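(* Let $(x_i)$ be a normalized weakly null basis for a Banach space $X$. Assume that $\ell_1$ does not embed isomorphically into $X$ and that whenever $(y_i)$ is a normalized weakly null block basis of $(x_i)$ with spreading model $(e_i)$, then $\|e_1-e_2\|=1$. Then some subsequence of $(x_i)$ is equivalent to the unit vector basis of $c_0$.
   Context: A normalized basic sequence $(e_i)$ is a spreading model of a sequence $(y_i)$ if for some $\varepsilon_n\downarrow 0$, for all $n$, all $(a_i)_{i=1}^n\subseteq[-1,1]$ and all positive integers $n\le k_1<\cdots<k_n$, $$\left|\Big\|\sum_{j=1}^n a_j y_{k_j}\Big\|-\Big\|\sum_{i=1}^n a_i e_i\Big\|\right|\le\varepsilon_n .$$ *)

theory Defs
  imports "HOL-Analysis.Analysis"
begin

text \<open>
  All spaces are real Banach spaces.  Sequences are indexed from \<open>0\<close>, so that the vector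
  written \<open>y\<^sub>k\<close> (\<open>k \<ge> 1\<close>) in the literature is \<open>y (k - 1)\<close> here.
\<close>

definition normalized :: "(nat \<Rightarrow> 'a::real_normed_vector) \<Rightarrow> bool"
  where "normalized y \<longleftrightarrow> (\<forall>i. norm (y i) = 1)"

definition weakly_null :: "(nat \<Rightarrow> 'a::real_normed_vector) \<Rightarrow> bool"
  where "weakly_null y \<longleftrightarrow>
    (\<forall>f :: 'a \<Rightarrow> real. bounded_linear f \<longrightarrow> (\<lambda>n. f (y n)) \<longlonglongrightarrow> 0)"

definition schauder_basis_of :: "'a::real_normed_vector set \<Rightarrow> (nat \<Rightarrow> 'a) \<Rightarrow> bool"
  where "schauder_basis_of S x \<longleftrightarrow>
    range x \<subseteq> S \<and> (\<forall>v\<in>S. \<exists>!a :: nat \<Rightarrow> real. (\<lambda>i. a i *\<^sub>R x i) sums v)"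

definition basic_sequence :: "(nat \<Rightarrow> 'a::real_normed_vector) \<Rightarrow> bool"
  where "basic_sequence x \<longleftrightarrow> schauder_basis_of (closure (span (range x))) x"

definition block_basis :: "(nat \<Rightarrow> 'a::real_normed_vector) \<Rightarrow> (nat \<Rightarrow> 'a) \<Rightarrow> bool"
  where "block_basis x y \<longleftrightarrow>
    (\<forall>i. y i \<noteq> 0) \<and>
    (\<exists>(p :: nat \<Rightarrow> nat) (b :: nat \<Rightarrow> real). strict_mono p \<and>
       (\<forall>i. y i = (\<Sum>j\<in>{p i..<p (Suc i)}. b j *\<^sub>R x j)))"

text \<open>
  Because of the index shift, the usual requirement \<open>n \<le> k\<^sub>1\<close> becomes \<open>n \<le> Suc (k 0)\<close>; as \<open>k\<close> is
  increasing this is the same as \<open>n \<le> Suc (k j)\<close> for all \<open>j < n\<close>.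
\<close>

definition spreading_model ::
    "(nat \<Rightarrow> 'a::real_normed_vector) \<Rightarrow> (nat \<Rightarrow> 'e::real_normed_vector) \<Rightarrow> bool"
  where "spreading_model y e \<longleftrightarrow>
    normalized e \<and> basic_sequence e \<and>
    (\<exists>\<epsilon> :: nat \<Rightarrow> real. decseq \<epsilon> \<and> \<epsilon> \<longlonglongrightarrow> 0 \<and>
      (\<forall>n\<ge>1. \<forall>(a :: nat \<Rightarrow> real) (k :: nat \<Rightarrow> nat).
         (\<forall>j<n. a j \<in> {-1..1}) \<and> strict_mono_on {..<n} k \<and> n \<le> Suc (k 0) \<longrightarrow>
         \<bar>norm (\<Sum>j<n. a j *\<^sub>R y (k j)) - norm (\<Sum>j<n. a j *\<^sub>R e j)\<bar> \<le> \<epsilon> n))"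

definition ell1 :: "(nat \<Rightarrow> real) set"
  where "ell1 = {a. summable (\<lambda>i. \<bar>a i\<bar>)}"

definition ell1_norm :: "(nat \<Rightarrow> real) \<Rightarrow> real"
  where "ell1_norm a = (\<Sum>i. \<bar>a i\<bar>)"

definition ell1_embeds_into :: "'a::real_normed_vector itself \<Rightarrow> bool"
  where "ell1_embeds_into (_ :: 'a itself) \<longleftrightarrow>
    (\<exists>T :: (nat \<Rightarrow> real) \<Rightarrow> 'a.
       (\<forall>a\<in>ell1. \<forall>b\<in>ell1. T (\<lambda>i. a i + b i) = T a + T b) \<and>
       (\<forall>r. \<forall>a\<in>ell1. T (\<lambda>i. r * a i) = r *\<^sub>R T a) \<and>
       (\<exists>c>0. \<exists>C>0. \<forall>a\<in>ell1.
          c * ell1_norm a \<le> norm (T a) \<and> norm (T a) \<le> C * ell1_norm a))"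

text \<open>
  Since the topology of \<open>nat\<close> is discrete, the type \<open>nat \<Rightarrow>\<^sub>C real\<close> of bounded continuous functions
  with the supremum norm is the Banach space of all bounded real sequences.
\<close>

type_synonym ell_infty = "nat \<Rightarrow>\<^sub>C real"

text \<open>
  The space of null sequences is a closed subspace of \<open>ell_infty\<close> with the inherited norm, so its
  unit vector basis can be taken in \<open>ell_infty\<close>.
\<close>

definition c0_unit :: "nat \<Rightarrow> ell_infty"
  where "c0_unit i = Bcontfun (\<lambda>n. if n = i then 1 else 0)"

lemma apply_c0_unit: "apply_bcontfun (c0_unit i) n = (if n = i then 1 else 0)"
proof -
  have "(\<lambda>n. if n = i then 1 else 0 :: real) \<in> bcontfun"
    by (rule bcontfun_normI[where b = 1]) (auto simp: continuous_on_discrete)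
  then show ?thesis
    by (simp add: c0_unit_def Bcontfun_inverse)
qed

definition equivalent_sequences ::
    "(nat \<Rightarrow> 'a::real_normed_vector) \<Rightarrow> (nat \<Rightarrow> 'b::real_normed_vector) \<Rightarrow> bool"
  where "equivalent_sequences x y \<longleftrightarrow>
    (\<exists>c>0. \<exists>C>0. \<forall>n. \<forall>a :: nat \<Rightarrow> real.
       c * norm (\<Sum>i<n. a i *\<^sub>R y i) \<le> norm (\<Sum>i<n. a i *\<^sub>R x i) \<and>
       norm (\<Sum>i<n. a i *\<^sub>R x i) \<le> C * norm (\<Sum>i<n. a i *\<^sub>R y i))"

text \<open>
  A spreading model of a sequence in \<open>X\<close> may live in any Banach space, and a hypothesis about all
  spreading models would quantify over types.  It is enough to let spreading models range over
  \<open>ell_infty\<close>: the closed span of a basic sequence is separable, every separable Banach space embeds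
  linearly and isometrically into \<open>ell_infty\<close>, and both \<^const>\<open>spreading_model\<close> and
  \<open>norm (e 0 - e 1)\<close> are invariant under such embeddings.
\<close>

end

theory Submission
  imports Defs "HOL-Library.Ramsey"
begin

text \<open>
  Suppose that no subsequence is equivalent to the unit vector basis of \<open>c\<^sub>0\<close>, and let \<open>C\<close> be the basis
  constant.  Ramsey arguments for infinite sets, in the spirit of Elton, give an infinite set \<open>M\<close> of
  indices such that along every infinite subset of \<open>M\<close> and for every choice of signs some partial sum
  has norm larger than \<open>2C\<close>.  Hence the tree of finite signed sequences in \<open>M\<close> all of whose partial sums
  have norm at most \<open>2C\<close> has no infinite branch, and by Koenig's lemma neither has the tree of all
  sequences that majorize the indices of such a signed sequence.

  Bar induction on the latter tree attaches to each node \<open>t\<close> a weakly null sequence of signed sums with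
  norms close to 1.  At a leaf this is a sequence of basis vectors.  At an inner node one takes, for
  each child of \<open>t\<close>, differences of two members of its sequence, whose norms stay close to 1 by the
  hypothesis on spreading models, and diagonalizes over the children; a diagonal sequence can be
  chosen weakly null because \<open>\<ell>\<^sub>1\<close> does not embed.  The difference of two members of the sequence at the
  root is a signed sum with partial sums bounded by \<open>2C\<close>, but it is so long that it yields a node
  of the tree that majorizes its indices and lies beyond every leaf.
\<close>

subsection \<open>Ramsey theory of infinite sets\<close>

text \<open>The hypothesis speaks of differences, so the vectors that are built carry signs, and
  boundedness has to be refuted for every choice of signs. The bound 2C arises because the final
  signed sum has norm at most 2 and its partial sums are basis projections of it.

  The rank of the tree may be infinite, so no error budget can be fixed in advance. Each node
  therefore serves every bound K > 1 and asks its children for a bound strictly between 1 and K.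

  A diagonal of weakly null sequences need not be weakly null; a failure would produce vectors on
  which functionals take large and small values in arbitrary patterns, hence a copy of l1. Moreover,
  diagonalization passes to a subsequence of the children and uses members far out in their
  sequences, so the coordinates cannot be prescribed. What survives is an inequality: on the way
  down, the marker naming a child exceeds the coordinates already passed. Hence the tree is closed
  under increasing entries; below a marker there are only finitely many coordinates, as Koenig's
  lemma requires.\<close>

lemma infinite_tail:
  fixes N :: "nat set"
  assumes "infinite N" "finite s"
  shows "infinite {k\<in>N. \<forall>i\<in>s. i < k}"
proof -
  have "N \<subseteq> {k\<in>N. \<forall>i\<in>s. i < k} \<union> (\<Union>i\<in>s. {..i})" by (auto simp: not_less)
  moreover have "finite (\<Union>i\<in>s. {..i})" using assms(2) by auto
  ultimately show ?thesis using assms(1) by (metis finite_Un finite_subset)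
qed

text \<open>Iterated shrinking: each set is replaced by a subset above its least element that meets
  the requirement indexed by the successor of that element, and \<open>M\<close> collects the least
  elements. The part of \<open>M\<close> beyond an element lies in the set chosen for it; index 0
  serves \<open>M\<close> itself.\<close>

lemma fusion:
  fixes Q :: "nat \<Rightarrow> nat set \<Rightarrow> bool"
  assumes mono: "\<And>m N M. Q m N \<Longrightarrow> M \<subseteq> N \<Longrightarrow> infinite M \<Longrightarrow> Q m M"
    and dense: "\<And>m N. infinite N \<Longrightarrow> \<exists>M\<subseteq>N. infinite M \<and> Q m M"
    and N: "infinite N"
  obtains M where "M \<subseteq> N" "infinite M" "\<And>m. m \<in> insert 0 (Suc ` M) \<Longrightarrow> Q m (M \<inter> {m..})"
proof -
  define R where "R A B \<longleftrightarrow> infinite B \<and> B \<subseteq> A \<inter> {Inf A<..} \<and> Q (Suc (Inf A)) B" for A B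
  have R: "\<exists>B. R A B" if "infinite A" for A
  proof -
    have "infinite (A \<inter> {Inf A<..})"
      using that by (metis finite_atMost Compl_atMost finite_Diff2 Diff_eq)
    from dense[OF this, of "Suc (Inf A)"] show ?thesis
      by (auto simp: R_def)
  qed
  obtain N0 where N0: "N0 \<subseteq> N" "infinite N0" "Q 0 N0"
    using dense[OF N] by blast
  obtain F where F: "F 0 = N0" "\<And>n. infinite (F n)" "\<And>n. R (F n) (F (Suc n))"
    using dependent_nat_choice[of "\<lambda>n A. infinite A \<and> (n = 0 \<longrightarrow> A = N0)" "\<lambda>n. R"] R N0
    by (metis R_def nat.distinct(1))
  have dec: "F j \<subseteq> F i" if "i \<le> j" for i j
    using that by (induction rule: dec_induct) (use F(3) in \<open>auto simp: R_def\<close>)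
  define f where "f n = Inf (F n)" for n
  have fin: "f n \<in> F n" for n
    unfolding f_def using F(2) by (metis Inf_nat_def1 infinite_imp_nonempty)
  have later: "f n < k" if "k \<in> F m" "n < m" for n m k
  proof -
    have "k \<in> F (Suc n)"
      using dec[of "Suc n" m] that by auto
    then show ?thesis
      using F(3)[of n] by (auto simp: R_def f_def)
  qed
  have sm: "strict_mono f"
    using later fin by (auto simp: strict_mono_def)
  show ?thesis
  proof
    show "range f \<subseteq> N"
      using fin dec[of 0] N0 F(1) by auto
    show inf: "infinite (range f)"
      using sm by (simp add: range_inj_infinite strict_mono_imp_inj_on)
    fix m assume "m \<in> insert 0 (Suc ` range f)"
    then consider "m = 0" | n where "m = Suc (f n)" by auto
    then show "Q m (range f \<inter> {m..})"
    proof cases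
      case 1
      moreover have "range f \<subseteq> N0"
        using fin dec[of 0] F(1) by auto
      ultimately show ?thesis
        using mono[OF N0(3)] inf by simp
    next
      case 2
      have sub: "range f \<inter> {m..} \<subseteq> F (Suc n)"
      proof
        fix k assume "k \<in> range f \<inter> {m..}"
        then obtain j where "k = f j" "f n < f j" using 2 by auto
        then have "n < j" using sm strict_mono_less by blast
        then show "k \<in> F (Suc n)"
          using fin[of j] dec[of "Suc n" j] \<open>k = f j\<close> by auto
      qed
      have "infinite (range f \<inter> {m..})"
        using inf by (metis finite_lessThan Compl_lessThan finite_Diff2 Diff_eq)
      then show ?thesis
        using mono[OF _ sub] F(3)[of n] 2 by (auto simp: R_def f_def)
    qed
  qed
qed

lemma finite_dense_conj:
  fixes Q :: "'i \<Rightarrow> nat set \<Rightarrow> bool"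
  assumes "finite I"
    and mono: "\<And>i N M. i \<in> I \<Longrightarrow> Q i N \<Longrightarrow> M \<subseteq> N \<Longrightarrow> infinite M \<Longrightarrow> Q i M"
    and dense: "\<And>i N. i \<in> I \<Longrightarrow> infinite N \<Longrightarrow> \<exists>M\<subseteq>N. infinite M \<and> Q i M"
    and "infinite N"
  shows "\<exists>M\<subseteq>N. infinite M \<and> (\<forall>i\<in>I. Q i M)"
  using assms(1) mono dense
proof (induction rule: finite_induct)
  case empty
  then show ?case using \<open>infinite N\<close> by blast
next
  case (insert i I)
  obtain M where M: "M \<subseteq> N" "infinite M" "\<forall>j\<in>I. Q j M"
    using insert.IH insert.prems by (metis insertCI)
  obtain M' where M': "M' \<subseteq> M" "infinite M'" "Q i M'"
    using insert.prems(2)[of i M] M(2) by auto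
  have "Q j M'" if "j \<in> I" for j
    using insert.prems(1)[of j M M'] M M' that by auto
  then show ?case using M M' by (metis insertE order_trans)
qed

text \<open>Only finitely many sets lie below a given bound, so their requirements can be met
  together; \<open>s\<close> is served at the stage of its largest element.\<close>

lemma fusion_finite_subsets:
  fixes Q :: "nat set \<Rightarrow> nat set \<Rightarrow> bool"
  assumes mono: "\<And>s N M. Q s N \<Longrightarrow> M \<subseteq> N \<Longrightarrow> infinite M \<Longrightarrow> Q s M"
    and dense: "\<And>s N. finite s \<Longrightarrow> infinite N \<Longrightarrow> \<exists>M\<subseteq>N. infinite M \<and> Q s M"
    and N: "infinite N"
  obtains M where "M \<subseteq> N" "infinite M"
    "\<And>s. finite s \<Longrightarrow> s \<subseteq> M \<Longrightarrow> Q s {k\<in>M. \<forall>i\<in>s. i < k}"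
proof -
  define Q' where "Q' m K \<longleftrightarrow> (\<forall>s\<in>Pow {..<m}. Q s K)" for m K
  obtain M where M: "M \<subseteq> N" "infinite M" "\<And>m. m \<in> insert 0 (Suc ` M) \<Longrightarrow> Q' m (M \<inter> {m..})"
  proof (rule fusion[of Q', OF _ _ N])
    show "Q' m N \<Longrightarrow> M \<subseteq> N \<Longrightarrow> infinite M \<Longrightarrow> Q' m M" for m N M
      unfolding Q'_def using mono by blast
    show "\<exists>M\<subseteq>N. infinite M \<and> Q' m M" if "infinite N" for m N
      unfolding Q'_def
      by (rule finite_dense_conj[OF _ _ _ that]) (auto intro: mono dense finite_subset)
  qed blast
  show ?thesis
  proof (rule that[OF M(1,2)])
    fix s assume s: "finite s" "s \<subseteq> M"
    define m where "m = (if s = {} then 0 else Suc (Max s))"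
    have "m \<in> insert 0 (Suc ` M)"
      using s by (auto simp: m_def dest: Max_in)
    from M(3)[OF this] have "\<forall>t\<in>Pow {..<m}. Q t (M \<inter> {m..})"
      by (simp add: Q'_def)
    moreover have "s \<subseteq> {..<m}"
      using s by (auto simp: m_def less_Suc_eq_le)
    ultimately have "Q s (M \<inter> {m..})"
      by blast
    moreover have "m \<le> k \<longleftrightarrow> (\<forall>i\<in>s. i < k)" for k
      using s(1) by (cases "s = {}") (simp_all add: m_def Suc_le_eq)
    then have "M \<inter> {m..} = {k\<in>M. \<forall>i\<in>s. i < k}"
      by auto
    ultimately show "Q s {k\<in>M. \<forall>i\<in>s. i < k}" by simp
  qed
qed

text \<open>Acceptance and rejection: \<open>M\<close> accepts \<open>s\<close> if every
  continuation of \<open>s\<close> inside \<open>M\<close> runs through a member of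
  \<open>\<G>\<close>, and rejects \<open>s\<close> if no infinite subset of \<open>M\<close>
  accepts it. One fusion makes every finite subset decided. If the empty set is rejected, a second
  one makes rejection pass to all finite subsets, whereas members of \<open>\<G>\<close> are always
  accepted.\<close>

theorem Galvin:
  fixes \<G> :: "nat set set"
  assumes N: "infinite N"
  obtains (avoids) M where "M \<subseteq> N" "infinite M" "\<And>s. finite s \<Longrightarrow> s \<subseteq> M \<Longrightarrow> s \<notin> \<G>"
  | (catches) M where "M \<subseteq> N" "infinite M" "\<And>K. infinite K \<Longrightarrow> K \<subseteq> M \<Longrightarrow> \<exists>n. K \<inter> {..<n} \<in> \<G>"
proof -
  define acc where "acc s M \<longleftrightarrow>
    (\<forall>K. infinite K \<and> K \<subseteq> M \<and> (\<forall>i\<in>s. \<forall>k\<in>K. i < k) \<longrightarrow> (\<exists>n. (s \<union> K) \<inter> {..<n} \<in> \<G>))" for s M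
  define rej where "rej s M \<longleftrightarrow> (\<forall>K. infinite K \<and> K \<subseteq> M \<longrightarrow> \<not> acc s K)" for s M
  have acc_mono: "acc s M'" if "acc s M" "M' \<subseteq> M" for s M M'
    using that unfolding acc_def by blast
  have rej_mono: "rej s M'" if "rej s M" "M' \<subseteq> M" for s M M'
    using that unfolding rej_def by blast
  have acc_tail: "acc s M" if "acc s {k\<in>M. \<forall>i\<in>s. i < k}" for s M
    using that unfolding acc_def by (smt (verit) mem_Collect_eq subset_iff)
  have rej_tail: "rej s M" if "rej s {k\<in>M. \<forall>i\<in>s. i < k}" "finite s" for s M
    unfolding rej_def
  proof (intro allI impI notI)
    fix K assume K: "infinite K \<and> K \<subseteq> M" "acc s K"
    have "infinite {k\<in>K. \<forall>i\<in>s. i < k}" using infinite_tail K that by blast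
    moreover have "acc s {k\<in>K. \<forall>i\<in>s. i < k}" using acc_mono K by auto
    moreover have "{k\<in>K. \<forall>i\<in>s. i < k} \<subseteq> {k\<in>M. \<forall>i\<in>s. i < k}" using K by auto
    ultimately show False using that(1) unfolding rej_def by blast
  qed
  obtain M where M: "M \<subseteq> N" "infinite M"
    and dec': "\<And>s. finite s \<Longrightarrow> s \<subseteq> M \<Longrightarrow>
      acc s {k\<in>M. \<forall>i\<in>s. i < k} \<or> rej s {k\<in>M. \<forall>i\<in>s. i < k}"
  proof (rule fusion_finite_subsets[of "\<lambda>s M. acc s M \<or> rej s M", OF _ _ N])
    show "acc s N \<or> rej s N \<Longrightarrow> M \<subseteq> N \<Longrightarrow> infinite M \<Longrightarrow> acc s M \<or> rej s M" for s N M
      using acc_mono rej_mono by blast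
    show "\<exists>M\<subseteq>N. infinite M \<and> (acc s M \<or> rej s M)" if "infinite N" for s N
      using that unfolding rej_def by blast
  qed blast
  have dec: "acc s M \<or> rej s M" if "finite s" "s \<subseteq> M" for s
    using dec'[OF that] acc_tail rej_tail that by blast
  show ?thesis
  proof (cases "acc {} M")
    case True
    then show ?thesis using M catches by (auto simp: acc_def)
  next
    case False
    then have rej0: "rej {} M" using dec by blast
    \<comment> \<open>Otherwise the accepted one-point extensions form an infinite set that accepts
      \<open>s\<close> itself: a continuation inside it begins with its least point
      \<open>m\<close>, and \<open>insert m s\<close> is accepted.\<close>
    have step: "finite {m\<in>M. (\<forall>i\<in>s. i < m) \<and> \<not> rej (insert m s) M}"
      if s: "finite s" "s \<subseteq> M" "rej s M" for s
    proof (rule ccontr)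
      define M' where "M' = {m\<in>M. (\<forall>i\<in>s. i < m) \<and> \<not> rej (insert m s) M}"
      assume "infinite {m\<in>M. (\<forall>i\<in>s. i < m) \<and> \<not> rej (insert m s) M}"
      then have inf: "infinite M'" by (simp add: M'_def)
      have "acc s M'"
        unfolding acc_def
      proof (intro allI impI)
        fix K assume K: "infinite K \<and> K \<subseteq> M' \<and> (\<forall>i\<in>s. \<forall>k\<in>K. i < k)"
        define m where "m = Inf K"
        have mK: "m \<in> K" unfolding m_def using K by (metis Inf_nat_def1 infinite_imp_nonempty)
        then have "acc (insert m s) M"
          using K dec[of "insert m s"] s by (auto simp: M'_def)
        moreover have "infinite (K - {m})" using K by simp
        moreover have "K - {m} \<subseteq> M" using K by (auto simp: M'_def)
        moreover have "\<forall>k\<in>K. m \<le> k"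
          unfolding m_def by (simp add: wellorder_Inf_le1)
        then have "\<forall>i\<in>insert m s. \<forall>k\<in>K-{m}. i < k"
          using K by (metis Diff_iff insertE insertI1 order_le_less)
        ultimately have "\<exists>n. (insert m s \<union> (K - {m})) \<inter> {..<n} \<in> \<G>"
          unfolding acc_def by blast
        then show "\<exists>n. (s \<union> K) \<inter> {..<n} \<in> \<G>"
          using mK by (metis Un_insert_left Un_insert_right insert_Diff)
      qed
      moreover have "M' \<subseteq> M" by (auto simp: M'_def)
      ultimately show False using s(3) inf unfolding rej_def by blast
    qed
    define Q where "Q s K \<longleftrightarrow> (rej s M \<and> s \<subseteq> M \<longrightarrow>
        (\<forall>m\<in>K \<inter> M. (\<forall>i\<in>s. i < m) \<longrightarrow> rej (insert m s) M))" for s K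
    obtain P where P: "P \<subseteq> M" "infinite P"
      and QP: "\<And>s. finite s \<Longrightarrow> s \<subseteq> P \<Longrightarrow> Q s {k\<in>P. \<forall>i\<in>s. i < k}"
    proof (rule fusion_finite_subsets[of Q, OF _ _ M(2)])
      show "Q s N \<Longrightarrow> M \<subseteq> N \<Longrightarrow> infinite M \<Longrightarrow> Q s M" for s N M
        unfolding Q_def by blast
      fix s K :: "nat set" assume sK: "finite s" "infinite K"
      show "\<exists>L\<subseteq>K. infinite L \<and> Q s L"
      proof (cases "rej s M \<and> s \<subseteq> M")
        case True
        then show ?thesis
          using step[of s] sK unfolding Q_def
          by (intro exI[of _ "K - {m\<in>M. (\<forall>i\<in>s. i < m) \<and> \<not> rej (insert m s) M}"]) auto
      qed (use sK in \<open>auto simp: Q_def\<close>)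
    qed blast
    have rejP: "s \<subseteq> P \<longrightarrow> rej s M" if "finite s" for s
      using that
    proof (induction rule: finite_linorder_max_induct)
      case empty
      then show ?case using rej0 by simp
    next
      case (insert b A)
      show ?case
      proof
        assume bA: "insert b A \<subseteq> P"
        then have "rej A M" "A \<subseteq> M" "b \<in> {k\<in>P. \<forall>i\<in>A. i < k} \<inter> M" "\<forall>i\<in>A. i < b"
          using insert P(1) by auto
        then show "rej (insert b A) M"
          using QP[OF insert.hyps(1)] bA unfolding Q_def by blast
      qed
    qed
    show ?thesis
    proof (rule avoids[of P])
      fix s assume s: "finite s" "s \<subseteq> P"
      show "s \<notin> \<G>"
      proof
        assume G: "s \<in> \<G>"
        \<comment> \<open>Cutting at the least element of \<open>K\<close> gives back
          \<open>s\<close>, which lies in \<open>\<G>\<close>.\<close>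
        have "acc s M"
          unfolding acc_def
        proof (intro allI impI)
          fix K assume K: "infinite K \<and> K \<subseteq> M \<and> (\<forall>i\<in>s. \<forall>k\<in>K. i < k)"
          have "(s \<union> K) \<inter> {..<Inf K} = s"
          proof -
            have "Inf K \<in> K" using K by (metis Inf_nat_def1 infinite_imp_nonempty)
            then have "s \<subseteq> {..<Inf K}" using K by auto
            moreover have "K \<inter> {..<Inf K} = {}" using wellorder_Inf_le1 not_less by blast
            ultimately show ?thesis by auto
          qed
          then show "\<exists>n. (s \<union> K) \<inter> {..<n} \<in> \<G>" using G by metis
        qed
        then show False using rejP s M unfolding rej_def by blast
      qed
    qed (use P M in auto)
  qed
qed

subsection \<open>Functionals of norm at most one\<close>

definition dual_ball :: "('a::real_normed_vector \<Rightarrow> real) set"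
  where "dual_ball = {f. linear f \<and> (\<forall>v. \<bar>f v\<bar> \<le> norm v)}"

lemma dual_ball_bounded_linear: "f \<in> dual_ball \<Longrightarrow> bounded_linear f"
  unfolding dual_ball_def bounded_linear_def bounded_linear_axioms_def
  by (auto intro!: exI[of _ 1])

lemma dual_ball_linear: "f \<in> dual_ball \<Longrightarrow> linear f"
  and dual_ball_le: "f \<in> dual_ball \<Longrightarrow> \<bar>f v\<bar> \<le> norm v"
  by (auto simp: dual_ball_def)

lemma dual_ball_uminus: "f \<in> dual_ball \<Longrightarrow> (\<lambda>v. - f v) \<in> dual_ball"
  by (auto simp: dual_ball_def intro: linear_compose_neg)

text \<open>The minimal sublinear functionals are linear, so Zorn's lemma yields Hahn-Banach without any
  extension from subspaces.\<close>

definition subl :: "('a::real_normed_vector \<Rightarrow> real) set"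
  where "subl = {p. (\<forall>v w. p (v + w) \<le> p v + p w) \<and> (\<forall>c v. 0 \<le> c \<longrightarrow> p (c *\<^sub>R v) = c * p v) \<and>
    (\<forall>v. p v \<le> norm v)}"

lemma subl_lower:
  assumes "p \<in> subl"
  shows "- norm v \<le> p v"
proof -
  have "p 0 = 0"
    using assms unfolding subl_def by (metis (mono_tags, lifting) mem_Collect_eq mult_zero_left order_refl scale_zero_left)
  moreover have "p (v + - v) \<le> p v + p (- v)" "p (- v) \<le> norm (- v)"
    using assms unfolding subl_def by blast+
  ultimately show ?thesis by simp
qed

text \<open>\<open>p\<close> is pushed down in direction \<open>v\<close>, to the infimum over t >=
  0 of p (w + t v) - t p v. The result is sublinear again, and t = 1 gives the last inequality,
  which at w = - v reads q (- v) <= - p v.\<close>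

lemma subl_below:
  assumes p: "p \<in> subl"
  obtains q where "q \<in> subl" "\<And>w. q w \<le> p w" "\<And>w. q w \<le> p (w + v) - p v"
proof -
  define q where "q w = (INF t\<in>{0..}. p (w + t *\<^sub>R v) - t * p v)" for w
  have tri: "p (x + y) \<le> p x + p y" for x y
    using p unfolding subl_def by blast
  have hom: "p (c *\<^sub>R x) = c * p x" if "0 \<le> c" for c x
    using p that unfolding subl_def by blast
  have p0: "p 0 = 0"
    using hom[of 0 0] by simp
  have low: "- p (- w) \<le> p (w + t *\<^sub>R v) - t * p v" if "0 \<le> t" for w t
    using tri[of "w + t *\<^sub>R v" "- w"] hom[OF that] by (simp add: algebra_simps)
  have bdd: "bdd_below ((\<lambda>t. p (w + t *\<^sub>R v) - t * p v) ` {0..})" for w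
    using low by (intro bdd_belowI[of _ "- p (- w)"]) auto
  have le: "q w \<le> p (w + t *\<^sub>R v) - t * p v" if "0 \<le> t" for w t
    unfolding q_def using bdd that by (intro cINF_lower) auto
  have geI: "c \<le> q w" if "\<And>t. 0 \<le> t \<Longrightarrow> c \<le> p (w + t *\<^sub>R v) - t * p v" for c w
    unfolding q_def using that by (intro cINF_greatest) auto
  have qp: "q w \<le> p w" for w
    using le[of 0 w] by simp
  have add: "q (x + y) \<le> q x + q y" for x y
  proof -
    have "q (x + y) - (p (x + t *\<^sub>R v) - t * p v) \<le> q y" if t: "0 \<le> t" for t
    proof (rule geI)
      fix s :: real assume "0 \<le> s"
      then have "q (x + y) \<le> p (x + y + (s + t) *\<^sub>R v) - (s + t) * p v"
        using t by (intro le) auto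
      also have "p (x + y + (s + t) *\<^sub>R v) \<le> p (x + t *\<^sub>R v) + p (y + s *\<^sub>R v)"
        using tri[of "x + t *\<^sub>R v" "y + s *\<^sub>R v"] by (simp add: algebra_simps)
      finally show "q (x + y) - (p (x + t *\<^sub>R v) - t * p v) \<le> p (y + s *\<^sub>R v) - s * p v"
        by (simp add: algebra_simps)
    qed
    then have "q (x + y) - q y \<le> q x"
      by (intro geI) (simp add: algebra_simps)
    then show ?thesis by simp
  qed
  have q0: "q 0 = 0"
  proof (rule antisym)
    show "0 \<le> q 0"
      by (rule geI) (simp add: hom)
  qed (use qp[of 0] p0 in simp)
  have homq_le: "q (c *\<^sub>R w) \<le> c * q w" if c: "0 < c" for c w
  proof -
    have "q (c *\<^sub>R w) / c \<le> q w"
    proof (rule geI)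
      fix t :: real assume t: "0 \<le> t"
      have "q (c *\<^sub>R w) \<le> p (c *\<^sub>R w + (c * t) *\<^sub>R v) - (c * t) * p v"
        using c t by (intro le) auto
      also have "\<dots> = c * (p (w + t *\<^sub>R v) - t * p v)"
        using hom[of c "w + t *\<^sub>R v"] c by (simp add: algebra_simps)
      finally show "q (c *\<^sub>R w) / c \<le> p (w + t *\<^sub>R v) - t * p v"
        using c by (simp add: field_simps)
    qed
    then show ?thesis using c by (simp add: field_simps)
  qed
  have homq: "q (c *\<^sub>R w) = c * q w" if c: "0 \<le> c" for c w
  proof (cases "c = 0")
    case False
    then have "q w \<le> inverse c * q (c *\<^sub>R w)"
      using homq_le[of "inverse c" "c *\<^sub>R w"] c by simp
    then show ?thesis
      using homq_le[of c w] False c by (simp add: field_simps)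
  qed (simp add: q0)
  show ?thesis
  proof (rule that)
    show "q \<in> subl"
      using add homq qp p unfolding subl_def by (blast intro: order_trans)
    show "q w \<le> p (w + v) - p v" for w
      using le[of 1 w] by simp
  qed (rule qp)
qed

text \<open>Minimality forces the functional from \<open>subl_below\<close> to coincide with
  \<open>p\<close>, which reverses the subadditivity inequality.\<close>

lemma minimal_subl_linear:
  assumes p: "p \<in> subl" and min: "\<And>q. q \<in> subl \<Longrightarrow> (\<And>w. q w \<le> p w) \<Longrightarrow> q = p"
  shows "linear p"
proof -
  have tri: "p (x + y) \<le> p x + p y" for x y
    using p unfolding subl_def by blast
  have hom: "p (c *\<^sub>R x) = c * p x" if "0 \<le> c" for c x
    using p that unfolding subl_def by blast
  have add: "p (x + y) = p x + p y" for x y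
  proof -
    obtain q where "q \<in> subl" "\<And>w. q w \<le> p w" "\<And>w. q w \<le> p (w + y) - p y"
      using subl_below[OF p, of y] by blast
    then have "p x \<le> p (x + y) - p y" using min by blast
    then show ?thesis using tri[of x y] by simp
  qed
  have "p 0 = 0" using hom[of 0 0] by simp
  then have neg: "p (- x) = - p x" for x
    using add[of x "- x"] by simp
  have "p (c *\<^sub>R x) = c * p x" for c x
    using hom[of c x] hom[of "- c" x] neg[of "c *\<^sub>R x"] by (cases "0 \<le> c") auto
  with add show ?thesis by (intro linearI) auto
qed

lemma exists_linear_below_subl:
  assumes p: "p \<in> subl"
  obtains f where "f \<in> dual_ball" "\<And>w. f w \<le> p w"
proof -
  define A where "A = {q\<in>subl. \<forall>w. q w \<le> p w}"
  \<comment> \<open>The order is reversed, so that Zorn's maximal element is a pointwise minimal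
    functional.\<close>
  define P where "P q r \<longleftrightarrow> (\<forall>w. r w \<le> q w)" for q r :: "'a \<Rightarrow> real"
  have "\<exists>m\<in>A. \<forall>a\<in>A. P m a \<longrightarrow> a = m"
  proof (rule predicate_Zorn)
    show "partial_order_on A (relation_of P A)"
      by (rule partial_order_on_relation_ofI) (auto simp: P_def intro: order_trans intro!: ext antisym)
    fix C assume C: "C \<in> Chains (relation_of P A)"
    then have CA: "C \<subseteq> A" and tot: "\<And>a b. a \<in> C \<Longrightarrow> b \<in> C \<Longrightarrow> P a b \<or> P b a"
      by (auto simp: Chains_def relation_of_def)
    show "\<exists>u\<in>A. \<forall>a\<in>C. P a u"
    proof (cases "C = {}")
      case True
      then show ?thesis using p by (auto simp: A_def)
    next
      case ne: False
      define u where "u w = (INF q\<in>C. q w)" for w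
      have sub: "q \<in> subl" "q w \<le> p w" if "q \<in> C" for q w
        using CA that by (auto simp: A_def)
      have bdd: "bdd_below ((\<lambda>q. q w) ` C)" for w
        using subl_lower[OF sub(1)] by (intro bdd_belowI[of _ "- norm w"]) auto
      have le: "u w \<le> q w" if "q \<in> C" for q w
        unfolding u_def using bdd that by (intro cINF_lower)
      have geI: "c \<le> u w" if "\<And>q. q \<in> C \<Longrightarrow> c \<le> q w" for c w
        unfolding u_def using that ne by (intro cINF_greatest) auto
      have "u (v + w) \<le> u v + u w" for v w
      proof -
        have "u (v + w) - q v \<le> u w" if q: "q \<in> C" for q
        proof (rule geI)
          fix r assume r: "r \<in> C"
          have tri: "s (v + w) \<le> s v + s w" if "s \<in> C" for s
            using sub(1)[OF that] by (simp add: subl_def)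
          \<comment> \<open>The two infima are tested at different members \<open>q\<close> and
            \<open>r\<close>; the smaller of them serves for both. This is where the chain condition
            enters.\<close>
          from tot[OF q r] show "u (v + w) - q v \<le> r w"
          proof
            assume "P q r"
            then have "r v \<le> q v" by (simp add: P_def)
            then show ?thesis using le[OF r, of "v + w"] tri[OF r] by simp
          next
            assume "P r q"
            then have "q w \<le> r w" by (simp add: P_def)
            then show ?thesis using le[OF q, of "v + w"] tri[OF q] by simp
          qed
        qed
        then have "u (v + w) - u w \<le> u v"
          by (intro geI) (simp add: algebra_simps)
        then show ?thesis by simp
      qed
      moreover have "u (c *\<^sub>R v) = c * u v" if c: "0 \<le> c" for c v
      proof (cases "c = 0")
        case True
        have "q 0 = 0" if "q \<in> C" for q
          using sub(1)[OF that] unfolding subl_def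
          by (metis (mono_tags, lifting) mem_Collect_eq mult_zero_left order_refl scale_zero_left)
        then have "(\<lambda>q. q 0) ` C = {0}" using ne by (auto simp: image_def)
        then show ?thesis using True by (simp add: u_def)
      next
        case False
        have hom: "q (c *\<^sub>R v) = c * q v" if "q \<in> C" for q
          using sub(1)[OF that] c by (simp add: subl_def)
        show ?thesis
        proof (rule antisym)
          have "u (c *\<^sub>R v) / c \<le> u v"
            using le[where w = "c *\<^sub>R v"] hom c False by (intro geI) (simp add: field_simps)
          then show "u (c *\<^sub>R v) \<le> c * u v" using c False by (simp add: field_simps)
          show "c * u v \<le> u (c *\<^sub>R v)"
            using mult_left_mono[OF le c, of _ v] hom by (intro geI) simp
        qed
      qed
      moreover have "u w \<le> p w" for w
        using ne le sub(2) by (metis ex_in_conv order_trans)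
      ultimately have "u \<in> A"
        using p unfolding A_def subl_def by (blast intro: order_trans)
      then show ?thesis using le by (auto simp: P_def)
    qed
  qed
  then obtain f where f: "f \<in> subl" "\<And>w. f w \<le> p w"
    and min: "\<And>q. q \<in> A \<Longrightarrow> (\<And>w. q w \<le> f w) \<Longrightarrow> q = f"
    by (auto simp: A_def P_def)
  have "linear f"
    by (rule minimal_subl_linear[OF f(1)]) (rule min, auto simp: A_def intro: order_trans f(2))
  moreover have "\<bar>f v\<bar> \<le> norm v" for v
    using f(1) subl_lower[OF f(1), of v] by (auto simp: subl_def abs_le_iff minus_le_iff)
  ultimately show ?thesis
    using f(2) by (intro that) (auto simp: dual_ball_def)
qed

text \<open>Zorn's lemma is started not at the norm but at the norm pushed down in direction
  \<open>v\<close>, which already forces f (- v) <= - norm v.\<close>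

theorem Hahn_Banach_norming:
  fixes v :: "'a::real_normed_vector"
  obtains f where "f \<in> dual_ball" "f v = norm v"
proof -
  have "norm \<in> (subl :: ('a \<Rightarrow> real) set)"
    by (auto simp: subl_def norm_triangle_ineq)
  from subl_below[OF this, of "v"] obtain q :: "'a \<Rightarrow> real"
    where q: "q \<in> subl" "\<And>w. q w \<le> norm (w + v) - norm v" by metis
  obtain f where f: "f \<in> dual_ball" "\<And>w. f w \<le> q w"
    using exists_linear_below_subl[OF q(1)] by metis
  have "f (- v) \<le> - norm v"
    using f(2)[of "- v"] q(2)[of "- v"] by simp
  then have "norm v \<le> f v"
    using linear_neg[OF dual_ball_linear[OF f(1)]] by simp
  then have "f v = norm v"
    using dual_ball_le[OF f(1), of v] by linarith
  with f(1) show ?thesis by (rule that)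
qed

lemma norm_le_if_dual_ball:
  assumes "\<And>f. f \<in> dual_ball \<Longrightarrow> f v \<le> c"
  shows "norm v \<le> c"
  using Hahn_Banach_norming[of v] assms by metis

text \<open>Banach-Alaoglu: pointwise linear identities cut a closed set out of a product of compact
  intervals.\<close>

lemma compact_dual_ball: "compact (dual_ball :: ('a::real_normed_vector \<Rightarrow> real) set)"
proof -
  have 1: "compact (PiE UNIV (\<lambda>v::'a. {- norm v..norm v}))"
    using compactin_PiE[of "\<lambda>_::'a. euclidean :: real topology" UNIV "\<lambda>v. {- norm v..norm v}"]
    by (simp add: euclidean_product_topology)
  have ev: "continuous_on UNIV (\<lambda>f::'a \<Rightarrow> real. f v)" for v
    by (intro continuous_on_product_coordinates)
  have "closed {f :: 'a \<Rightarrow> real. f (v + w) = f v + f w}" for v w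
    by (intro closed_Collect_eq continuous_on_add ev)
  moreover have "closed {f :: 'a \<Rightarrow> real. f (c *\<^sub>R v) = c *\<^sub>R f v}" for c v
    by (intro closed_Collect_eq continuous_on_scaleR continuous_on_const ev)
  ultimately have 2: "closed ((\<Inter>v w. {f :: 'a \<Rightarrow> real. f (v + w) = f v + f w}) \<inter>
      (\<Inter>c v. {f. f (c *\<^sub>R v) = c *\<^sub>R f v}))"
    by (intro closed_Int closed_INT) auto
  have "dual_ball = PiE UNIV (\<lambda>v::'a. {- norm v..norm v}) \<inter>
      ((\<Inter>v w. {f :: 'a \<Rightarrow> real. f (v + w) = f v + f w}) \<inter> (\<Inter>c v. {f. f (c *\<^sub>R v) = c *\<^sub>R f v}))"
    by (auto simp: dual_ball_def linear_iff PiE_def abs_le_iff minus_le_iff)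
  then show ?thesis using compact_Int_closed[OF 1 2] by simp
qed

text \<open>A uniform version of weak nullity: not one index for all functionals, but finitely many
  indices among which each functional finds a small value. If no \<open>J\<close> worked,
  compactness would give one functional that is large at every term.\<close>

lemma weakly_null_dual_ball_bound:
  fixes z :: "nat \<Rightarrow> 'a::real_normed_vector"
  assumes z: "weakly_null z" and \<delta>: "0 < \<delta>"
  obtains J where "\<And>f. f \<in> dual_ball \<Longrightarrow> \<exists>j<J. \<bar>f (z j)\<bar> < \<delta>"
proof (rule ccontr)
  assume "\<not> thesis"
  then have neg: "\<exists>f\<in>dual_ball. \<forall>j<J. \<delta> \<le> \<bar>f (z j)\<bar>" for J
    using that by (metis not_less)
  define C where "C j = {f :: 'a \<Rightarrow> real. \<delta> \<le> \<bar>f (z j)\<bar>}" for j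
  have cl: "closed (C j)" for j
    unfolding C_def by (intro closed_Collect_le continuous_intros continuous_on_product_coordinates)
  have "dual_ball \<inter> \<Inter>(range C) \<noteq> {}"
  proof (rule compact_imp_fip[OF compact_dual_ball])
    fix F assume F: "finite F" "F \<subseteq> range C"
    then obtain I where I: "finite I" "F = C ` I" by (metis finite_subset_image)
    obtain J where "I \<subseteq> {..<J}" using I(1) finite_nat_iff_bounded by blast
    moreover obtain f where "f \<in> dual_ball" "\<forall>j<J. \<delta> \<le> \<bar>f (z j)\<bar>" using neg by blast
    ultimately have "f \<in> dual_ball \<inter> \<Inter>F" using I by (auto simp: C_def)
    then show "dual_ball \<inter> \<Inter>F \<noteq> {}" by blast
  qed (use cl in auto)
  then obtain f where f: "f \<in> dual_ball" "\<And>j. \<delta> \<le> \<bar>f (z j)\<bar>" by (auto simp: C_def)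
  have "(\<lambda>n. f (z n)) \<longlonglongrightarrow> 0"
    using z dual_ball_bounded_linear[OF f(1)] by (simp add: weakly_null_def)
  from LIMSEQ_D[OF this \<delta>] obtain n where "\<bar>f (z n)\<bar> < \<delta>" by auto
  then show False using f(2)[of n] by simp
qed

subsection \<open>Bases and basic sequences\<close>

lemma span_range_eq_sum:
  fixes e :: "nat \<Rightarrow> 'e::real_normed_vector"
  assumes "v \<in> span (range e)"
  obtains a n where "v = (\<Sum>i<n. a i *\<^sub>R e i)" "\<And>i. n \<le> i \<Longrightarrow> a i = 0"
proof -
  have "\<exists>a n. v = (\<Sum>i<n. a i *\<^sub>R e i) \<and> (\<forall>i\<ge>n. a i = 0)"
    using assms
  proof (induction rule: span_induct_alt)
    case base
    then show ?case by (intro exI[of _ "\<lambda>_. 0"] exI[of _ 0]) auto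
  next
    case (step c x y)
    then obtain a n k where y: "y = (\<Sum>i<n. a i *\<^sub>R e i)" "\<forall>i\<ge>n. a i = 0" "x = e k" by auto
    define N where "N = max n (Suc k)"
    have "y = (\<Sum>i<N. a i *\<^sub>R e i)"
      unfolding y(1) using y(2) by (intro sum.mono_neutral_left) (auto simp: N_def)
    moreover have "(\<Sum>i<N. (a i + (if i = k then c else 0)) *\<^sub>R e i) =
        (\<Sum>i<N. a i *\<^sub>R e i) + (\<Sum>i<N. if i = k then c *\<^sub>R e i else 0)"
      unfolding sum.distrib[symmetric] by (intro sum.cong) (auto simp: algebra_simps)
    ultimately have "c *\<^sub>R x + y = (\<Sum>i<N. (a i + (if i = k then c else 0)) *\<^sub>R e i)"
      using y(3) by (simp add: N_def less_max_iff_disj)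
    moreover have "\<forall>i\<ge>N. a i + (if i = k then c else 0) = 0"
      using y(2) by (auto simp: N_def)
    ultimately show ?case by (intro exI[of _ "\<lambda>i. a i + (if i = k then c else 0)"] exI[of _ N]) auto
  qed
  then show ?thesis using that by blast
qed

lemma basis_inequality_coeff:
  fixes e :: "nat \<Rightarrow> 'e::real_normed_vector"
  assumes C: "\<And>a m n. m \<le> n \<Longrightarrow> norm (\<Sum>i<m. a i *\<^sub>R e i) \<le> C * norm (\<Sum>i<n. a i *\<^sub>R e i)"
    and "k < n"
  shows "\<bar>a k\<bar> * norm (e k) \<le> 2 * C * norm (\<Sum>i<n. a i *\<^sub>R e i)"
proof -
  have "a k *\<^sub>R e k = (\<Sum>i<Suc k. a i *\<^sub>R e i) - (\<Sum>i<k. a i *\<^sub>R e i)" by simp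
  then have "\<bar>a k\<bar> * norm (e k) \<le> norm (\<Sum>i<Suc k. a i *\<^sub>R e i) + norm (\<Sum>i<k. a i *\<^sub>R e i)"
    by (metis norm_scaleR norm_triangle_ineq4)
  then show ?thesis
    using C[of "Suc k" n a] C[of k n a] \<open>k < n\<close> by simp
qed

text \<open>The sufficiency half of Grunblum's criterion. The vector \<open>v\<close> is given in
  the closure, so only scalars have to converge: approximants from the span have Cauchy
  coefficients, and the uniform bound on partial sums carries the approximation over to the limit
  expansion.\<close>

lemma basic_sequenceI:
  fixes e :: "nat \<Rightarrow> 'e::real_normed_vector"
  assumes nz: "\<And>i. e i \<noteq> 0"
    and C: "\<And>a m n. m \<le> n \<Longrightarrow> norm (\<Sum>i<m. a i *\<^sub>R e i) \<le> C * norm (\<Sum>i<n. a i *\<^sub>R e i)"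
  shows "basic_sequence e"
  unfolding basic_sequence_def schauder_basis_of_def
proof (intro conjI ballI)
  show "range e \<subseteq> closure (span (range e))"
    by (meson closure_subset span_superset subset_trans)
  note coeff = basis_inequality_coeff[of e C, OF C]
  have "0 \<le> C * norm (e 0)"
    using C[of 0 1 "\<lambda>_. 1"] by simp
  then have C0: "0 \<le> C"
    using nz[of 0] by (simp add: zero_le_mult_iff)
  fix v assume v: "v \<in> closure (span (range e))"
  have "\<exists>s. s \<in> span (range e) \<and> dist s v < inverse (real (Suc k))" for k
    using v unfolding closure_approachable by (meson inverse_positive_iff_positive of_nat_0_less_iff zero_less_Suc)
  then obtain s where s: "\<And>k. s k \<in> span (range e)" "\<And>k. dist (s k) v < inverse (real (Suc k))"
    by metis
  have "\<exists>a n. s k = (\<Sum>i<n. a i *\<^sub>R e i) \<and> (\<forall>i\<ge>n. a i = 0)" for k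
    using span_range_eq_sum[OF s(1)[of k]] by metis
  then obtain a n where an: "\<And>k. s k = (\<Sum>i<n k. a k i *\<^sub>R e i)" "\<And>k i. n k \<le> i \<Longrightarrow> a k i = 0"
    by metis
  have san: "s k = (\<Sum>i<N. a k i *\<^sub>R e i)" if "n k \<le> N" for k N
    unfolding an(1) using an(2) that by (intro sum.mono_neutral_left) auto
  have slim: "s \<longlonglongrightarrow> v"
  proof -
    have "(\<lambda>k. dist (s k) v) \<longlonglongrightarrow> 0"
      by (rule real_tendsto_sandwich[OF _ _ tendsto_const LIMSEQ_inverse_real_of_nat])
        (use s(2) in \<open>auto intro!: always_eventually less_imp_le\<close>)
    then show ?thesis by (simp add: tendsto_dist_iff[symmetric])
  qed
  have diff: "norm ((\<Sum>i<m. a k i *\<^sub>R e i) - (\<Sum>i<m. a l i *\<^sub>R e i)) \<le> C * norm (s k - s l)" for m k l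
  proof -
    define N where "N = max m (max (n k) (n l))"
    have "s k - s l = (\<Sum>i<N. (a k i - a l i) *\<^sub>R e i)"
      using san[of k N] san[of l N] by (simp add: N_def sum_subtractf algebra_simps)
    moreover have "norm (\<Sum>i<m. (a k i - a l i) *\<^sub>R e i) \<le> C * norm (\<Sum>i<N. (a k i - a l i) *\<^sub>R e i)"
      by (rule C) (simp add: N_def)
    ultimately show ?thesis by (simp add: sum_subtractf scaleR_left_diff_distrib)
  qed
  have cdiff: "\<bar>a k i - a l i\<bar> * norm (e i) \<le> 2 * C * norm (s k - s l)" for k l i
  proof -
    define N where "N = max (Suc i) (max (n k) (n l))"
    have "s k - s l = (\<Sum>i<N. (a k i - a l i) *\<^sub>R e i)"
      using san[of k N] san[of l N] by (simp add: N_def sum_subtractf algebra_simps)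
    then show ?thesis using coeff[of i N "\<lambda>i. a k i - a l i"] by (simp add: N_def)
  qed
  have "Cauchy (\<lambda>k. a k i)" for i
  proof (rule metric_CauchyI)
    fix \<epsilon> :: real assume e: "0 < \<epsilon>"
    \<comment> \<open>The summand 1 excludes division by zero and makes the final inequality
      strict.\<close>
    define d where "d = \<epsilon> * norm (e i) / (2 * C + 1)"
    have "d > 0" unfolding d_def using e nz C0 by (intro divide_pos_pos mult_pos_pos) auto
    then obtain M where M: "\<And>k l. M \<le> k \<Longrightarrow> M \<le> l \<Longrightarrow> norm (s k - s l) < d"
      using CauchyD[OF LIMSEQ_imp_Cauchy[OF slim]] by metis
    have "dist (a k i) (a l i) < \<epsilon>" if "M \<le> k" "M \<le> l" for k l
    proof -
      have "\<bar>a k i - a l i\<bar> * norm (e i) \<le> 2 * C * d"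
        using cdiff[of k i l] M[OF that] C0 by (meson less_imp_le mult_left_mono order_trans mult_nonneg_nonneg zero_le_numeral)
      also have "\<dots> < (2 * C + 1) * d" using \<open>d > 0\<close> by (simp add: algebra_simps)
      also have "\<dots> = \<epsilon> * norm (e i)" using C0 by (simp add: d_def)
      finally show ?thesis using nz by (simp add: dist_real_def)
    qed
    then show "\<exists>M. \<forall>k\<ge>M. \<forall>l\<ge>M. dist (a k i) (a l i) < \<epsilon>" by blast
  qed
  then have "\<exists>c. (\<lambda>k. a k i) \<longlonglongrightarrow> c" for i
    using real_Cauchy_convergent convergent_def by blast
  then obtain b where b: "\<And>i. (\<lambda>k. a k i) \<longlonglongrightarrow> b i" by metis
  have approx: "norm ((\<Sum>i<m. a k i *\<^sub>R e i) - (\<Sum>i<m. b i *\<^sub>R e i)) \<le> C * norm (s k - v)" for m k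
  proof (rule LIMSEQ_le)
    show "(\<lambda>l. norm ((\<Sum>i<m. a k i *\<^sub>R e i) - (\<Sum>i<m. a l i *\<^sub>R e i))) \<longlonglongrightarrow>
        norm ((\<Sum>i<m. a k i *\<^sub>R e i) - (\<Sum>i<m. b i *\<^sub>R e i))"
      by (intro tendsto_intros b)
    show "(\<lambda>l. C * norm (s k - s l)) \<longlonglongrightarrow> C * norm (s k - v)"
      by (intro tendsto_intros slim)
  qed (use diff in auto)
  have "(\<lambda>m. \<Sum>i<m. b i *\<^sub>R e i) \<longlonglongrightarrow> v"
  proof (rule LIMSEQ_I)
    fix \<epsilon> :: real assume e: "0 < \<epsilon>"
    then obtain k where k: "norm (s k - v) < \<epsilon> / (C + 1)"
      using LIMSEQ_D[OF slim, of "\<epsilon> / (C + 1)"] C0 by auto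
    have "norm ((\<Sum>i<m. b i *\<^sub>R e i) - v) < \<epsilon>" if "n k \<le> m" for m
    proof -
      have "norm ((\<Sum>i<m. b i *\<^sub>R e i) - v) \<le> norm (s k - (\<Sum>i<m. b i *\<^sub>R e i)) + norm (s k - v)"
        using norm_triangle_ineq4[of "s k - v" "s k - (\<Sum>i<m. b i *\<^sub>R e i)"] by simp
      also have "\<dots> \<le> (C + 1) * norm (s k - v)"
        using approx[of k m] san[OF that] by (simp add: algebra_simps)
      also have "\<dots> < \<epsilon>"
        using k C0 by (simp add: field_simps)
      finally show ?thesis .
    qed
    then show "\<exists>N. \<forall>m\<ge>N. norm ((\<Sum>i<m. b i *\<^sub>R e i) - v) < \<epsilon>" by blast
  qed
  then have bv: "(\<lambda>i. b i *\<^sub>R e i) sums v" by (simp add: sums_def)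
  show "\<exists>!a. (\<lambda>i. a i *\<^sub>R e i) sums v"
  proof (rule ex1I[of _ b])
    show "(\<lambda>i. b i *\<^sub>R e i) sums v" by (rule bv)
  next
    fix a' :: "nat \<Rightarrow> real" assume "(\<lambda>i. a' i *\<^sub>R e i) sums v"
    from sums_diff[OF this bv] have "(\<lambda>i. (a' i - b i) *\<^sub>R e i) sums 0"
      by (simp add: algebra_simps)
    then have lim: "(\<lambda>n. 2 * C * norm (\<Sum>i<n. (a' i - b i) *\<^sub>R e i)) \<longlonglongrightarrow> 2 * C * norm (0::'e)"
      unfolding sums_def by (intro tendsto_intros)
    have "\<bar>a' k - b k\<bar> * norm (e k) \<le> 2 * C * norm (0::'e)" for k
      by (rule LIMSEQ_le[OF tendsto_const lim]) (use coeff[of k _ "\<lambda>i. a' i - b i"] in \<open>auto intro!: exI[of _ "Suc k"]\<close>)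
    then show "a' = b"
      using nz by (intro ext) (simp add: mult_le_0_iff)
  qed
qed

section \<open>Uniform bounds for the basis projections\<close>

lemma geometrically_dominated_series:
  fixes f :: "nat \<Rightarrow> 'a::banach"
  assumes "\<And>j. norm (f j) \<le> K * (1 / 2) ^ j"
  shows "summable f" "norm (suminf f - (\<Sum>j<J. f j)) \<le> 2 * K * (1 / 2) ^ J"
proof -
  have geo: "summable (\<lambda>j. K * (1 / 2 :: real) ^ j)"
    by (intro summable_mult summable_geometric) auto
  show sf: "summable f"
    by (rule summable_comparison_test[OF _ geo]) (use assms in auto)
  have "suminf f - (\<Sum>j<J. f j) = (\<Sum>j. f (j + J))"
    using suminf_minus_initial_segment[OF sf, of J] by simp
  also have "norm \<dots> \<le> (\<Sum>j. K * (1 / 2) ^ J * (1 / 2) ^ j)"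
  proof (rule norm_suminf_le)
    show "norm (f (j + J)) \<le> K * (1 / 2) ^ J * (1 / 2) ^ j" for j
      using assms[of "j + J"] by (simp add: power_add mult.commute mult.left_commute)
  qed (intro summable_mult summable_geometric; simp)
  also have "\<dots> = K * (1 / 2) ^ J * 2"
    by (subst suminf_mult) (auto simp: suminf_geometric)
  finally show "norm (suminf f - (\<Sum>j<J. f j)) \<le> 2 * K * (1 / 2) ^ J" by simp
qed

text \<open>The open mapping argument for the norm given by the supremum of the norms of the partial
  sums, done by hand. By Baire, vectors with partial sums bounded by some \<open>k\<close> are dense
  in a ball. Hence every vector can be approximated with partial sums controlled by its norm, and
  successive corrections add up to it.\<close>

theorem schauder_basis_constant:
  fixes x :: "nat \<Rightarrow> 'a::banach"
  assumes x: "schauder_basis_of UNIV x"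
  obtains C where "1 \<le> C"
    "\<And>a m n. m \<le> n \<Longrightarrow> norm (\<Sum>i<m. a i *\<^sub>R x i) \<le> C * norm (\<Sum>i<n. a i *\<^sub>R x i)"
proof -
  have ex1: "\<exists>!a. (\<lambda>i. a i *\<^sub>R x i) sums v" for v
    using x by (auto simp: schauder_basis_of_def)
  define co where "co v = (THE a. (\<lambda>i. a i *\<^sub>R x i) sums v)" for v
  have co: "(\<lambda>i. co v i *\<^sub>R x i) sums v" for v
    unfolding co_def by (rule theI'[OF ex1])
  have coI: "a = co v" if "(\<lambda>i. a i *\<^sub>R x i) sums v" for a v
    using ex1 co that by blast
  define S where "S n v = (\<Sum>i<n. co v i *\<^sub>R x i)" for n v
  have Slim: "(\<lambda>n. S n v) \<longlonglongrightarrow> v" for v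
    using co[of v] by (simp add: S_def sums_def)
  have coadd: "co (v + w) = (\<lambda>i. co v i + co w i)" for v w
    by (rule coI[symmetric]) (use sums_add[OF co[of v] co[of w]] in \<open>simp add: algebra_simps\<close>)
  have coscale: "co (c *\<^sub>R v) = (\<lambda>i. c * co v i)" for c v
    by (rule coI[symmetric]) (use sums_scaleR_right[OF co[of v], of c] in simp)
  have Slin: "linear (S n)" for n
    by (rule linearI) (simp_all add: S_def coadd coscale scaleR_left_distrib sum.distrib scaleR_sum_right)
  have xnz: "x i \<noteq> 0" for i
  proof
    assume "x i = 0"
    then have "(\<lambda>j. (if j = i then 1 else 0) *\<^sub>R x j) = (\<lambda>j. 0 *\<^sub>R x j)" by auto
    moreover have "(\<lambda>j. 0 *\<^sub>R x j) sums 0" by simp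
    ultimately have "(\<lambda>j. if j = i then 1 else 0) = co 0" "(\<lambda>j. 0) = co 0"
      by (auto intro!: coI)
    then have "(if i = i then 1 else 0 :: real) = 0" by (metis (mono_tags))
    then show False by simp
  qed
  define A where "A K = {v. \<forall>n. norm (S n v) \<le> K}" for K
  have AD: "norm (S n v) \<le> K" if "v \<in> A K" for n v K
    using that by (simp add: A_def)
  have Anorm: "norm v \<le> K" if "v \<in> A K" for v K
    using Slim[of v] AD[OF that] by (intro LIMSEQ_le_const2[OF tendsto_norm]) auto
  have cover: "\<exists>k::nat. v \<in> A (real k)" for v
  proof -
    have "Bseq (\<lambda>n. S n v)" using Slim convergentI convergent_imp_Bseq by blast
    then obtain K where "\<And>n. norm (S n v) \<le> K" unfolding Bseq_def by blast
    moreover obtain k where "K \<le> real k" using real_arch_simple by blast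
    ultimately show ?thesis by (auto simp: A_def intro: order_trans)
  qed
  have "\<exists>k::nat. interior (closure (A (real k))) \<noteq> {}"
  proof (rule ccontr)
    assume no: "\<not> ?thesis"
    have "euclidean interior_of \<Union>(range (\<lambda>k::nat. closure (A (real k)))) = {}"
      by (rule Baire_category_alt) (use no in \<open>auto simp: completely_metrizable_space_euclidean\<close>)
    moreover have "\<Union>(range (\<lambda>k::nat. closure (A (real k)))) = UNIV"
      using cover closure_subset by blast
    ultimately show False by simp
  qed
  then obtain k :: nat and v0 r where r: "0 < r" "ball v0 r \<subseteq> closure (A (real k))"
    by (metis ex_in_conv mem_interior)
  \<comment> \<open>Differences of vectors near \<open>v0 + v\<close> and \<open>v0\<close> move the
    ball to the origin and double the bound.\<close>
  have near: "\<exists>a\<in>A (2 * real k). norm (v - a) < \<epsilon>" if v: "norm v < r" and eps: "0 < \<epsilon>" for v \<epsilon>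
  proof -
    have "v0 + v \<in> closure (A (real k))" "v0 \<in> closure (A (real k))"
      using r v by (auto simp: dist_norm subset_iff)
    then obtain p q where pq: "p \<in> A (real k)" "dist p (v0 + v) < \<epsilon> / 2" "q \<in> A (real k)" "dist q v0 < \<epsilon> / 2"
      using eps unfolding closure_approachable by (metis half_gt_zero)
    have "norm (S n (p - q)) \<le> 2 * real k" for n
      using AD[OF pq(1), of n] AD[OF pq(3), of n] norm_triangle_ineq4[of "S n p" "S n q"]
      by (simp add: linear_diff[OF Slin])
    moreover have "norm (v - (p - q)) < \<epsilon>"
    proof -
      have "norm (v - (p - q)) \<le> norm (v0 + v - p) + norm (q - v0)"
        using norm_triangle_ineq[of "v0 + v - p" "q - v0"] by (simp add: algebra_simps)
      also have "\<dots> = dist p (v0 + v) + dist q v0"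
        by (simp add: dist_norm norm_minus_commute)
      finally show ?thesis using pq(2,4) by linarith
    qed
    ultimately show ?thesis by (auto simp: A_def)
  qed
  \<comment> \<open>Rescaling from norm r / 2 back to norm v multiplies the bound 2 k by 2 norm v /
    r.\<close>
  define D where "D = 4 * real k / r"
  have D0: "0 \<le> D" using r by (simp add: D_def)
  have near2: "\<exists>a\<in>A (D * norm v). norm (v - a) < \<epsilon>" if eps: "0 < \<epsilon>" for v \<epsilon>
  proof (cases "v = 0")
    case True
    then show ?thesis using eps by (intro bexI[of _ 0]) (auto simp: A_def linear_0[OF Slin])
  next
    case False
    define c where "c = r / (2 * norm v)"
    have c: "0 < c" using r False by (simp add: c_def)
    have "norm (c *\<^sub>R v) < r" using r False by (simp add: c_def)
    then obtain a where a: "a \<in> A (2 * real k)" "norm (c *\<^sub>R v - a) < c * \<epsilon>"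
      using near[of "c *\<^sub>R v" "c * \<epsilon>"] c eps by auto
    have "norm (S n (inverse c *\<^sub>R a)) \<le> D * norm v" for n
    proof -
      have "norm (S n (inverse c *\<^sub>R a)) = inverse c * norm (S n a)"
        using c by (simp add: linear_scale[OF Slin])
      also have "\<dots> \<le> inverse c * (2 * real k)"
        using AD[OF a(1)] c by (intro mult_left_mono) auto
      also have "\<dots> = D * norm v" using r by (simp add: c_def D_def field_simps)
      finally show ?thesis .
    qed
    moreover have "norm (v - inverse c *\<^sub>R a) < \<epsilon>"
    proof -
      have "v - inverse c *\<^sub>R a = inverse c *\<^sub>R (c *\<^sub>R v - a)" using c by (simp add: algebra_simps)
      then have "norm (v - inverse c *\<^sub>R a) = inverse c * norm (c *\<^sub>R v - a)" using c by simp
      also have "\<dots> < \<epsilon>" using a(2) c by (simp add: field_simps)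
      finally show ?thesis .
    qed
    ultimately show ?thesis by (auto simp: A_def)
  qed
  have bound: "norm (S m v) \<le> 2 * (D * norm v)" for m v
  proof (cases "v = 0")
    case True
    then show ?thesis by (simp add: linear_0[OF Slin])
  next
    case False
    obtain g where g: "\<And>\<epsilon> w. 0 < \<epsilon> \<Longrightarrow> g \<epsilon> w \<in> A (D * norm w)" "\<And>\<epsilon> w. 0 < \<epsilon> \<Longrightarrow> norm (w - g \<epsilon> w) < \<epsilon>"
      using near2 by metis
    define ep where "ep j = norm v * (1 / 2) ^ j" for j :: nat
    have ep: "0 < ep j" for j using False by (simp add: ep_def)
    \<comment> \<open>\<open>rem j\<close> is what remains of \<open>v\<close> after
      \<open>j\<close> corrections; \<open>a j\<close> approximates it up to
      \<open>ep (Suc j)\<close>, so the bounds for the remainders halve.\<close>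
    define rem where "rem = rec_nat v (\<lambda>j w. w - g (ep (Suc j)) w)"
    define a where "a j = g (ep (Suc j)) (rem j)" for j
    have rem: "rem 0 = v" "rem (Suc j) = rem j - a j" for j by (simp_all add: rem_def a_def)
    have remle: "norm (rem j) \<le> ep j" for j
      by (cases j) (use g(2)[OF ep] in \<open>auto simp: rem a_def less_imp_le\<close>, simp add: ep_def)
    have aA: "norm (S n (a j)) \<le> D * norm v * (1 / 2) ^ j" for n j
    proof -
      have "norm (S n (a j)) \<le> D * norm (rem j)" unfolding a_def by (rule AD[OF g(1)[OF ep]])
      also have "\<dots> \<le> D * ep j" by (intro mult_left_mono remle D0)
      finally show ?thesis by (simp add: ep_def)
    qed
    define V where "V J = (\<Sum>j<J. a j)" for J
    have VJ: "rem J = v - V J" for J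
      by (induction J) (simp_all add: rem V_def)
    define T where "T n = (\<Sum>j. S n (a j))" for n
    have SV: "S n (V J) = (\<Sum>j<J. S n (a j))" for n J
      unfolding V_def by (rule linear_sum[OF Slin])
    have "summable (\<lambda>j. co (a j) i)" for i
    proof -
      have "norm (co (a j) i) \<le> 2 * (D * norm v) / norm (x i) * (1 / 2) ^ j" for j
      proof -
        have "co (a j) i *\<^sub>R x i = S (Suc i) (a j) - S i (a j)" by (simp add: S_def)
        then have "\<bar>co (a j) i\<bar> * norm (x i) \<le> norm (S (Suc i) (a j)) + norm (S i (a j))"
          by (metis norm_scaleR norm_triangle_ineq4)
        also have "\<dots> \<le> 2 * (D * norm v * (1 / 2) ^ j)"
          using aA[of "Suc i" j] aA[of i j] by simp
        finally show ?thesis using xnz[of i] by (simp add: field_simps)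
      qed
      then show ?thesis by (rule geometrically_dominated_series)
    qed
    then have Teq: "T n = (\<Sum>i<n. (\<Sum>j. co (a j) i) *\<^sub>R x i)" for n
      unfolding T_def S_def by (subst suminf_sum) (auto intro: summable_scaleR_left simp: suminf_scaleR_left)
    have "T \<longlonglongrightarrow> v"
    proof (rule LIMSEQ_I)
      fix \<epsilon> :: real assume e: "0 < \<epsilon>"
      have "(\<lambda>J. 2 * (D * norm v) * (1 / 2) ^ J + norm v * (1 / 2) ^ J) \<longlonglongrightarrow> 2 * (D * norm v) * 0 + norm v * 0"
        by (intro tendsto_intros LIMSEQ_power_zero) auto
      from LIMSEQ_D[OF this, of "\<epsilon> / 2"] e obtain J where
        "\<bar>2 * (D * norm v) * (1 / 2) ^ J + norm v * (1 / 2) ^ J\<bar> < \<epsilon> / 2" by force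
      then have J: "2 * (D * norm v) * (1 / 2) ^ J + norm v * (1 / 2) ^ J < \<epsilon> / 2"
        by linarith
      obtain N where N: "\<And>n. N \<le> n \<Longrightarrow> norm (S n (V J) - V J) < \<epsilon> / 2"
        using LIMSEQ_D[OF Slim, of "\<epsilon> / 2" "V J"] e by auto
      have "norm (T n - v) < \<epsilon>" if "N \<le> n" for n
      proof -
        have "norm (T n - S n (V J)) \<le> 2 * (D * norm v) * (1 / 2) ^ J"
          unfolding T_def SV by (rule geometrically_dominated_series(2)[OF aA])
        moreover have "norm (v - V J) \<le> norm v * (1 / 2) ^ J"
          using remle[of J] VJ[of J] by (simp add: ep_def)
        moreover have "norm (T n - v) \<le> norm (T n - S n (V J)) + norm (S n (V J) - V J) + norm (v - V J)"
          using norm_triangle_ineq[of "T n - S n (V J)" "S n (V J) - V J"]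
            norm_triangle_ineq4[of "T n - V J" "v - V J"] by simp
        ultimately show ?thesis using N[OF that] J by linarith
      qed
      then show "\<exists>N. \<forall>n\<ge>N. norm (T n - v) < \<epsilon>" by blast
    qed
    \<comment> \<open>Summing the corrections coefficientwise expands \<open>v\<close>; by
      uniqueness this is its expansion, so \<open>T m\<close> is the partial sum
      \<open>S m v\<close>.\<close>
    then have "(\<lambda>i. (\<Sum>j. co (a j) i) *\<^sub>R x i) sums v" by (simp add: sums_def flip: Teq)
    then have "S m v = T m" using coI by (simp add: S_def Teq fun_eq_iff)
    then show ?thesis 
      using geometrically_dominated_series(2)[of "\<lambda>j. S m (a j)" "D * norm v" 0, OF aA]
      by (simp add: T_def)
  qed
  show ?thesis
  proof (rule that)
    show "1 \<le> max 1 (2 * D)" by simp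
  next
    fix a :: "nat \<Rightarrow> real" and m n :: nat assume mn: "m \<le> n"
    define v where "v = (\<Sum>i<n. a i *\<^sub>R x i)"
    have "(\<lambda>i. (if i < n then a i else 0) *\<^sub>R x i) sums (\<Sum>i<n. (if i < n then a i else 0) *\<^sub>R x i)"
      by (rule sums_finite) auto
    moreover have "(\<Sum>i<n. (if i < n then a i else 0) *\<^sub>R x i) = v"
      by (simp add: v_def)
    ultimately have "(\<lambda>i. if i < n then a i else 0) = co v" using coI by metis
    then have "co v i = a i" if "i < n" for i using that fun_cong[of _ "co v" i] by fastforce
    then have "S m v = (\<Sum>i<m. a i *\<^sub>R x i)" using mn by (simp add: S_def)
    moreover have "norm (S m v) \<le> max 1 (2 * D) * norm v"
      using bound[of m v] mult_right_mono[of "2 * D" "max 1 (2 * D)" "norm v"] by simp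
    ultimately show "norm (\<Sum>i<m. a i *\<^sub>R x i) \<le> max 1 (2 * D) * norm (\<Sum>i<n. a i *\<^sub>R x i)"
      by (simp add: v_def)
  qed
qed

subsection \<open>Existence of spreading models\<close>

lemma sorted_list_of_set_strict_mono_image:
  fixes k :: "nat \<Rightarrow> nat"
  assumes "strict_mono_on {..<n} k"
  shows "sorted_list_of_set (k ` {..<n}) = map k [0..<n]"
proof -
  have "sorted_wrt (<) (map k [0..<n])"
    using assms by (auto simp: sorted_wrt_iff_nth_less strict_mono_on_def)
  moreover have "set (map k [0..<n]) = k ` {..<n}" by (auto simp: atLeast0LessThan)
  ultimately show ?thesis
    using strict_sorted_equal[of "sorted_list_of_set (k ` {..<n})" "map k [0..<n]"] by simp
qed

definition almost_spreading :: "nat \<Rightarrow> (nat \<Rightarrow> 'a::real_normed_vector) \<Rightarrow> nat set \<Rightarrow> bool"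
  where "almost_spreading n y M \<longleftrightarrow> (\<forall>(a :: nat \<Rightarrow> real) k k'.
    (\<forall>j<n. a j \<in> {-1..1}) \<and> strict_mono_on {..<n} k \<and> strict_mono_on {..<n} k' \<and>
    k ` {..<n} \<subseteq> M \<and> k' ` {..<n} \<subseteq> M \<longrightarrow>
    \<bar>norm (\<Sum>j<n. a j *\<^sub>R y (k j)) - norm (\<Sum>j<n. a j *\<^sub>R y (k' j))\<bar> \<le> 1 / real n)"

text \<open>Coefficients are rounded to multiples of 1 / L and norms to multiples of 1 / (2 n). For
  each of the finitely many rounded vectors and thresholds, Ramsey's theorem for
  \<open>n\<close>-element sets makes it constant whether the norm stays below the threshold.
  Rounding twice costs 1 / (2 n), the threshold another 1 / (2 n).\<close>

lemma almost_spreading_dense: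
  fixes y :: "nat \<Rightarrow> 'a::real_normed_vector"
  assumes y: "\<And>i. norm (y i) = 1" and N: "infinite N"
  shows "\<exists>M\<subseteq>N. infinite M \<and> almost_spreading n y M"
proof (cases "n = 0")
  case True
  then show ?thesis using N by (auto simp: almost_spreading_def)
next
  case False
  \<comment> \<open>Rounding the \<open>n\<close> coefficients of unit vectors then costs at most n
    / L = 1 / (4 n).\<close>
  define L :: nat where "L = 4 * n * n"
  have L: "0 < real L" using False by (simp add: L_def)
  define w where "w g X = (\<Sum>j<n. (of_int (g j) / real L) *\<^sub>R y (sorted_list_of_set X ! j))"
    for g :: "nat \<Rightarrow> int" and X
  \<comment> \<open>Rounded vectors have norm at most \<open>n\<close>, so thresholds i / (2 n) up
    to i = 2 n n suffice.\<close>
  define I where "I = (PiE {..<n} (\<lambda>_. {- int L..int L})) \<times> {..2 * n * n}"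
  define Q where "Q gi M \<longleftrightarrow> (\<exists>t::nat. \<forall>X. X \<subseteq> M \<and> finite X \<and> card X = n \<longrightarrow>
      (if norm (w (fst gi) X) \<le> real (snd gi) / (2 * real n) then 0 else 1) = t)" for gi M
  have "\<exists>M\<subseteq>N. infinite M \<and> (\<forall>gi\<in>I. Q gi M)"
  proof (rule finite_dense_conj[OF _ _ _ N])
    show "finite I" unfolding I_def by (intro finite_cartesian_product finite_PiE) auto
    show "Q gi M" if "Q gi K" "M \<subseteq> K" for gi M K
      using that unfolding Q_def by (meson order_trans)
    show "\<exists>M\<subseteq>K. infinite M \<and> Q gi M" if K: "infinite K" for gi K
    proof -
      define col :: "nat set \<Rightarrow> nat"
        where "col X = (if norm (w (fst gi) X) \<le> real (snd gi) / (2 * real n) then 0 else 1)" for X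
      have "\<exists>Y t. Y \<subseteq> K \<and> infinite Y \<and> t < 2 \<and>
          (\<forall>X. X \<subseteq> Y \<and> finite X \<and> card X = n \<longrightarrow> col X = t)"
        by (rule Ramsey[OF K]) (simp add: col_def)
      then show ?thesis unfolding Q_def col_def by metis
    qed
  qed
  then obtain M where M: "M \<subseteq> N" "infinite M" "\<And>gi. gi \<in> I \<Longrightarrow> Q gi M" by blast
  have "almost_spreading n y M"
    unfolding almost_spreading_def
  proof (intro allI impI, elim conjE)
    fix a :: "nat \<Rightarrow> real" and k k'
    assume a: "\<forall>j<n. a j \<in> {-1..1}" and k: "strict_mono_on {..<n} k" "k ` {..<n} \<subseteq> M"
      and k': "strict_mono_on {..<n} k'" "k' ` {..<n} \<subseteq> M"
    define g where "g = restrict (\<lambda>j. \<lfloor>a j * real L\<rfloor>) {..<n}"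
    have g: "g \<in> PiE {..<n} (\<lambda>_. {- int L..int L})"
      unfolding g_def
    proof (rule restrict_PiE_iff[THEN iffD2], rule ballI)
      fix j assume "j \<in> {..<n}"
      then have "- 1 \<le> a j" "a j \<le> 1" using a by auto
      then have "- real L \<le> a j * real L" "a j * real L \<le> real L"
        using L mult_right_mono[of "-1" "a j" "real L"] mult_right_mono[of "a j" 1 "real L"] by auto
      then show "\<lfloor>a j * real L\<rfloor> \<in> {- int L..int L}"
        by (simp add: le_floor_iff floor_le_iff)
    qed
    have ga: "\<bar>a j - of_int (g j) / real L\<bar> \<le> 1 / real L" if "j < n" for j
    proof -
      have "\<bar>a j * real L - of_int \<lfloor>a j * real L\<rfloor>\<bar> \<le> 1" by linarith
      moreover have "(a j - of_int (g j) / real L) * real L = a j * real L - of_int \<lfloor>a j * real L\<rfloor>"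
        using that L by (simp add: g_def field_simps)
      ultimately have "\<bar>(a j - of_int (g j) / real L) * real L\<bar> \<le> 1" by simp
      then have "\<bar>a j - of_int (g j) / real L\<bar> * real L \<le> 1" by (simp only: abs_mult abs_of_nat)
      then show ?thesis using L by (simp only: pos_le_divide_eq)
    qed
    have g1: "\<bar>of_int (g j) / real L\<bar> \<le> 1" if "j < n" for j
    proof -
      have "g j \<in> {- int L..int L}" using g that by (auto simp: PiE_iff)
      then have "\<bar>of_int (g j) :: real\<bar> \<le> real L" by auto
      then show ?thesis using L by simp
    qed
    have wa: "\<bar>norm (\<Sum>j<n. a j *\<^sub>R y (h j)) - norm (w g (h ` {..<n}))\<bar> \<le> 1 / (4 * real n)"
      if h: "strict_mono_on {..<n} h" for h
    proof -
      have "(\<Sum>j<n. a j *\<^sub>R y (h j)) - w g (h ` {..<n}) = (\<Sum>j<n. (a j - of_int (g j) / real L) *\<^sub>R y (h j))"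
        by (simp add: w_def sorted_list_of_set_strict_mono_image[OF h] sum_subtractf[symmetric] scaleR_left_diff_distrib)
      also have "norm \<dots> \<le> (\<Sum>j<n. 1 / real L)"
        by (intro sum_norm_le) (simp add: y ga)
      also have "\<dots> = 1 / (4 * real n)" using False by (simp add: L_def field_simps)
      finally show ?thesis by (smt (verit) norm_triangle_ineq3)
    qed
    have wle: "norm (w g X) \<le> real n" for X
    proof -
      have "norm (w g X) \<le> (\<Sum>j<n. 1)"
        unfolding w_def by (intro sum_norm_le) (use g1 y in simp)
      then show ?thesis by simp
    qed
    have close: "norm (w g X') \<le> norm (w g X) + 1 / (2 * real n)"
      if X: "X \<subseteq> M" "finite X" "card X = n" "X' \<subseteq> M" "finite X'" "card X' = n" for X X'
    proof -
      define i where "i = nat \<lceil>2 * real n * norm (w g X)\<rceil>"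
      have i: "2 * real n * norm (w g X) \<le> real i" "real i \<le> 2 * real n * norm (w g X) + 1"
        unfolding i_def by (auto simp: of_nat_nat)
      have "2 * real n * norm (w g X) \<le> real (2 * n * n)"
        using mult_left_mono[OF wle[of X], of "2 * real n"] by simp
      then have "i \<le> 2 * n * n" unfolding i_def by (simp add: nat_le_iff ceiling_le_iff)
      then have "Q (g, i) M" using g by (intro M) (simp add: I_def)
      moreover have "norm (w g X) \<le> real i / (2 * real n)"
        using i(1) False by (simp add: field_simps)
      ultimately have "norm (w g X') \<le> real i / (2 * real n)"
        unfolding Q_def using X by (metis fst_conv snd_conv zero_neq_one)
      also have "\<dots> \<le> norm (w g X) + 1 / (2 * real n)"
        using i(2) False by (simp add: field_simps)
      finally show ?thesis .
    qed
    have card: "card (h ` {..<n}) = n" if "strict_mono_on {..<n} h" for h :: "nat \<Rightarrow> nat"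
      using card_image[OF strict_mono_on_imp_inj_on[OF that]] by simp
    have "1 / (4 * real n) + 1 / (2 * real n) + 1 / (4 * real n) = 1 / real n"
      using False by (simp add: field_simps)
    then show "\<bar>norm (\<Sum>j<n. a j *\<^sub>R y (k j)) - norm (\<Sum>j<n. a j *\<^sub>R y (k' j))\<bar> \<le> 1 / real n"
      using wa[OF k(1)] wa[OF k'(1)] close[of "k ` {..<n}" "k' ` {..<n}"] close[of "k' ` {..<n}" "k ` {..<n}"]
        k k' card[OF k(1)] card[OF k'(1)] by (simp add: abs_le_iff)
  qed
  then show ?thesis using M by blast
qed

lemma almost_spreading_subsequence:
  fixes y :: "nat \<Rightarrow> 'a::real_normed_vector"
  assumes y: "\<And>i. norm (y i) = 1"
  obtains r where "strict_mono r"
    "\<And>n a k k'. 1 \<le> n \<Longrightarrow> (\<And>j. j < n \<Longrightarrow> a j \<in> {-1..1}) \<Longrightarrow> strict_mono_on {..<n} k \<Longrightarrow>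
      strict_mono_on {..<n} k' \<Longrightarrow> n \<le> Suc (k 0) \<Longrightarrow> n \<le> Suc (k' 0) \<Longrightarrow>
      \<bar>norm (\<Sum>j<n. a j *\<^sub>R y (r (k j))) - norm (\<Sum>j<n. a j *\<^sub>R y (r (k' j)))\<bar> \<le> 1 / real n"
proof -
  define Q where "Q m M \<longleftrightarrow> (\<forall>n\<in>{..Suc m}. almost_spreading n y M)" for m M
  obtain M where M: "infinite M" "\<And>m. m \<in> insert 0 (Suc ` M) \<Longrightarrow> Q m (M \<inter> {m..})"
  proof (rule fusion[of Q UNIV])
    show "Q m M" if "Q m N" "M \<subseteq> N" for m M N
      using that unfolding Q_def almost_spreading_def by (meson order_trans)
    show "\<exists>M\<subseteq>N. infinite M \<and> Q m M" if "infinite N" for m N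
      unfolding Q_def
    proof (rule finite_dense_conj[OF _ _ _ that])
      show "almost_spreading n y M" if "almost_spreading n y N" "M \<subseteq> N" for n M N
        using that unfolding almost_spreading_def by (meson order_trans)
    qed (auto intro: almost_spreading_dense y)
  qed auto
  define r where "r = enumerate M"
  have r: "strict_mono r" "\<And>i. r i \<in> M" "\<And>i. i \<le> r i"
    using M(1) by (auto simp: r_def strict_mono_enumerate enumerate_in_set le_enumerate)
  show ?thesis
  proof (rule that[OF r(1)])
    fix n and a :: "nat \<Rightarrow> real" and k k'
    assume n: "1 \<le> n" and a: "\<And>j. j < n \<Longrightarrow> a j \<in> {-1..1}"
      and k: "strict_mono_on {..<n} k" "n \<le> Suc (k 0)"
      and k': "strict_mono_on {..<n} k'" "n \<le> Suc (k' 0)"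
    \<comment> \<open>Positions under the restriction \<open>n \<le> Suc (k 0)\<close> are at least
      n - 1, so their indices lie beyond \<open>r (n - 2)\<close>; for n = 1 there is no such
      earlier term and index 0 is used.\<close>
    define m where "m = (if n = 1 then 0 else Suc (r (n - 2)))"
    have "almost_spreading n y (M \<inter> {m..})"
    proof -
      have "Q m (M \<inter> {m..})" using r(2) by (intro M(2)) (auto simp: m_def)
      moreover have "n \<le> Suc m" using r(3)[of "n - 2"] n by (auto simp: m_def)
      ultimately show ?thesis by (auto simp: Q_def)
    qed
    moreover have "strict_mono_on {..<n} (\<lambda>j. r (h j)) \<and> (\<lambda>j. r (h j)) ` {..<n} \<subseteq> M \<inter> {m..}"
      if h: "strict_mono_on {..<n} h" "n \<le> Suc (h 0)" for h
    proof (intro conjI subsetI)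
      show "strict_mono_on {..<n} (\<lambda>j. r (h j))"
        using h(1) r(1) by (simp add: strict_mono_on_def strict_mono_def)
      fix x assume "x \<in> (\<lambda>j. r (h j)) ` {..<n}"
      then obtain j where j: "j < n" "x = r (h j)" by auto
      have "h 0 \<le> h j" using h(1) j(1) by (cases "j = 0") (auto simp: strict_mono_on_def less_imp_le)
      then have "m \<le> r (h j)"
        using h(2) r(1) n by (auto simp: m_def Suc_le_eq strict_mono_less)
      then show "x \<in> M \<inter> {m..}" using r(2) j by auto
    qed
    from this[OF k] this[OF k'] have
      "strict_mono_on {..<n} (\<lambda>j. r (k j))" "(\<lambda>j. r (k j)) ` {..<n} \<subseteq> M \<inter> {m..}"
      "strict_mono_on {..<n} (\<lambda>j. r (k' j))" "(\<lambda>j. r (k' j)) ` {..<n} \<subseteq> M \<inter> {m..}" by blast+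
    ultimately show "\<bar>norm (\<Sum>j<n. a j *\<^sub>R y (r (k j))) - norm (\<Sum>j<n. a j *\<^sub>R y (r (k' j)))\<bar> \<le> 1 / real n"
      using a unfolding almost_spreading_def by blast
  qed
qed

section \<open>Limits of norms and their realization by bounded sequences\<close>

lemma apply_bcontfun_Bcontfun:
  assumes "\<And>m. \<bar>f m\<bar> \<le> B"
  shows "apply_bcontfun (Bcontfun f :: ell_infty) = f"
  by (rule Bcontfun_inverse, rule bcontfun_normI[where b = B]) (use assms in \<open>auto simp: continuous_on_discrete\<close>)

lemma apply_bcontfun_sum:
  "apply_bcontfun (\<Sum>i\<in>A. f i :: ell_infty) m = (\<Sum>i\<in>A. apply_bcontfun (f i) m)"
  by (induction A rule: infinite_finite_induct) auto

text \<open>The Brunel-Sucheston limit of norms, realized inside \<open>ell_infty\<close>: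
  coordinate \<open>c\<close> of \<open>e i\<close> is the \<open>i\<close>-th value of a functional
  that norms the \<open>c\<close>-th rational vector in the limit norm. Rational vectors are dense,
  so these countably many functionals recover the norm. The constant \<open>C\<close> is uniform
  over subsequences and therefore passes to the limit.\<close>

theorem spreading_model_exists:
  fixes y :: "nat \<Rightarrow> 'a::real_normed_vector"
  assumes y: "normalized y"
    and C: "\<And>(a :: nat \<Rightarrow> real) m n k. strict_mono (k :: nat \<Rightarrow> nat) \<Longrightarrow> m \<le> n \<Longrightarrow>
      norm (\<Sum>i<m. a i *\<^sub>R y (k i)) \<le> C * norm (\<Sum>i<n. a i *\<^sub>R y (k i))"
  obtains r and e :: "nat \<Rightarrow> ell_infty" where "strict_mono r" "spreading_model (y \<circ> r) e"
proof -
  obtain r where r: "strict_mono r" and close: "\<And>n a k k'. 1 \<le> n \<Longrightarrow> (\<And>j. j < n \<Longrightarrow> a j \<in> {-1..1}) \<Longrightarrow>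
      strict_mono_on {..<n} k \<Longrightarrow> strict_mono_on {..<n} k' \<Longrightarrow> n \<le> Suc (k 0) \<Longrightarrow> n \<le> Suc (k' 0) \<Longrightarrow>
      \<bar>norm (\<Sum>j<n. a j *\<^sub>R y (r (k j))) - norm (\<Sum>j<n. a j *\<^sub>R y (r (k' j)))\<bar> \<le> 1 / real n"
    using almost_spreading_subsequence[of y] y by (auto simp: normalized_def)
  define z where "z = y \<circ> r"
  have z1: "norm (z i) = 1" for i using y by (simp add: z_def normalized_def)
  define v where "v n a p = (\<Sum>j<n. a j *\<^sub>R z (p + j))" for n and a :: "nat \<Rightarrow> real" and p
  have vscale: "v n (\<lambda>j. c * a j) p = c *\<^sub>R v n a p" for n c a p
    by (simp add: v_def scaleR_sum_right)
  have vext: "v N (\<lambda>j. if j < n then a j else 0) p = v n a p" if "n \<le> N" for N n a p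
  proof -
    have "v N (\<lambda>j. if j < n then a j else 0) p = (\<Sum>j<n. (if j < n then a j else 0) *\<^sub>R z (p + j))"
      unfolding v_def by (rule sum.mono_neutral_right) (use that in auto)
    then show ?thesis by (simp add: v_def)
  qed
  have vcauchy1: "Cauchy (\<lambda>p. norm (v n a p))" if a: "\<And>j. j < n \<Longrightarrow> a j \<in> {-1..1}" for n a
  proof (rule metric_CauchyI)
    fix \<epsilon> :: real assume "0 < \<epsilon>"
    then obtain N0 where N0: "inverse (real (Suc N0)) < \<epsilon>" using reals_Archimedean by blast
    define N where "N = max n (Suc N0)"
    have "1 / real N \<le> inverse (real (Suc N0))" by (simp add: N_def inverse_eq_divide frac_le)
    with N0 have N: "1 / real N < \<epsilon>" by simp
    have "dist (norm (v n a p)) (norm (v n a q)) < \<epsilon>" if "N \<le> p" "N \<le> q" for p q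
    proof -
      \<comment> \<open>Padding with zeros to length \<open>N\<close> improves the error from 1 / n
        to 1 / N.\<close>
      have "\<bar>norm (v N (\<lambda>j. if j < n then a j else 0) p) - norm (v N (\<lambda>j. if j < n then a j else 0) q)\<bar> \<le> 1 / real N"
        unfolding v_def z_def comp_def
        by (rule close[where k = "\<lambda>j. p + j" and k' = "\<lambda>j. q + j"])
          (use that a in \<open>auto simp: N_def strict_mono_on_def\<close>)
      then show ?thesis using N vext[of n N] by (simp add: N_def dist_real_def)
    qed
    then show "\<exists>M. \<forall>p\<ge>M. \<forall>q\<ge>M. dist (norm (v n a p)) (norm (v n a q)) < \<epsilon>" by blast
  qed
  have "convergent (\<lambda>p. norm (v n a p))" for n a
  proof -
    \<comment> \<open>Dividing by \<open>s\<close> brings all coefficients between -1 and 1; the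
      summand 1 keeps \<open>s\<close> positive.\<close>
    define s where "s = 1 + (\<Sum>j<n. \<bar>a j\<bar>)"
    have s: "1 \<le> s" by (simp add: s_def sum_nonneg)
    have "\<bar>a j\<bar> \<le> s" if "j < n" for j
      unfolding s_def using member_le_sum[of j "{..<n}" "\<lambda>j. \<bar>a j\<bar>"] that by auto
    then have "\<bar>inverse s * a j\<bar> \<le> 1" if "j < n" for j
      using that s by (simp add: abs_mult field_simps)
    then have "inverse s * a j \<in> {-1..1}" if "j < n" for j
      using that by (meson abs_le_iff atLeastAtMost_iff minus_le_iff)
    from vcauchy1[of n "\<lambda>j. inverse s * a j", OF this]
    have "convergent (\<lambda>p. s * norm (v n (\<lambda>j. inverse s * a j) p))"
      by (intro convergent_mult convergent_const real_Cauchy_convergent)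
    moreover have "s * norm (v n (\<lambda>j. inverse s * a j) p) = norm (v n a p)" for p
      using s by (simp only: vscale) simp
    ultimately show ?thesis by simp
  qed
  then have "\<exists>N. \<forall>n a. (\<lambda>p. norm (v n a p)) \<longlonglongrightarrow> N n a"
    unfolding convergent_def by metis
  then obtain N where N: "\<And>n a. (\<lambda>p. norm (v n a p)) \<longlonglongrightarrow> N n a" by blast
  have Ndiff: "\<bar>N n a - N n b\<bar> \<le> (\<Sum>j<n. \<bar>a j - b j\<bar>)" for n a b
  proof (rule LIMSEQ_le_const2)
    show "(\<lambda>p. \<bar>norm (v n a p) - norm (v n b p)\<bar>) \<longlonglongrightarrow> \<bar>N n a - N n b\<bar>"
      by (intro tendsto_intros N)
    have "\<bar>norm (v n a p) - norm (v n b p)\<bar> \<le> (\<Sum>j<n. \<bar>a j - b j\<bar>)" for p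
    proof -
      have "v n a p - v n b p = (\<Sum>j<n. (a j - b j) *\<^sub>R z (p + j))"
        by (simp add: v_def sum_subtractf scaleR_left_diff_distrib)
      also have "norm \<dots> \<le> (\<Sum>j<n. \<bar>a j - b j\<bar>)" by (intro sum_norm_le) (simp add: z1)
      finally show ?thesis by (smt (verit) norm_triangle_ineq3)
    qed
    then show "\<exists>M. \<forall>p\<ge>M. \<bar>norm (v n a p) - norm (v n b p)\<bar> \<le> (\<Sum>j<n. \<bar>a j - b j\<bar>)" by blast
  qed
  have Nneg: "N n (\<lambda>j. - a j) = N n a" for n a
    using N[of n "\<lambda>j. - a j"] N[of n a] vscale[of n "-1" a] by (simp add: LIMSEQ_unique)
  \<comment> \<open>\<open>\<phi>\<close> represents a functional dominated by the limit norm
    \<open>N\<close> and attaining it at \<open>a\<close>.\<close>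
  define P where "P \<phi> n a \<longleftrightarrow> (\<forall>i. \<bar>\<phi> i\<bar> \<le> 1) \<and> (\<forall>m b. (\<Sum>j<m. b j * \<phi> j) \<le> N m b) \<and>
      (\<Sum>j<n. a j * \<phi> j) = N n a" for \<phi> :: "nat \<Rightarrow> real" and n a
  have "\<exists>\<phi>. P \<phi> n a" for n a
  proof -
    have "\<exists>f. f \<in> dual_ball \<and> f (v n a p) = norm (v n a p)" for p
      by (metis Hahn_Banach_norming)
    then obtain F where F: "\<And>p. F p \<in> dual_ball" "\<And>p. F p (v n a p) = norm (v n a p)" by metis
    have Fle: "F p u \<le> norm u" for p u
      using dual_ball_le[OF F(1), of p u] by linarith
    \<comment> \<open>Only the countably many values of \<open>F p\<close> on the shifted sequence
      matter, so compactness of a countable product gives a convergent subsequence.\<close>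
    define g where "g p i = F p (z (p + i))" for p i
    have "compact (PiE UNIV (\<lambda>_::nat. {-1..1::real}))"
      using compactin_PiE[of "\<lambda>_::nat. euclidean :: real topology" UNIV "\<lambda>_. {-1..1}"]
      by (simp add: euclidean_product_topology)
    then have sc: "seq_compact (PiE UNIV (\<lambda>_::nat. {-1..1::real}))"
      by (rule compact_imp_seq_compact)
    have "g p \<in> PiE UNIV (\<lambda>_. {-1..1})" for p
    proof -
      have "\<bar>g p i\<bar> \<le> 1" for i using dual_ball_le[OF F(1), of p "z (p + i)"] by (simp add: g_def z1)
      then show ?thesis by (auto simp: PiE_def abs_le_iff minus_le_iff)
    qed
    then obtain \<phi> q where \<phi>: "\<phi> \<in> PiE UNIV (\<lambda>_. {-1..1})" and q: "strict_mono q" "(g \<circ> q) \<longlonglongrightarrow> \<phi>"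
      using sc unfolding seq_compact_def by metis
    have lim: "(\<lambda>p. g (q p) i) \<longlonglongrightarrow> \<phi> i" for i
    proof -
      have "isCont (\<lambda>f :: nat \<Rightarrow> real. f i) \<phi>"
        using continuous_on_product_coordinates[of i] continuous_on_eq_continuous_at[OF open_UNIV] by blast
      from isCont_tendsto_compose[OF this q(2)] show ?thesis by (simp add: comp_def)
    qed
    have gsum: "(\<Sum>j<m. b j * g p j) = F p (v m b p)" for m b p
      unfolding g_def v_def using dual_ball_linear[OF F(1)]
      by (simp add: linear_sum linear_scale)
    have lims: "(\<lambda>p. F (q p) (v m b (q p))) \<longlonglongrightarrow> (\<Sum>j<m. b j * \<phi> j)" for m b
      unfolding gsum[symmetric] by (intro tendsto_intros lim)
    have limN: "(\<lambda>p. norm (v m b (q p))) \<longlonglongrightarrow> N m b" for m b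
      using LIMSEQ_subseq_LIMSEQ[OF N q(1)] by (simp add: comp_def)
    show ?thesis
      unfolding P_def
    proof (intro exI[of _ \<phi>] conjI allI)
      show "\<bar>\<phi> i\<bar> \<le> 1" for i using \<phi> by (auto simp: PiE_iff abs_le_iff minus_le_iff)
      show "(\<Sum>j<m. b j * \<phi> j) \<le> N m b" for m b
        using Fle by (intro LIMSEQ_le[OF lims limN]) blast
      show "(\<Sum>j<n. a j * \<phi> j) = N n a"
        using lims[of n a] limN[of n a] by (simp add: F(2) LIMSEQ_unique)
    qed
  qed
  then obtain \<phi> where "P (\<phi> n a) n a" for n a by metis
  then have \<phi>1: "\<bar>\<phi> n a i\<bar> \<le> 1" and \<phi>N: "(\<Sum>j<m. b j * \<phi> n a j) \<le> N m b"
    and \<phi>eq: "(\<Sum>j<n. a j * \<phi> n a j) = N n a" for n a i m b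
    unfolding P_def by blast+
  define q where "q c = (from_nat c :: rat list)" for c
  define \<psi> where "\<psi> c = \<phi> (length (q c)) (\<lambda>j. of_rat (q c ! j))" for c
  define e where "e i = (Bcontfun (\<lambda>c. \<psi> c i) :: ell_infty)" for i
  have e: "apply_bcontfun (e i) c = \<psi> c i" for i c
    unfolding e_def by (subst apply_bcontfun_Bcontfun[where B = 1]) (auto simp: \<psi>_def \<phi>1)
  have eN: "norm (\<Sum>j<n. b j *\<^sub>R e j) = N n b" for n b
  proof (rule antisym)
    have coord: "apply_bcontfun (\<Sum>j<n. b j *\<^sub>R e j) c = (\<Sum>j<n. b j * \<psi> c j)" for c
      by (simp add: apply_bcontfun_sum e)
    show "norm (\<Sum>j<n. b j *\<^sub>R e j) \<le> N n b"
    proof (rule norm_bound)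
      fix c
      have "(\<Sum>j<n. b j * \<psi> c j) \<le> N n b" "(\<Sum>j<n. - b j * \<psi> c j) \<le> N n (\<lambda>j. - b j)"
        unfolding \<psi>_def by (rule \<phi>N)+
      then show "norm (apply_bcontfun (\<Sum>j<n. b j *\<^sub>R e j) c) \<le> N n b"
        by (simp add: coord Nneg sum_negf)
    qed
    show "N n b \<le> norm (\<Sum>j<n. b j *\<^sub>R e j)"
    proof (rule field_le_epsilon)
      fix \<epsilon> :: real assume eps: "0 < \<epsilon>"
      define d where "d = \<epsilon> / (2 * (real n + 1))"
      have "0 < d" using eps by (simp add: d_def)
      have "\<exists>s::rat. \<bar>of_rat s - b j\<bar> < d" for j
      proof -
        obtain s where "b j < of_rat s" "of_rat s < b j + d"
          using of_rat_dense[of "b j" "b j + d"] \<open>0 < d\<close> by auto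
        then show ?thesis by (intro exI[of _ s]) linarith
      qed
      then obtain s where s: "\<And>j. \<bar>of_rat (s j) - b j\<bar> < d" by metis
      define c where "c = to_nat (map s [0..<n])"
      have qc: "q c = map s [0..<n]" by (simp add: q_def c_def)
      define a where "a j = (of_rat (q c ! j) :: real)" for j
      have ab: "\<bar>a j - b j\<bar> \<le> d" if "j < n" for j
        using s[of j] that by (simp add: a_def qc less_imp_le)
      have sumd: "(\<Sum>j<n. \<bar>a j - b j\<bar>) \<le> \<epsilon> / 2"
      proof -
        have "(\<Sum>j<n. \<bar>a j - b j\<bar>) \<le> (\<Sum>j<n. d)" by (intro sum_mono) (simp add: ab)
        also have "\<dots> \<le> \<epsilon> / 2" using eps by (simp add: d_def field_simps)
        finally show ?thesis .
      qed
      have "\<psi> c = \<phi> n a" by (simp add: \<psi>_def qc a_def[abs_def])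
      then have "N n a = (\<Sum>j<n. a j * \<psi> c j)"
        using \<phi>eq[where n = n and a = a] by simp
      also have "\<dots> = (\<Sum>j<n. b j * \<psi> c j) + (\<Sum>j<n. (a j - b j) * \<psi> c j)"
        by (simp add: sum.distrib[symmetric] algebra_simps)
      also have "(\<Sum>j<n. (a j - b j) * \<psi> c j) \<le> (\<Sum>j<n. \<bar>a j - b j\<bar>)"
      proof (rule sum_mono)
        fix j
        have "(a j - b j) * \<psi> c j \<le> \<bar>a j - b j\<bar> * \<bar>\<psi> c j\<bar>" by (metis abs_ge_self abs_mult)
        also have "\<dots> \<le> \<bar>a j - b j\<bar> * 1" by (intro mult_left_mono) (auto simp: \<psi>_def \<phi>1)
        finally show "(a j - b j) * \<psi> c j \<le> \<bar>a j - b j\<bar>" by simp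
      qed
      also have "(\<Sum>j<n. b j * \<psi> c j) \<le> norm (\<Sum>j<n. b j *\<^sub>R e j)"
        using norm_bounded[of "\<Sum>j<n. b j *\<^sub>R e j" c] by (simp add: coord)
      finally have "N n a \<le> norm (\<Sum>j<n. b j *\<^sub>R e j) + (\<Sum>j<n. \<bar>a j - b j\<bar>)" by simp
      then show "N n b \<le> norm (\<Sum>j<n. b j *\<^sub>R e j) + \<epsilon>"
        using Ndiff[of n a b] sumd by linarith
    qed
  qed
  have e1: "norm (e i) = 1" for i
  proof -
    have "e i = (\<Sum>j<Suc i. (if j = i then 1 else 0) *\<^sub>R e j)"
      by (simp add: if_distrib[of "\<lambda>c. c *\<^sub>R _"] cong: if_cong)
    then have "norm (e i) = N (Suc i) (\<lambda>j. if j = i then 1 else 0)" by (metis eN)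
    moreover have "v (Suc i) (\<lambda>j. if j = i then 1 else 0) p = z (p + i)" for p
      by (simp add: v_def)
    then have "(\<lambda>p. norm (v (Suc i) (\<lambda>j. if j = i then 1 else 0) p)) \<longlonglongrightarrow> 1" by (simp add: z1)
    ultimately show ?thesis using N LIMSEQ_unique by metis
  qed
  have "basic_sequence e"
  proof (rule basic_sequenceI)
    show "e i \<noteq> 0" for i using e1[of i] by auto
    show "norm (\<Sum>i<m. a i *\<^sub>R e i) \<le> C * norm (\<Sum>i<n. a i *\<^sub>R e i)" if "m \<le> n" for a m n
      unfolding eN
    proof (rule LIMSEQ_le[OF N tendsto_mult_left[OF N]])
      have "strict_mono (\<lambda>i. r (p + i))" for p using r by (simp add: strict_mono_def)
      then show "\<exists>M. \<forall>p\<ge>M. norm (v m a p) \<le> C * norm (v n a p)"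
        unfolding v_def z_def comp_def using C[OF _ that] by blast
    qed
  qed
  \<comment> \<open>The bound 1 / n is replaced by 2 / (n + 1) because 1 / 0 is 0, so that 1 / n
    would not be decreasing from n = 0 to n = 1.\<close>
  moreover have "\<bar>norm (\<Sum>j<n. a j *\<^sub>R z (k j)) - norm (\<Sum>j<n. a j *\<^sub>R e j)\<bar> \<le> 2 / real (Suc n)"
    if n: "1 \<le> n" and a: "\<forall>j<n. a j \<in> {-1..1}" and k: "strict_mono_on {..<n} k" "n \<le> Suc (k 0)" for n a k
  proof -
    have "\<bar>norm (\<Sum>j<n. a j *\<^sub>R z (k j)) - N n a\<bar> \<le> 1 / real n"
    proof (rule LIMSEQ_le_const2)
      show "(\<lambda>p. \<bar>norm (\<Sum>j<n. a j *\<^sub>R z (k j)) - norm (v n a p)\<bar>) \<longlonglongrightarrow> \<bar>norm (\<Sum>j<n. a j *\<^sub>R z (k j)) - N n a\<bar>"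
        by (intro tendsto_intros N)
      have "\<bar>norm (\<Sum>j<n. a j *\<^sub>R z (k j)) - norm (v n a p)\<bar> \<le> 1 / real n" if "n \<le> p" for p
        unfolding v_def z_def comp_def
        by (rule close[OF n _ k(1), where k' = "\<lambda>j. p + j"]) (use that a k in \<open>auto simp: strict_mono_on_def\<close>)
      then show "\<exists>M. \<forall>p\<ge>M. \<bar>norm (\<Sum>j<n. a j *\<^sub>R z (k j)) - norm (v n a p)\<bar> \<le> 1 / real n" by blast
    qed
    also have "1 / real n \<le> 2 / real (Suc n)" using n by (simp add: field_simps)
    finally show ?thesis by (simp add: eN)
  qed
  moreover have "decseq (\<lambda>n. 2 / real (Suc n))" by (auto simp: decseq_def frac_le)
  moreover have "(\<lambda>n. 2 / real (Suc n)) \<longlonglongrightarrow> 0"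
    by (rule LIMSEQ_Suc[OF lim_const_over_n])
  ultimately have "spreading_model z e"
    unfolding spreading_model_def normalized_def using e1 by blast
  then show ?thesis using that r by (simp add: z_def)
qed

subsection \<open>Weakly null block sequences\<close>

text \<open>Block sequences with zero terms allowed and without a common coefficient sequence; in
  this form the notion passes to subsequences and multiples.\<close>

definition successive_blocks :: "(nat \<Rightarrow> 'a::real_normed_vector) \<Rightarrow> (nat \<Rightarrow> 'a) \<Rightarrow> bool"
  where "successive_blocks x u \<longleftrightarrow> (\<exists>p. strict_mono p \<and> (\<forall>i. u i \<in> span (x ` {p i..<p (Suc i)})))"

lemma successive_blocks_subseq:
  assumes "successive_blocks x u" "strict_mono k"
  shows "successive_blocks x (u \<circ> k)"
proof -
  obtain p where p: "strict_mono p" "\<And>i. u i \<in> span (x ` {p i..<p (Suc i)})"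
    using assms(1) by (auto simp: successive_blocks_def)
  have "p (Suc (k i)) \<le> p (k (Suc i))" for i
    using p(1) assms(2) by (meson Suc_leI lessI strict_monoD strict_mono_less_eq)
  \<comment> \<open>Skipped blocks are absorbed into the interval of the preceding selected
    one.\<close>
  then have "span (x ` {p (k i)..<p (Suc (k i))}) \<subseteq> span (x ` {p (k i)..<p (k (Suc i))})" for i
    by (intro span_mono image_mono) auto
  then have "(u \<circ> k) i \<in> span (x ` {(p \<circ> k) i..<(p \<circ> k) (Suc i)})" for i
    using p(2)[of "k i"] by auto
  then show ?thesis
    unfolding successive_blocks_def using p(1) assms(2) strict_mono_o by blast
qed

lemma successive_blocks_scale:
  "successive_blocks x u \<Longrightarrow> successive_blocks x (\<lambda>i. c i *\<^sub>R u i)"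
  unfolding successive_blocks_def by (meson span_scale)

lemma span_image_eq_sum:
  fixes x :: "nat \<Rightarrow> 'a::real_normed_vector"
  assumes "v \<in> span (x ` A)" "finite A"
  shows "\<exists>b. v = (\<Sum>j\<in>A. b j *\<^sub>R x j)"
  using assms(1)
proof (induction rule: span_induct_alt)
  case base
  show ?case by (rule exI[of _ "\<lambda>_. 0"]) simp
next
  case (step c w v)
  then obtain b j where b: "v = (\<Sum>j\<in>A. b j *\<^sub>R x j)" "j \<in> A" "w = x j" by auto
  have "(\<Sum>i\<in>A. (b i + (if i = j then c else 0)) *\<^sub>R x i) =
      v + (\<Sum>i\<in>A. if i = j then c *\<^sub>R x i else 0)"
    unfolding b(1) sum.distrib[symmetric] by (intro sum.cong) (auto simp: algebra_simps)
  then show ?case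
    using b assms(2) by (intro exI[of _ "\<lambda>i. b i + (if i = j then c else 0)"]) simp
qed

text \<open>The blocks are disjoint, so their separate coefficients merge into the single sequence
  that \<open>block_basis\<close> asks for; \<open>\<iota> j\<close> numbers the block containing
  \<open>j\<close>.\<close>

lemma successive_blocks_coeffs:
  fixes x :: "nat \<Rightarrow> 'a::real_normed_vector"
  assumes "successive_blocks x u"
  obtains p b \<iota> where "strict_mono p" "\<And>i. u i = (\<Sum>j\<in>{p i..<p (Suc i)}. b j *\<^sub>R x j)"
    "\<And>i j. j \<in> {p i..<p (Suc i)} \<Longrightarrow> \<iota> j = i"
proof -
  obtain p where p: "strict_mono p" "\<And>i. u i \<in> span (x ` {p i..<p (Suc i)})"
    using assms by (auto simp: successive_blocks_def)
  have "\<exists>b. u i = (\<Sum>j\<in>{p i..<p (Suc i)}. b j *\<^sub>R x j)" for i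
    by (rule span_image_eq_sum[OF p(2)]) simp
  then obtain b where b: "\<And>i. u i = (\<Sum>j\<in>{p i..<p (Suc i)}. b i j *\<^sub>R x j)" by metis
  define \<iota> where "\<iota> j = (LEAST i. j < p (Suc i))" for j
  have \<iota>: "\<iota> j = i" if "j \<in> {p i..<p (Suc i)}" for i j
    unfolding \<iota>_def
  proof (rule Least_equality)
    fix i' assume "j < p (Suc i')"
    then have "p i < p (Suc i')" using that by auto
    then show "i \<le> i'" using p(1) by (auto simp: strict_mono_less)
  qed (use that in auto)
  show ?thesis
  proof (rule that[OF p(1)])
    show "u i = (\<Sum>j\<in>{p i..<p (Suc i)}. b (\<iota> j) j *\<^sub>R x j)" for i
      unfolding b by (intro sum.cong) (auto simp: \<iota>)
  qed (rule \<iota>)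
qed

lemma block_basisI:
  assumes "successive_blocks x u" "\<And>i. u i \<noteq> 0"
  shows "block_basis x u"
  using successive_blocks_coeffs[OF assms(1)] assms(2) unfolding block_basis_def by metis

lemma successive_blocks_basis_inequality:
  fixes x :: "nat \<Rightarrow> 'a::real_normed_vector"
  assumes C: "\<And>a m n. m \<le> n \<Longrightarrow> norm (\<Sum>i<m. a i *\<^sub>R x i) \<le> C * norm (\<Sum>i<n. a i *\<^sub>R x i)"
    and u: "successive_blocks x u" and "m \<le> n"
  shows "norm (\<Sum>i<m. a i *\<^sub>R u i) \<le> C * norm (\<Sum>i<n. a i *\<^sub>R u i)"
proof -
  obtain p b \<iota> where p: "strict_mono p" and b: "\<And>i. u i = (\<Sum>j\<in>{p i..<p (Suc i)}. b j *\<^sub>R x j)"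
    and \<iota>: "\<And>i j. j \<in> {p i..<p (Suc i)} \<Longrightarrow> \<iota> j = i"
    using successive_blocks_coeffs[OF u] by metis
  \<comment> \<open>Below \<open>p 0\<close> there is no block and \<open>\<iota>\<close> carries no
    information, so the coefficient is 0.\<close>
  define d where "d j = (if p 0 \<le> j then a (\<iota> j) * b j else 0)" for j
  have eq: "(\<Sum>i<m. a i *\<^sub>R u i) = (\<Sum>j<p m. d j *\<^sub>R x j)" for m
  proof (induction m)
    case 0
    then show ?case by (simp add: d_def)
  next
    case (Suc m)
    have pm: "p m \<le> p (Suc m)" using p by (simp add: strict_mono_less_eq)
    have "a m *\<^sub>R u m = (\<Sum>j\<in>{p m..<p (Suc m)}. d j *\<^sub>R x j)"
      unfolding b scaleR_sum_right
    proof (rule sum.cong)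
      fix j assume j: "j \<in> {p m..<p (Suc m)}"
      moreover have "p 0 \<le> p m" using p by (simp add: strict_mono_less_eq)
      ultimately show "a m *\<^sub>R b j *\<^sub>R x j = d j *\<^sub>R x j" using \<iota>[OF j] by (simp add: d_def)
    qed simp
    moreover have "{..<p (Suc m)} = {..<p m} \<union> {p m..<p (Suc m)}" using pm by auto
    then have "(\<Sum>j<p (Suc m). d j *\<^sub>R x j) = (\<Sum>j<p m. d j *\<^sub>R x j) + (\<Sum>j\<in>{p m..<p (Suc m)}. d j *\<^sub>R x j)"
      by (metis sum.union_disjoint finite_lessThan finite_atLeastLessThan ivl_disj_int_one(2))
    ultimately show ?case using Suc by simp
  qed
  show ?thesis
    unfolding eq by (rule C) (use p \<open>m \<le> n\<close> in \<open>simp add: strict_mono_less_eq\<close>)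
qed

section \<open>Weakly null sequences and norms of differences\<close>

lemma weakly_null_compose:
  assumes "weakly_null u" "filterlim k sequentially sequentially"
  shows "weakly_null (\<lambda>i. u (k i))"
  using assms filterlim_compose unfolding weakly_null_def by blast

lemma weakly_null_scale:
  assumes u: "weakly_null u" and B: "\<And>i. \<bar>c i\<bar> \<le> B"
  shows "weakly_null (\<lambda>i. c i *\<^sub>R u i)"
  unfolding weakly_null_def
proof (intro allI impI)
  fix f :: "'a \<Rightarrow> real" assume f: "bounded_linear f"
  then interpret bounded_linear f .
  have "(\<lambda>n. B * \<bar>f (u n)\<bar>) \<longlonglongrightarrow> B * \<bar>0\<bar>"
    using u f by (intro tendsto_intros) (auto simp: weakly_null_def)
  then have lim: "(\<lambda>n. B * \<bar>f (u n)\<bar>) \<longlonglongrightarrow> 0" by simp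
  show "(\<lambda>n. f (c n *\<^sub>R u n)) \<longlonglongrightarrow> 0"
  proof (rule Lim_null_comparison[OF _ lim], rule always_eventually, rule allI)
    show "norm (f (c n *\<^sub>R u n)) \<le> B * \<bar>f (u n)\<bar>" for n
      using mult_right_mono[OF B[of n] abs_ge_zero[of "f (u n)"]] by (simp add: scale abs_mult)
  qed
qed

lemma weakly_null_diff:
  assumes "weakly_null u" "weakly_null v"
  shows "weakly_null (\<lambda>i. u i - v i)"
  unfolding weakly_null_def
proof (intro allI impI)
  fix f :: "'a \<Rightarrow> real" assume f: "bounded_linear f"
  then have "(\<lambda>n. f (u n) - f (v n)) \<longlonglongrightarrow> 0 - 0"
    using assms by (intro tendsto_intros) (auto simp: weakly_null_def)
  then show "(\<lambda>n. f (u n - v n)) \<longlonglongrightarrow> 0"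
    using f by (simp add: linear_diff bounded_linear.linear)
qed

text \<open>The combination 1, -1 is padded with zeros to length \<open>n\<close>; with only two
  terms the error bound would be the fixed second member of the null sequence.\<close>

lemma spreading_model_pair:
  assumes "spreading_model y e" "0 < \<epsilon>"
  shows "\<exists>N. \<forall>i j. N \<le> i \<longrightarrow> i < j \<longrightarrow> \<bar>norm (y i - y j) - norm (e 0 - e 1)\<bar> < \<epsilon>"
proof -
  obtain \<delta> where \<delta>: "\<delta> \<longlonglongrightarrow> 0"
    and close: "\<And>n (a :: nat \<Rightarrow> real) k. 1 \<le> n \<Longrightarrow> \<forall>j<n. a j \<in> {-1..1} \<Longrightarrow> strict_mono_on {..<n} k \<Longrightarrow>
      n \<le> Suc (k 0) \<Longrightarrow> \<bar>norm (\<Sum>j<n. a j *\<^sub>R y (k j)) - norm (\<Sum>j<n. a j *\<^sub>R e j)\<bar> \<le> \<delta> n"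
    using assms(1) unfolding spreading_model_def by blast
  from LIMSEQ_D[OF \<delta> assms(2)] obtain n0 where n0: "\<And>n. n0 \<le> n \<Longrightarrow> \<bar>\<delta> n\<bar> < \<epsilon>" by auto
  define n where "n = n0 + 2"
  define a where "a j = (if j = 0 then 1 else if j = 1 then - 1 else 0 :: real)" for j :: nat
  have sum_a: "(\<Sum>j<n. a j *\<^sub>R z j) = z 0 - z 1" for z :: "nat \<Rightarrow> 'c::real_normed_vector"
  proof -
    have "(\<Sum>j<n. a j *\<^sub>R z j) = (\<Sum>j\<in>{0,1}. a j *\<^sub>R z j)"
      by (rule sum.mono_neutral_right) (auto simp: a_def n_def)
    then show ?thesis by (simp add: a_def)
  qed
  have "\<bar>norm (y i - y j) - norm (e 0 - e 1)\<bar> < \<epsilon>" if "n \<le> i" "i < j" for i j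
  proof -
    define k where "k l = (if l = 0 then i else j + l)" for l :: nat
    define k' where "k' l = (if l = 0 then i else j + (l - 1))" for l :: nat
    have "\<bar>norm (\<Sum>l<n. a l *\<^sub>R y (k' l)) - norm (\<Sum>l<n. a l *\<^sub>R e l)\<bar> \<le> \<delta> n"
      by (rule close) (use that in \<open>auto simp: n_def a_def k'_def strict_mono_on_def\<close>)
    then have "\<bar>norm (y i - y j) - norm (e 0 - e 1)\<bar> \<le> \<delta> n"
      using sum_a[of "\<lambda>l. y (k' l)"] sum_a[of e] by (simp add: k'_def)
    then show ?thesis using n0[of n] by (simp add: n_def)
  qed
  then show ?thesis by blast
qed

text \<open>After normalization the hypothesis on spreading models makes differences of suitable far
  terms nearly of norm 1, hence \<open>u i - u j\<close> nearly of norm \<open>l\<close>, the limit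
  of the norms along a subsequence. The lower bound \<open>c\<close> keeps the normalized sequence
  weakly null.\<close>

lemma close_pair_in_weakly_null_blocks:
  fixes x :: "nat \<Rightarrow> 'a::real_normed_vector"
  assumes C: "\<And>a m n. m \<le> n \<Longrightarrow> norm (\<Sum>i<m. a i *\<^sub>R x i) \<le> C * norm (\<Sum>i<n. a i *\<^sub>R x i)"
    and sm: "\<And>y (e :: nat \<Rightarrow> ell_infty). block_basis x y \<Longrightarrow> normalized y \<Longrightarrow> weakly_null y \<Longrightarrow>
      spreading_model y e \<Longrightarrow> norm (e 0 - e 1) = 1"
    and u: "successive_blocks x u" "weakly_null u" "\<And>i. c \<le> norm (u i)" "\<And>i. norm (u i) \<le> K"
    and "0 < c" "0 < \<eta>"
  shows "\<exists>i j. N \<le> i \<and> i < j \<and> norm (u i - u j) \<le> K + \<eta>"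
proof -
  have "seq_compact {c..K}" by (simp add: compact_imp_seq_compact)
  moreover have "\<forall>n. norm (u n) \<in> {c..K}" using u(3,4) by simp
  ultimately obtain l s where l: "l \<in> {c..K}" and s: "strict_mono s" "((\<lambda>n. norm (u n)) \<circ> s) \<longlonglongrightarrow> l"
    by (rule seq_compactE)
  define w where "w i = inverse (norm (u (s i))) *\<^sub>R u (s i)" for i
  have unz: "0 < norm (u i)" for i using u(3)[of i] \<open>0 < c\<close> by linarith
  have w1: "norm (w i) = 1" for i using unz[of "s i"] by (simp add: w_def)
  have wb: "successive_blocks x w"
    using successive_blocks_scale[OF successive_blocks_subseq[OF u(1) s(1)]]
    unfolding w_def[abs_def] comp_def .
  have wn: "weakly_null w"
    unfolding w_def[abs_def]
  proof (rule weakly_null_scale)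
    show "weakly_null (\<lambda>i. u (s i))" by (rule weakly_null_compose[OF u(2) filterlim_subseq[OF s(1)]])
    show "\<bar>inverse (norm (u (s i)))\<bar> \<le> inverse c" for i
      using u(3)[of "s i"] \<open>0 < c\<close> by (simp add: le_imp_inverse_le)
  qed
  obtain r and e :: "nat \<Rightarrow> ell_infty" where r: "strict_mono r" and e: "spreading_model (w \<circ> r) e"
  proof (rule spreading_model_exists[of w C])
    show "normalized w" by (simp add: normalized_def w1)
    show "norm (\<Sum>i<m. a i *\<^sub>R w (k i)) \<le> C * norm (\<Sum>i<n. a i *\<^sub>R w (k i))"
      if "strict_mono k" "m \<le> n" for a :: "nat \<Rightarrow> real" and m n k
      using successive_blocks_basis_inequality[OF C successive_blocks_subseq[OF wb that(1)] that(2)] by simp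
  qed
  have e1: "norm (e 0 - e 1) = 1"
  proof (rule sm[OF _ _ _ e])
    show "block_basis x (w \<circ> r)"
      by (rule block_basisI[OF successive_blocks_subseq[OF wb r]]) (metis w1 comp_apply norm_zero zero_neq_one)
    show "weakly_null (w \<circ> r)"
      using weakly_null_compose[OF wn filterlim_subseq[OF r]] by (simp add: comp_def)
  qed (simp add: normalized_def w1)
  have K: "0 < K" using l \<open>0 < c\<close> by auto
  \<comment> \<open>One third of \<open>\<eta>\<close> goes to the difference of the normalized
    vectors and one third to each of the two norms.\<close>
  define \<delta> where "\<delta> = \<eta> / (3 * K)"
  have "0 < \<delta>" using K \<open>0 < \<eta>\<close> by (simp add: \<delta>_def)
  from spreading_model_pair[OF e this] obtain N1 where
    N1: "\<And>i j. N1 \<le> i \<Longrightarrow> i < j \<Longrightarrow> \<bar>norm (w (r i) - w (r j)) - 1\<bar> < \<delta>" unfolding e1 by auto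
  obtain N2 where N2: "\<And>i. N2 \<le> i \<Longrightarrow> \<bar>norm (u (s i)) - l\<bar> < \<eta> / 3"
    using LIMSEQ_D[OF s(2), of "\<eta> / 3"] \<open>0 < \<eta>\<close> by auto
  define q where "q = max N (max N1 N2)"
  have qN: "N \<le> q" "N1 \<le> q" "N2 \<le> q" by (auto simp: q_def le_max_iff_disj)
  define i where "i = s (r q)"
  define j where "j = s (r (Suc q))"
  have ge: "q \<le> r q" "r q \<le> s (r q)" "Suc q \<le> r (Suc q)"
    using r s(1) by (auto intro: strict_mono_imp_increasing)
  have "i < j" using r s(1) by (simp add: i_def j_def strict_mono_less)
  moreover have "N \<le> i" using ge qN by (simp add: i_def)
  moreover have "norm (u i - u j) \<le> K + \<eta>"
  proof -
    let ?p = "r q" and ?p' = "r (Suc q)"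
    have uw: "u (s p) = norm (u (s p)) *\<^sub>R w p" for p using unz[of "s p"] by (simp add: w_def)
    have 1: "u i - u j = l *\<^sub>R (w ?p - w ?p') + (norm (u i) - l) *\<^sub>R w ?p - (norm (u j) - l) *\<^sub>R w ?p'"
      unfolding i_def j_def by (subst (1 2) uw) (simp add: algebra_simps)
    have "norm (u i - u j) \<le> norm (l *\<^sub>R (w ?p - w ?p')) + norm ((norm (u i) - l) *\<^sub>R w ?p)
        + norm ((norm (u j) - l) *\<^sub>R w ?p')"
      unfolding 1 using norm_triangle_ineq4 norm_triangle_ineq by (smt (verit))
    also have "\<dots> = l * norm (w ?p - w ?p') + \<bar>norm (u i) - l\<bar> + \<bar>norm (u j) - l\<bar>"
      using l \<open>0 < c\<close> by (simp add: w1)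
    also have "\<dots> \<le> K * (1 + \<delta>) + \<eta> / 3 + \<eta> / 3"
    proof (intro add_mono mult_mono)
      show "norm (w ?p - w ?p') \<le> 1 + \<delta>"
        using N1[of q "Suc q"] qN by linarith
      show "\<bar>norm (u i) - l\<bar> \<le> \<eta> / 3" "\<bar>norm (u j) - l\<bar> \<le> \<eta> / 3"
        using N2[of ?p] N2[of ?p'] ge qN by (auto simp: i_def j_def)
    qed (use l K in auto)
    also have "\<dots> = K + \<eta>" using K by (simp add: \<delta>_def field_simps)
    finally show ?thesis .
  qed
  ultimately show ?thesis by blast
qed

subsection \<open>Weakly null diagonal sequences\<close>

lemma strict_mono_on_image_lessThan_eqD:
  fixes h h' :: "nat \<Rightarrow> nat"
  assumes "strict_mono_on {..<m} h" "strict_mono_on {..<m'} h'" "h ` {..<m} = h' ` {..<m'}"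
  shows "m = m'" "i < m \<Longrightarrow> h i = h' i"
proof -
  have "card (h ` {..<m}) = m" "card (h' ` {..<m'}) = m'"
    using card_image[OF strict_mono_on_imp_inj_on] assms by fastforce+
  then show "m = m'" using assms(3) by simp
  have "map h [0..<m] = map h' [0..<m']"
    using sorted_list_of_set_strict_mono_image assms by metis
  then show "h i = h' i" if "i < m"
    using that \<open>m = m'\<close> by (simp add: list_eq_iff_nth_eq)
qed

lemma range_Int_lessThan:
  fixes h :: "nat \<Rightarrow> nat"
  assumes "strict_mono h"
  obtains m where "range h \<inter> {..<n} = h ` {..<m}"
proof
  define m where "m = (LEAST i. n \<le> h i)"
  have "n \<le> h n" using assms by (rule strict_mono_imp_increasing)
  then have m: "n \<le> h m" unfolding m_def by (rule LeastI)
  show "range h \<inter> {..<n} = h ` {..<m}"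
  proof (intro equalityI subsetI)
    fix k assume "k \<in> range h \<inter> {..<n}"
    then obtain i where i: "k = h i" "h i < h m" using m by auto
    then have "i < m" using assms by (simp add: strict_mono_less)
    then show "k \<in> h ` {..<m}" using i by blast
  next
    fix k assume "k \<in> h ` {..<m}"
    then obtain i where i: "i < m" "k = h i" by auto
    then have "\<not> n \<le> h i" unfolding m_def by (metis not_less_Least)
    then show "k \<in> range h \<inter> {..<n}" using i by auto
  qed
qed

lemma Galvin_sequences:
  fixes P :: "nat \<Rightarrow> (nat \<Rightarrow> nat) \<Rightarrow> bool"
  assumes N: "infinite N"
    and P: "\<And>m h h'. (\<And>i. i < m \<Longrightarrow> h i = h' i) \<Longrightarrow> P m h \<Longrightarrow> P m h'"
  obtains (avoids) M where "M \<subseteq> N" "infinite M"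
      "\<And>m h. strict_mono h \<Longrightarrow> range h \<subseteq> M \<Longrightarrow> \<not> P m h"
  | (catches) M where "M \<subseteq> N" "infinite M"
      "\<And>h. strict_mono h \<Longrightarrow> range h \<subseteq> M \<Longrightarrow> \<exists>m. P m h"
proof -
  define \<G> where "\<G> = {h ` {..<m} | h m. strict_mono_on {..<m} h \<and> P m h}"
  show ?thesis
  proof (cases rule: Galvin[OF N, of \<G>])
    case (1 M)
    show ?thesis
    proof (rule avoids[OF 1(1,2)])
      fix m and h :: "nat \<Rightarrow> nat" assume h: "strict_mono h" "range h \<subseteq> M"
      show "\<not> P m h"
      proof
        assume "P m h"
        then have "h ` {..<m} \<in> \<G>"
          unfolding \<G>_def using monotone_on_subset[OF h(1) subset_UNIV] by blast
        moreover have "h ` {..<m} \<subseteq> M" using h(2) by auto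
        ultimately show False using 1(3)[of "h ` {..<m}"] by simp
      qed
    qed
  next
    case (2 M)
    show ?thesis
    proof (rule catches[OF 2(1,2)])
      fix h :: "nat \<Rightarrow> nat" assume h: "strict_mono h" "range h \<subseteq> M"
      have inf: "infinite (range h)" using h(1) by (simp add: range_inj_infinite strict_mono_imp_inj_on)
      then obtain n where n: "range h \<inter> {..<n} \<in> \<G>" using 2(3) h(2) by blast
      obtain m where m: "range h \<inter> {..<n} = h ` {..<m}"
        using range_Int_lessThan[OF h(1)] .
      obtain h' :: "nat \<Rightarrow> nat" and m' where h': "strict_mono_on {..<m'} h'" "P m' h'" "h ` {..<m} = h' ` {..<m'}"
        using n unfolding m \<G>_def by blast
      have hm: "strict_mono_on {..<m} h" using monotone_on_subset[OF h(1) subset_UNIV] .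
      note eq = strict_mono_on_image_lessThan_eqD[OF hm h'(1,3)]
      have "P m h"
        by (rule P[of m h' h]) (use eq h'(2) in auto)
      then show "\<exists>m. P m h" ..
    qed
  qed
qed

text \<open>Boolean independence as in Rosenthal's theorem. Subtracting the functionals for a sign
  pattern and for its complement cancels \<open>s\<close> and leaves a functional of norm at most 2
  with values at least \<delta> on the pattern and at most - \<delta> off it, whence the lower
  estimate \<delta> / 2.\<close>

lemma ell1_embedsI:
  fixes w :: "nat \<Rightarrow> 'a::banach"
  assumes wK: "\<And>j. norm (w j) \<le> K" and \<delta>: "0 < \<delta>"
    and indep: "\<And>n S. \<exists>f\<in>dual_ball. \<forall>j<n. (j \<in> S \<longrightarrow> s + \<delta> \<le> f (w j)) \<and> (j \<notin> S \<longrightarrow> f (w j) \<le> s)"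
  shows "ell1_embeds_into TYPE('a)"
proof -
  define K' where "K' = max 1 K"
  have K': "0 < K'" "\<And>j. norm (w j) \<le> K'" using wK by (auto simp: K'_def intro: max.coboundedI2)
  define T where "T a = (\<Sum>j. a j *\<^sub>R w j)" for a :: "nat \<Rightarrow> real"
  have nrm: "norm (a j *\<^sub>R w j) \<le> K' * \<bar>a j\<bar>" for a j
    using mult_left_mono[OF K'(2)[of j] abs_ge_zero[of "a j"]] by (simp add: mult.commute)
  have sumK: "summable (\<lambda>j. K' * \<bar>a j\<bar>)" if "a \<in> ell1" for a
    using that by (intro summable_mult) (simp add: ell1_def)
  have sum: "summable (\<lambda>j. a j *\<^sub>R w j)" if "a \<in> ell1" for a
    by (rule summable_comparison_test'[OF sumK[OF that], of 0]) (rule nrm)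
  have lower_fin: "\<delta> / 2 * (\<Sum>j<n. \<bar>a j\<bar>) \<le> norm (\<Sum>j<n. a j *\<^sub>R w j)" for n a
  proof -
    define S where "S = {j. 0 \<le> a j}"
    obtain f where f: "f \<in> dual_ball" "\<And>j. j < n \<Longrightarrow> j \<in> S \<Longrightarrow> s + \<delta> \<le> f (w j)" "\<And>j. j < n \<Longrightarrow> j \<notin> S \<Longrightarrow> f (w j) \<le> s"
      using indep[of n S] by blast
    obtain g where g: "g \<in> dual_ball" "\<And>j. j < n \<Longrightarrow> j \<notin> S \<Longrightarrow> s + \<delta> \<le> g (w j)" "\<And>j. j < n \<Longrightarrow> j \<in> S \<Longrightarrow> g (w j) \<le> s"
      using indep[of n "- S"] by auto
    let ?v = "\<Sum>j<n. a j *\<^sub>R w j"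
    have "\<delta> * (\<Sum>j<n. \<bar>a j\<bar>) \<le> (\<Sum>j<n. a j * (f (w j) - g (w j)))"
      unfolding sum_distrib_left
    proof (rule sum_mono)
      fix j assume "j \<in> {..<n}"
      then have j: "j < n" by simp
      show "\<delta> * \<bar>a j\<bar> \<le> a j * (f (w j) - g (w j))"
      proof (cases "j \<in> S")
        case True
        then have "0 \<le> a j" "\<delta> \<le> f (w j) - g (w j)" using f(2)[OF j True] g(3)[OF j True] by (auto simp: S_def)
        then show ?thesis using mult_left_mono[of \<delta> "f (w j) - g (w j)" "a j"] by (simp add: mult.commute)
      next
        case False
        then have "a j \<le> 0" "f (w j) - g (w j) \<le> - \<delta>" using f(3)[OF j False] g(2)[OF j False] by (auto simp: S_def)
        then show ?thesis using mult_left_mono_neg[of "f (w j) - g (w j)" "- \<delta>" "a j"] by (simp add: mult.commute)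
      qed
    qed
    also have "\<dots> = f ?v - g ?v"
      using dual_ball_linear[OF f(1)] dual_ball_linear[OF g(1)]
      by (simp add: linear_sum linear_scale sum_subtractf right_diff_distrib)
    also have "\<dots> \<le> 2 * norm ?v"
      using dual_ball_le[OF f(1), of ?v] dual_ball_le[OF g(1), of ?v] by linarith
    finally show ?thesis by simp
  qed
  show ?thesis
    unfolding ell1_embeds_into_def
  proof (intro exI[of _ T] conjI ballI allI)
    show "T (\<lambda>i. a i + b i) = T a + T b" if "a \<in> ell1" "b \<in> ell1" for a b
      using suminf_add[OF sum[OF that(1)] sum[OF that(2)]] by (simp add: T_def scaleR_left_distrib)
    show "T (\<lambda>i. r * a i) = r *\<^sub>R T a" if "a \<in> ell1" for r a
      using suminf_scaleR_right[OF sum[OF that], of r] by (simp add: T_def)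
    have "\<delta> / 2 * ell1_norm a \<le> norm (T a) \<and> norm (T a) \<le> K' * ell1_norm a" if a: "a \<in> ell1" for a
    proof
      have "(\<lambda>n. \<Sum>j<n. \<bar>a j\<bar>) \<longlonglongrightarrow> ell1_norm a"
        using a summable_LIMSEQ by (auto simp: ell1_def ell1_norm_def)
      then have 1: "(\<lambda>n. \<delta> / 2 * (\<Sum>j<n. \<bar>a j\<bar>)) \<longlonglongrightarrow> \<delta> / 2 * ell1_norm a"
        by (intro tendsto_intros)
      have 2: "(\<lambda>n. norm (\<Sum>j<n. a j *\<^sub>R w j)) \<longlonglongrightarrow> norm (T a)"
        unfolding T_def by (intro tendsto_norm summable_LIMSEQ sum a)
      show "\<delta> / 2 * ell1_norm a \<le> norm (T a)"
        by (rule LIMSEQ_le[OF 1 2]) (use lower_fin in blast)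
      have "norm (T a) \<le> (\<Sum>j. K' * \<bar>a j\<bar>)"
        unfolding T_def by (rule norm_suminf_le[OF _ sumK[OF a]]) (rule nrm)
      also have "\<dots> = K' * ell1_norm a"
        using a by (simp add: ell1_norm_def ell1_def suminf_mult)
      finally show "norm (T a) \<le> K' * ell1_norm a" .
    qed
    then show "\<exists>c>0. \<exists>C>0. \<forall>a\<in>ell1. c * ell1_norm a \<le> norm (T a) \<and> norm (T a) \<le> C * ell1_norm a"
      using \<delta> K'(1) by (intro exI[of _ "\<delta> / 2"] exI[of _ K'] conjI) auto
  qed
qed

lemma not_weakly_nullE:
  fixes z :: "nat \<Rightarrow> 'a::real_normed_vector"
  assumes "\<not> weakly_null z"
  obtains f \<epsilon> where "f \<in> dual_ball" "0 < \<epsilon>" "\<And>n. \<exists>k\<ge>n. \<epsilon> \<le> f (z k)"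
proof -
  obtain g :: "'a \<Rightarrow> real" where g: "bounded_linear g" "\<not> (\<lambda>n. g (z n)) \<longlonglongrightarrow> 0"
    using assms by (auto simp: weakly_null_def)
  obtain B where B: "0 < B" "\<And>v. norm (g v) \<le> norm v * B"
    using bounded_linear.pos_bounded[OF g(1)] by auto
  obtain \<epsilon> where \<epsilon>: "0 < \<epsilon>" "\<And>n. \<exists>k\<ge>n. \<epsilon> \<le> \<bar>g (z k)\<bar>"
    using g(2) unfolding LIMSEQ_iff by (auto simp: not_less)
  define f where "f v = g v / B" for v
  have f: "f \<in> dual_ball"
  proof -
    have "linear f"
      unfolding f_def using linear_compose_scale_right[of g "inverse B"] bounded_linear.linear[OF g(1)]
      by (simp add: divide_inverse mult.commute)
    moreover have "\<bar>f v\<bar> \<le> norm v" for v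
      using B by (simp add: f_def field_simps)
    ultimately show ?thesis by (simp add: dual_ball_def)
  qed
  show ?thesis
  proof (cases "\<forall>n. \<exists>k\<ge>n. \<epsilon> / B \<le> f (z k)")
    case True
    then show ?thesis using that[OF f, of "\<epsilon> / B"] \<epsilon>(1) B(1) by auto
  next
    case False
    then obtain n0 where n0: "\<And>k. n0 \<le> k \<Longrightarrow> f (z k) < \<epsilon> / B" by (metis not_le)
    have "\<exists>k\<ge>n. \<epsilon> / B \<le> - f (z k)" for n
    proof -
      obtain k where k: "max n n0 \<le> k" "\<epsilon> \<le> \<bar>g (z k)\<bar>" using \<epsilon>(2) by blast
      have "\<epsilon> / B \<le> \<bar>f (z k)\<bar>" using k(2) B(1) by (simp add: f_def divide_right_mono)
      then show ?thesis using n0[of k] k(1) by (intro exI[of _ k]) auto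
    qed
    then show ?thesis using that[OF dual_ball_uminus[OF f], of "\<epsilon> / B"] \<epsilon>(1) B(1) by auto
  qed
qed

text \<open>Consecutive entries of \<open>h\<close> are read as pairs, a row and a position in it.
  The gap between \<epsilon> and \<epsilon> / 2 is the one that independence needs.\<close>

definition alternates :: "real \<Rightarrow> (nat \<Rightarrow> nat \<Rightarrow> 'a::real_normed_vector) \<Rightarrow> ('a \<Rightarrow> real) \<Rightarrow> (nat \<Rightarrow> nat) \<Rightarrow> nat \<Rightarrow> bool"
  where "alternates \<epsilon> u f h k \<longleftrightarrow>
    (if even k then \<epsilon> \<le> f (u (h (2 * k)) (h (2 * k + 1))) else f (u (h (2 * k)) (h (2 * k + 1))) \<le> \<epsilon> / 2)"

text \<open>On a set where all finite stretches of all increasing sequences admit alternating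
  functionals, varying the sequence would prescribe large or small values at fixed vectors in every
  pattern, and these vectors would span l1. Galvin's theorem gives the alternative.\<close>

lemma no_alternation:
  fixes u :: "nat \<Rightarrow> nat \<Rightarrow> 'a::banach"
  assumes l1: "\<not> ell1_embeds_into TYPE('a)" and uK: "\<And>a i. norm (u a i) \<le> K"
    and N: "infinite N" and \<epsilon>: "0 < \<epsilon>"
  shows "\<exists>M\<subseteq>N. infinite M \<and>
    (\<forall>h. strict_mono h \<longrightarrow> range h \<subseteq> M \<longrightarrow> (\<forall>f\<in>dual_ball. \<exists>k. \<not> alternates \<epsilon> u f h k))"
proof -
  define P where "P m h \<longleftrightarrow> \<not> (\<exists>f\<in>dual_ball. \<forall>k. 2 * k + 1 < m \<longrightarrow> alternates \<epsilon> u f h k)" for m h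
  have P: "P m h'" if "\<And>i. i < m \<Longrightarrow> h i = h' i" "P m h" for m h h'
  proof -
    have "alternates \<epsilon> u f h k = alternates \<epsilon> u f h' k" if k: "2 * k + 1 < m" for f k
      using \<open>\<And>i. i < m \<Longrightarrow> h i = h' i\<close>[of "2 * k"] \<open>\<And>i. i < m \<Longrightarrow> h i = h' i\<close>[of "2 * k + 1"] k
      by (simp add: alternates_def)
    then show ?thesis using that(2) unfolding P_def by blast
  qed
  show ?thesis
  proof (rule Galvin_sequences[OF N, of P])
    show "\<And>m h h'. (\<And>i. i < m \<Longrightarrow> h i = h' i) \<Longrightarrow> P m h \<Longrightarrow> P m h'"
      by (rule P)
  next
    fix M assume avoids: "M \<subseteq> N" "infinite M"
      "\<And>m h. strict_mono h \<Longrightarrow> range h \<subseteq> M \<Longrightarrow> \<not> P m h"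
    define h0 where "h0 = enumerate M"
    have h0: "strict_mono h0" "range h0 \<subseteq> M"
      using avoids(2) by (auto simp: h0_def strict_mono_enumerate enumerate_in_set)
    \<comment> \<open>The pairs of the enumeration are grouped in threes and \<open>w j\<close>
      belongs to the middle pair of group \<open>j\<close>, with a spare pair on either
      side.\<close>
    define w where "w j = u (h0 (2 * (3 * j + 1))) (h0 (2 * (3 * j + 1) + 1))" for j
    have "ell1_embeds_into TYPE('a)"
    proof (rule ell1_embedsI)
      show "norm (w j) \<le> K" for j by (simp add: w_def uK)
      show "0 < \<epsilon> / 2" using \<epsilon> by simp
      fix n S
      \<comment> \<open>Group \<open>j\<close> contributes its middle and last pair if
        \<open>j \<in> S\<close>, otherwise its first and middle pair. So the middle pair gets the
        even place 2 j, with a large value, or the odd place 2 j + 1, with a small one.\<close>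
      define \<pi> where "\<pi> l = 3 * (l div 2) + l mod 2 + (if l div 2 \<in> S then 1 else 0)" for l :: nat
      define h where "h i = h0 (2 * \<pi> (i div 2) + i mod 2)" for i
      have h01: "h (2 * l) = h0 (2 * \<pi> l)" "h (2 * l + 1) = h0 (2 * \<pi> l + 1)" for l
        by (simp_all add: h_def)
      have \<pi>S: "\<pi> l < \<pi> (Suc l)" for l
      proof (cases "even l")
        case True
        then have "Suc l div 2 = l div 2" "Suc l mod 2 = Suc (l mod 2)" by presburger+
        then show ?thesis by (simp add: \<pi>_def)
      next
        case False
        then have "Suc l div 2 = Suc (l div 2)" "Suc l mod 2 = 0" "l mod 2 = 1" by presburger+
        then show ?thesis by (simp add: \<pi>_def)
      qed
      have "strict_mono h"
      proof (rule strict_monoI_Suc)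
        fix i
        have "2 * \<pi> (i div 2) + i mod 2 < 2 * \<pi> (Suc i div 2) + Suc i mod 2"
        proof (cases "even i")
          case True
          then have "Suc i div 2 = i div 2" "Suc i mod 2 = Suc (i mod 2)" by presburger+
          then show ?thesis by simp
        next
          case False
          then have "Suc i div 2 = Suc (i div 2)" "Suc i mod 2 = 0" "i mod 2 = 1" by presburger+
          then show ?thesis using \<pi>S[of "i div 2"] by simp
        qed
        then show "h i < h (Suc i)" using h0(1) by (simp add: h_def strict_mono_less)
      qed
      moreover have "range h \<subseteq> M" using h0(2) by (auto simp: h_def)
      ultimately have "\<not> P (4 * n) h" by (rule avoids(3))
      then obtain f where f: "f \<in> dual_ball" "\<And>k. 2 * k + 1 < 4 * n \<Longrightarrow> alternates \<epsilon> u f h k"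
        by (auto simp: P_def)
      have "(j \<in> S \<longrightarrow> \<epsilon> / 2 + \<epsilon> / 2 \<le> f (w j)) \<and> (j \<notin> S \<longrightarrow> f (w j) \<le> \<epsilon> / 2)" if "j < n" for j
      proof (intro conjI impI)
        assume "j \<in> S"
        then have \<pi>j: "\<pi> (2 * j) = 3 * j + 1" by (simp add: \<pi>_def)
        have "h (2 * (2 * j)) = h0 (2 * (3 * j + 1))" "h (2 * (2 * j) + 1) = h0 (2 * (3 * j + 1) + 1)"
          using h01[of "2 * j"] \<pi>j by simp_all
        then show "\<epsilon> / 2 + \<epsilon> / 2 \<le> f (w j)"
          using f(2)[of "2 * j"] that by (simp add: alternates_def w_def)
      next
        assume "j \<notin> S"
        then have \<pi>j: "\<pi> (2 * j + 1) = 3 * j + 1" by (simp add: \<pi>_def)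
        have "h (2 * (2 * j + 1)) = h0 (2 * (3 * j + 1))" "h (2 * (2 * j + 1) + 1) = h0 (2 * (3 * j + 1) + 1)"
          using h01[of "2 * j + 1"] \<pi>j by simp_all
        then show "f (w j) \<le> \<epsilon> / 2"
          using f(2)[of "2 * j + 1"] that by (simp add: alternates_def w_def)
      qed
      then show "\<exists>f\<in>dual_ball. \<forall>j<n. (j \<in> S \<longrightarrow> \<epsilon> / 2 + \<epsilon> / 2 \<le> f (w j)) \<and> (j \<notin> S \<longrightarrow> f (w j) \<le> \<epsilon> / 2)"
        using f(1) by blast
    qed
    then show ?thesis using l1 by simp
  next
    fix M assume catches: "M \<subseteq> N" "infinite M"
      "\<And>h. strict_mono h \<Longrightarrow> range h \<subseteq> M \<Longrightarrow> \<exists>m. P m h"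
    have "\<exists>k. \<not> alternates \<epsilon> u f h k" if "strict_mono h" "range h \<subseteq> M" "f \<in> dual_ball" for h f
      using catches(3)[OF that(1,2)] that(3) unfolding P_def by blast
    then show ?thesis using catches(1,2) by blast
  qed
qed

text \<open>A functional that is large infinitely often along the diagonal could be made to
  alternate by inserting pairs far out in single rows, where it is small because each row is weakly
  null. Fusion excludes alternation for a sequence of thresholds tending to 0.\<close>

theorem diagonal_weakly_null:
  fixes u :: "nat \<Rightarrow> nat \<Rightarrow> 'a::banach"
  assumes l1: "\<not> ell1_embeds_into TYPE('a)" and uK: "\<And>a i. norm (u a i) \<le> K"
    and un: "\<And>a. weakly_null (u a)"
  obtains a n where "strict_mono a" "weakly_null (\<lambda>k. u (a k) (n k))"
proof -
  define Q where "Q m M \<longleftrightarrow> (\<forall>h. strict_mono h \<longrightarrow> range h \<subseteq> M \<longrightarrow>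
      (\<forall>f\<in>dual_ball. \<exists>k. \<not> alternates (1 / (real m + 1)) u f h k))" for m M
  obtain M where M: "infinite M" "\<And>m. m \<in> insert 0 (Suc ` M) \<Longrightarrow> Q m (M \<inter> {m..})"
  proof (rule fusion[of Q UNIV])
    show "Q m M" if "Q m N" "M \<subseteq> N" for m M N
      using that unfolding Q_def by (meson order_trans)
    show "\<exists>M\<subseteq>N. infinite M \<and> Q m M" if "infinite N" for m N
      unfolding Q_def by (rule no_alternation[OF l1 uK that]) simp
  qed auto
  define h0 where "h0 = enumerate M"
  have h0: "strict_mono h0" "\<And>i. h0 i \<in> M" "\<And>i. i \<le> h0 i"
    using M(1) by (auto simp: h0_def strict_mono_enumerate enumerate_in_set le_enumerate)
  define a where "a k = h0 (2 * k)" for k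
  define n where "n k = h0 (2 * k + 1)" for k
  have "strict_mono a" using h0(1) by (simp add: a_def strict_mono_def)
  moreover have "weakly_null (\<lambda>k. u (a k) (n k))"
  proof (rule ccontr)
    assume "\<not> ?thesis"
    then obtain f \<epsilon> where f: "f \<in> dual_ball" "0 < \<epsilon>" "\<And>N. \<exists>k\<ge>N. \<epsilon> \<le> f (u (a k) (n k))"
      by (rule not_weakly_nullE) blast
    obtain i0 where "inverse (real (Suc i0)) < \<epsilon>" using reals_Archimedean[OF f(2)] by blast
    \<comment> \<open>The set \<open>M\<close> handles thresholds 1 / (m + 1) with \<open>m\<close>
      the successor of an element of \<open>M\<close>; the choice of \<open>i0\<close> brings one of
      them below \<epsilon>.\<close>
    define m where "m = Suc (h0 i0)"
    define \<epsilon>' where "\<epsilon>' = 1 / (real m + 1)"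
    have "1 / (real m + 1) \<le> inverse (real (Suc i0))"
      using h0(3)[of i0] by (simp add: m_def inverse_eq_divide frac_le)
    then have \<epsilon>': "\<epsilon>' \<le> \<epsilon>" using \<open>inverse (real (Suc i0)) < \<epsilon>\<close> by (simp add: \<epsilon>'_def)
    have \<epsilon>'0: "0 < \<epsilon>'" by (simp add: \<epsilon>'_def)
    have Q: "Q m (M \<inter> {m..})" using h0(2) by (intro M(2)) (auto simp: m_def)
    define ok where "ok l pq \<longleftrightarrow> fst pq \<in> M \<and> snd pq \<in> M \<and> m \<le> fst pq \<and> fst pq < snd pq \<and>
        (if even l then \<epsilon>' \<le> f (u (fst pq) (snd pq)) else f (u (fst pq) (snd pq)) \<le> \<epsilon>' / 2)"
      for l :: nat and pq :: "nat \<times> nat"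
    have ex: "\<exists>pq. ok l pq \<and> b < fst pq" for l b
    proof (cases "even l")
      case True
      obtain k where k: "max (Suc b) m \<le> k" "\<epsilon> \<le> f (u (a k) (n k))" using f(3) by blast
      have "2 * k \<le> a k" using h0(3)[of "2 * k"] by (simp add: a_def)
      moreover have "a k < n k" using h0(1) by (simp add: a_def n_def strict_mono_less)
      ultimately show ?thesis
        using k True \<epsilon>' h0(2) by (intro exI[of _ "(a k, n k)"]) (auto simp: ok_def a_def n_def)
    next
      case False
      define p where "p = h0 (max (Suc b) m)"
      have p: "b < p" "m \<le> p" "p \<in> M" using h0(2,3)[of "max (Suc b) m"] by (auto simp: p_def)
      have "(\<lambda>i. f (u p i)) \<longlonglongrightarrow> 0"
        using un[of p] dual_ball_bounded_linear[OF f(1)] by (simp add: weakly_null_def)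
      then obtain i1 where i1: "\<And>i. i1 \<le> i \<Longrightarrow> \<bar>f (u p i)\<bar> < \<epsilon>' / 2"
        using LIMSEQ_D[of "\<lambda>i. f (u p i)" 0 "\<epsilon>' / 2"] \<epsilon>'0 by auto
      define q where "q = h0 (max i1 (Suc p))"
      have "i1 \<le> q" "p < q" "q \<in> M" using h0(2,3)[of "max i1 (Suc p)"] by (auto simp: q_def)
      then show ?thesis
        using p i1[of q] False by (intro exI[of _ "(p, q)"]) (auto simp: ok_def)
    qed
    obtain F where F: "\<And>l. ok l (F l)" "\<And>l. snd (F l) < fst (F (Suc l))"
      using dependent_nat_choice[of ok "\<lambda>l pq pq'. snd pq < fst pq'"] ex by metis
    define h where "h i = (if even i then fst (F (i div 2)) else snd (F (i div 2)))" for i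
    have "strict_mono h"
    proof (rule strict_monoI_Suc)
      fix i
      show "h i < h (Suc i)"
      proof (cases "even i")
        case True
        then have "Suc i div 2 = i div 2" by presburger
        then show ?thesis using True F(1)[of "i div 2"] by (simp add: h_def ok_def)
      next
        case False
        then have "Suc i div 2 = Suc (i div 2)" by presburger
        then show ?thesis using False F(2)[of "i div 2"] by (simp add: h_def)
      qed
    qed
    moreover have "range h \<subseteq> M \<inter> {m..}"
    proof
      fix k assume "k \<in> range h"
      then obtain i where "k = h i" by auto
      then show "k \<in> M \<inter> {m..}" using F(1)[of "i div 2"] by (auto simp: h_def ok_def)
    qed
    ultimately obtain k where "\<not> alternates \<epsilon>' u f h k"
      using Q f(1) unfolding Q_def \<epsilon>'_def by blast
    then show False
      using F(1)[of k] by (simp add: alternates_def h_def ok_def split: if_splits)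
  qed
  ultimately show ?thesis by (rule that)
qed

subsection \<open>Signed sums along subsequences\<close>

text \<open>The bound required at a killed coordinate depends only on the number of earlier ones, and not on
  the coordinate itself: weak nullity excludes many large values only for a fixed threshold.\<close>

definition kills :: "(nat \<Rightarrow> 'a::real_normed_vector) \<Rightarrow> real \<Rightarrow> nat set \<Rightarrow> nat set \<Rightarrow> bool"
  where "kills x L F O' \<longleftrightarrow> (\<exists>f\<in>dual_ball. L < f (\<Sum>i\<in>F. x i) \<and>
    (\<forall>q\<in>O'. \<bar>f (x q)\<bar> \<le> (1 / 2) ^ card {p\<in>O'. p < q}))"

text \<open>The sum exceeds \<open>L\<close> for the first time at the end of \<open>F\<close>.
  Galvin's theorem yields just some initial segment in a family; asking for the first one makes it
  determinate.\<close>

definition critical :: "(nat \<Rightarrow> 'a::real_normed_vector) \<Rightarrow> real \<Rightarrow> nat set \<Rightarrow> bool"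
  where "critical x L F \<longleftrightarrow> L < norm (\<Sum>i\<in>F. x i) \<and>
    (\<forall>n. F \<inter> {..<n} \<noteq> F \<longrightarrow> norm (\<Sum>i\<in>F \<inter> {..<n}. x i) \<le> L)"

lemma critical_initial_segment:
  assumes "L < norm (\<Sum>i\<in>E \<inter> {..<n}. x i)"
  obtains n where "critical x L (E \<inter> {..<n})"
proof
  define m where "m = (LEAST n. L < norm (\<Sum>i\<in>E \<inter> {..<n}. x i))"
  have m: "L < norm (\<Sum>i\<in>E \<inter> {..<m}. x i)"
    unfolding m_def using assms by (rule LeastI)
  show "critical x L (E \<inter> {..<m})"
    unfolding critical_def
  proof (intro conjI allI impI)
    fix n assume ne: "E \<inter> {..<m} \<inter> {..<n} \<noteq> E \<inter> {..<m}"
    then have "n < m" by (rule contrapos_np) auto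
    then have "\<not> L < norm (\<Sum>i\<in>E \<inter> {..<n}. x i)" unfolding m_def by (rule not_less_Least)
    moreover have "E \<inter> {..<m} \<inter> {..<n} = E \<inter> {..<n}" using \<open>n < m\<close> by auto
    ultimately show "norm (\<Sum>i\<in>E \<inter> {..<m} \<inter> {..<n}. x i) \<le> L" by simp
  qed (rule m)
qed

lemma critical_unique:
  assumes "critical x L (E \<inter> {..<a})" "critical x L (E \<inter> {..<b})"
  shows "E \<inter> {..<a} = E \<inter> {..<b}"
proof -
  have *: "E \<inter> {..<a} = E \<inter> {..<b}"
    if ab: "critical x L (E \<inter> {..<a})" "critical x L (E \<inter> {..<b})" "a \<le> b" for a b
  proof (rule ccontr)
    have eq: "E \<inter> {..<b} \<inter> {..<a} = E \<inter> {..<a}" using ab(3) by auto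
    assume "E \<inter> {..<a} \<noteq> E \<inter> {..<b}"
    then have "norm (\<Sum>i\<in>E \<inter> {..<a}. x i) \<le> L"
      using ab(2) unfolding critical_def by (metis eq)
    then show False using ab(1) unfolding critical_def by linarith
  qed
  show ?thesis
  proof (cases "a \<le> b")
    case False
    then have "b \<le> a" by simp
    then show ?thesis using *[OF assms(2,1)] by blast
  qed (rule *[OF assms])
qed

text \<open>In increasing order the terms are 1, 1/2, 1/4 and so on, so all killed coordinates
  together contribute less than 2, whatever the set.\<close>

lemma sum_halves_le:
  assumes "finite (O' :: nat set)"
  shows "(\<Sum>q\<in>O'. (1 / 2 :: real) ^ card {p\<in>O'. p < q}) \<le> 2 - 2 * (1 / 2) ^ card O'"
  using assms
proof (induction rule: finite_linorder_max_induct)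
  case empty
  then show ?case by simp
next
  case (insert b A)
  have "b \<notin> A" using insert.hyps by blast
  have "{p\<in>insert b A. p < b} = A" using insert.hyps by auto
  moreover have "{p\<in>insert b A. p < q} = {p\<in>A. p < q}" if "q \<in> A" for q
    using insert.hyps that by auto
  ultimately show ?case
    using insert.IH insert.hyps \<open>b \<notin> A\<close> by simp
qed

text \<open>If killing were impossible, Galvin's theorem would provide a set on which a single functional
  is large at arbitrarily many terms, contradicting weak nullity.\<close>

lemma killing_dense:
  fixes x :: "nat \<Rightarrow> 'a::real_normed_vector"
  assumes x: "weakly_null x"
    and ex: "\<And>K. infinite K \<Longrightarrow> K \<subseteq> M1 \<Longrightarrow> \<exists>n. L < norm (\<Sum>i\<in>K \<inter> {..<n}. x i)"
    and s: "finite s" "s \<subseteq> M1" "A \<subseteq> s" and N: "infinite N" "N \<subseteq> M1"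
  shows "\<exists>M\<subseteq>N. infinite M \<and> (\<forall>q\<in>M. \<forall>H\<subseteq>M. finite H \<longrightarrow> (\<forall>i\<in>s. i < q) \<longrightarrow> (\<forall>k\<in>H. q < k) \<longrightarrow>
    critical x L (A \<union> H) \<longrightarrow> kills x L (A \<union> H) (s - A) \<longrightarrow> kills x L (A \<union> H) (insert q (s - A)))"
proof -
  define good where "good q H \<longleftrightarrow>
    (kills x L (A \<union> H) (s - A) \<longrightarrow> kills x L (A \<union> H) (insert q (s - A)))" for q H
  \<comment> \<open>New coordinates \<open>q\<close> with continuations \<open>H\<close> for which
    killing \<open>q\<close> succeeds; since \<open>H\<close> lies above \<open>q\<close>, the set
    determines the pair.\<close>
  define \<G> where "\<G> = {insert q H | q H. finite H \<and> (\<forall>k\<in>H. q < k) \<and> critical x L (A \<union> H) \<and> good q H}"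
  define T where "T = {k\<in>N. \<forall>i\<in>s. i < k}"
  have T: "infinite T" "T \<subseteq> N" "\<And>i k. i \<in> s \<Longrightarrow> k \<in> T \<Longrightarrow> i < k"
    using infinite_tail[OF N(1) s(1)] by (auto simp: T_def)
  have "\<exists>M\<subseteq>T. infinite M \<and> (\<forall>q\<in>M. \<forall>H\<subseteq>M. finite H \<longrightarrow> (\<forall>k\<in>H. q < k) \<longrightarrow>
      critical x L (A \<union> H) \<longrightarrow> good q H)"
  proof (cases rule: Galvin[OF T(1), of \<G>])
    case (1 M)
    have "\<not> critical x L (A \<union> H0)" if H0: "H0 \<subseteq> M" for H0
    proof
      assume crit0: "critical x L (A \<union> H0)"
      define h where "h = enumerate M"
      have h: "strict_mono h" "\<And>i. h i \<in> M" "\<And>i. i \<le> h i"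
        using 1(2) by (auto simp: h_def strict_mono_enumerate enumerate_in_set le_enumerate)
      have "weakly_null (\<lambda>i. x (h i))"
        by (rule weakly_null_compose[OF x filterlim_subseq[OF h(1)]])
      \<comment> \<open>The threshold is the one for the next killed coordinate, the earlier ones
        being those in \<open>s - A\<close>. The continuation below starts above \<open>h J\<close>,
        so that each earlier \<open>h j\<close> can be that coordinate.\<close>
      then obtain J where J: "\<And>f. f \<in> dual_ball \<Longrightarrow> \<exists>j<J. \<bar>f (x (h j))\<bar> < (1 / 2) ^ card (s - A)"
        by (rule weakly_null_dual_ball_bound[of _ "(1 / 2) ^ card (s - A)"]) auto
      define E where "E = A \<union> (M \<inter> {h J<..})"
      have "infinite (M \<inter> {h J<..})"
        using infinite_tail[OF 1(2), of "{h J}"] by (simp add: Int_def)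
      then have "infinite E" "E \<subseteq> M1" using s N T(2) 1(1) by (auto simp: E_def)
      then obtain n0 where "L < norm (\<Sum>i\<in>E \<inter> {..<n0}. x i)" using ex by blast
      then obtain n where n: "critical x L (E \<inter> {..<n})" by (rule critical_initial_segment)
      \<comment> \<open>A critical segment ending inside \<open>A\<close> would be a proper initial
        segment of \<open>A \<union> H0\<close> above the bound, against
        \<open>crit0\<close>.\<close>
      have An: "A \<subseteq> {..<n}"
      proof (rule ccontr)
        assume "\<not> A \<subseteq> {..<n}"
        then obtain a where a: "a \<in> A" "n \<le> a" by (metis lessThan_iff not_less subsetI)
        have "B \<inter> {..<n} = {}" if "B \<subseteq> M" for B
        proof -
          have "n \<le> k" if "k \<in> B" for k
            using T(3)[of a k] 1(1) \<open>B \<subseteq> M\<close> that a s(3) by (meson less_imp_le order_trans subsetD)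
          then show ?thesis by (meson disjoint_iff lessThan_iff not_le)
        qed
        then have "(M \<inter> {h J<..}) \<inter> {..<n} = {}" "H0 \<inter> {..<n} = {}" using H0 by blast+
        then have E0: "E \<inter> {..<n} = A \<inter> {..<n}" "(A \<union> H0) \<inter> {..<n} = A \<inter> {..<n}"
          by (auto simp: E_def)
        have "a \<in> A \<union> H0" "a \<notin> (A \<union> H0) \<inter> {..<n}" using a by auto
        then have "(A \<union> H0) \<inter> {..<n} \<noteq> A \<union> H0" by blast
        then have "norm (\<Sum>i\<in>(A \<union> H0) \<inter> {..<n}. x i) \<le> L"
          using crit0 unfolding critical_def by blast
        then show False using n unfolding critical_def E0 by simp
      qed
      define H where "H = M \<inter> {h J<..} \<inter> {..<n}"
      have AH: "E \<inter> {..<n} = A \<union> H" using An by (auto simp: E_def H_def)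
      have bad: "\<not> good (h j) H" if "j \<le> J" for j
      proof
        assume "good (h j) H"
        moreover have "h j \<le> h J" using h(1) that by (simp add: strict_mono_less_eq)
        then have "\<forall>k\<in>H. h j < k" by (auto simp: H_def)
        moreover have "finite H" "critical x L (A \<union> H)" using n AH by (simp_all add: H_def)
        ultimately have "insert (h j) H \<in> \<G>"
          unfolding \<G>_def by blast
        moreover have "insert (h j) H \<subseteq> M" "finite (insert (h j) H)" using h(2) by (auto simp: H_def)
        ultimately show False using 1(3) by blast
      qed
      then have "kills x L (A \<union> H) (s - A)" unfolding good_def by blast
      then obtain f where f: "f \<in> dual_ball" "L < f (\<Sum>i\<in>A \<union> H. x i)"
        "\<And>q. q \<in> s - A \<Longrightarrow> \<bar>f (x q)\<bar> \<le> (1 / 2) ^ card {p\<in>s - A. p < q}"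
        unfolding kills_def by blast
      obtain j where j: "j < J" "\<bar>f (x (h j))\<bar> < (1 / 2) ^ card (s - A)" using J[OF f(1)] by blast
      have "h j \<in> T" using h(2) 1(1) by blast
      then have less: "p < h j" if "p \<in> s" for p using T(3) that by blast
      have "kills x L (A \<union> H) (insert (h j) (s - A))"
        unfolding kills_def
      proof (intro bexI[OF _ f(1)] conjI ballI)
        fix q assume q: "q \<in> insert (h j) (s - A)"
        have "{p \<in> insert (h j) (s - A). p < h j} = s - A" using less by auto
        moreover have "{p \<in> insert (h j) (s - A). p < q} = {p\<in>s - A. p < q}" if "q \<in> s - A"
          using less[of q] that by auto
        ultimately show "\<bar>f (x q)\<bar> \<le> (1 / 2) ^ card {p \<in> insert (h j) (s - A). p < q}"
          using q f(3)[of q] j(2) by (cases "q = h j") (auto simp: less_imp_le)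
      qed (rule f(2))
      then show False using bad[of j] j(1) unfolding good_def by simp
    qed
    then show ?thesis using 1(1,2) by blast
  next
    case (2 M)
    have "good q H" if q: "q \<in> M" and H: "H \<subseteq> M" "finite H" "\<forall>k\<in>H. q < k" "critical x L (A \<union> H)" for q H
    proof -
      define R where "R = {k\<in>M. \<forall>i\<in>insert q H. i < k}"
      \<comment> \<open>An infinite set beginning with \<open>q\<close> and \<open>H\<close>.
        Galvin's theorem gives an initial segment of it, which uniqueness of critical segments
        identifies with the one for \<open>H\<close>.\<close>
      define K where "K = insert q (H \<union> R)"
      have "infinite R" unfolding R_def using infinite_tail[OF 2(2), of "insert q H"] H(2) by simp
      then have "infinite K" "K \<subseteq> M" using q H(1) by (auto simp: K_def R_def)
      then obtain n where "K \<inter> {..<n} \<in> \<G>" using 2(3) by blast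
      then obtain q' H' where G: "K \<inter> {..<n} = insert q' H'" "finite H'" "\<And>k. k \<in> H' \<Longrightarrow> q' < k"
        "critical x L (A \<union> H')" "good q' H'"
        unfolding \<G>_def by auto
      have qK: "q \<le> k" if "k \<in> K" for k using that H(3) by (auto simp: K_def R_def less_imp_le)
      have q'K: "q' \<in> K" "q' < n" using G(1) by auto
      have "q \<in> insert q' H'" using qK[OF q'K(1)] q'K(2) G(1) by (auto simp: K_def)
      then have qq: "q' = q" using G(3) qK[OF q'K(1)] by fastforce
      have AT: "a < k" if "a \<in> A" "k \<in> M" for a k using T(3) that s(3) 2(1) by blast
      have qn: "q < n" using q'K qq by simp
      define E where "E = A \<union> H \<union> R"
      have "H' = (H \<union> R) \<inter> {..<n}"
      proof -
        have "H' = insert q' H' - {q'}" using G(3) by fastforce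
        also have "\<dots> = K \<inter> {..<n} - {q}" using G(1) qq by simp
        also have "\<dots> = (H \<union> R) \<inter> {..<n}" using H(3) by (auto simp: K_def R_def)
        finally show ?thesis .
      qed
      moreover have "A \<subseteq> {..<n}" using AT[OF _ q] qn by fastforce
      ultimately have 1: "A \<union> H' = E \<inter> {..<n}" by (auto simp: E_def)
      define b where "b = Suc (Max (insert q H))"
      have "A \<union> H = E \<inter> {..<b}"
      proof (intro equalityI subsetI)
        fix k assume k: "k \<in> A \<union> H"
        have "q \<le> Max (insert q H)" using H(2) by (intro Max_ge) auto
        moreover have "k \<le> Max (insert q H)" if "k \<in> H" using H(2) that by (intro Max_ge) auto
        ultimately show "k \<in> E \<inter> {..<b}" using k AT[OF _ q, of k] by (auto simp: E_def b_def less_Suc_eq_le)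
      next
        fix k assume k: "k \<in> E \<inter> {..<b}"
        have "Max (insert q H) \<in> insert q H" using H(2) by (intro Max_in) auto
        moreover have "\<not> Max (insert q H) < k" using k by (simp add: b_def)
        ultimately have "k \<notin> R" unfolding R_def by blast
        then show "k \<in> A \<union> H" using k by (auto simp: E_def)
      qed
      then have eq: "A \<union> H = A \<union> H'" using critical_unique[of x L E b n] H(4) G(4) 1 by simp
      show ?thesis using G(5) unfolding good_def eq qq by simp
    qed
    then show ?thesis using 2(1,2) by blast
  qed
  then show ?thesis using T(2) unfolding good_def by (meson subset_trans)
qed

text \<open>Let \<open>E\<close> carry a sign that occurs infinitely often and \<open>O'\<close> the
  opposite sign. Sums over initial segments of \<open>E\<close> eventually exceed L + 2, and killing
  provides a functional that witnesses this while its absolute values on \<open>O'\<close> sum to at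
  most 2. On the signed sum it still exceeds \<open>L\<close> in absolute value.\<close>

theorem Elton_sign_sums:
  fixes x :: "nat \<Rightarrow> 'a::real_normed_vector"
  assumes x: "weakly_null x"
    and big: "\<And>M L. infinite M \<Longrightarrow> \<exists>F\<subseteq>M. finite F \<and> L < norm (\<Sum>i\<in>F. x i)"
  obtains M where "infinite M"
    "\<And>(k :: nat \<Rightarrow> nat) \<sigma>. strict_mono k \<Longrightarrow> range k \<subseteq> M \<Longrightarrow> (\<And>i. \<sigma> i = 1 \<or> \<sigma> i = - 1) \<Longrightarrow>
      \<exists>n. L < norm (\<Sum>i<n. \<sigma> i *\<^sub>R x (k i))"
proof -
  define L' where "L' = L + 2"
  obtain M1 where M1: "infinite M1"
    and ex: "\<And>K. infinite K \<Longrightarrow> K \<subseteq> M1 \<Longrightarrow> \<exists>n. L' < norm (\<Sum>i\<in>K \<inter> {..<n}. x i)"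
  proof (cases rule: Galvin[OF infinite_UNIV_nat, of "{F. L' < norm (\<Sum>i\<in>F. x i)}"])
    case (1 M)
    then show ?thesis using big[of M L'] by blast
  next
    case (2 M)
    then show ?thesis using that[of M] by auto
  qed
  define R where "R s A M \<longleftrightarrow> (\<forall>q\<in>M. \<forall>H\<subseteq>M. finite H \<longrightarrow> (\<forall>i\<in>s. i < q) \<longrightarrow> (\<forall>k\<in>H. q < k) \<longrightarrow>
    critical x L' (A \<union> H) \<longrightarrow> kills x L' (A \<union> H) (s - A) \<longrightarrow> kills x L' (A \<union> H) (insert q (s - A)))"
    for s A M
  have R_mono: "R s A M'" if "R s A M" "M' \<subseteq> M" for s A M M'
  proof -
    have *: "\<forall>q\<in>M'. \<forall>H\<subseteq>M'. Z q H" if "\<forall>q\<in>M. \<forall>H\<subseteq>M. Z q H" for Z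
      using that \<open>M' \<subseteq> M\<close> by blast
    show ?thesis using that(1) unfolding R_def by (rule *)
  qed
  \<comment> \<open>Relativized to \<open>M1\<close> and vacuous otherwise, because fusion asks for
    density below every infinite set.\<close>
  define Q where "Q s A M \<longleftrightarrow> (infinite (M \<inter> M1) \<and> s \<subseteq> M1 \<longrightarrow> R s A (M \<inter> M1))" for s A M
  have Q_mono: "Q s A M" if Q: "Q s A N" and sub: "M \<subseteq> N" for s A N M
    unfolding Q_def
  proof (intro impI, elim conjE)
    assume A: "infinite (M \<inter> M1)" "s \<subseteq> M1"
    have MN: "M \<inter> M1 \<subseteq> N \<inter> M1" using sub by auto
    then have "infinite (N \<inter> M1)" using A(1) infinite_super by blast
    then show "R s A (M \<inter> M1)" using Q A(2) R_mono[OF _ MN] unfolding Q_def by blast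
  qed
  have Q_dense: "\<exists>M\<subseteq>N. infinite M \<and> Q s A M" if sA: "finite s" "A \<subseteq> s" "infinite N" for s A N
  proof (cases "infinite (N \<inter> M1) \<and> s \<subseteq> M1")
    case True
    then obtain M where M: "M \<subseteq> N \<inter> M1" "infinite M" "R s A M"
      using killing_dense[of x M1 L' s A "N \<inter> M1", OF x ex sA(1) _ sA(2)] unfolding R_def by auto
    then have "M \<inter> M1 = M" by auto
    then show ?thesis using M by (auto simp: Q_def)
  qed (use sA(3) in \<open>auto simp: Q_def\<close>)
  obtain M where M: "M \<subseteq> M1" "infinite M"
    and QM: "\<And>s. finite s \<Longrightarrow> s \<subseteq> M \<Longrightarrow> \<forall>A\<in>Pow s. Q s A {k\<in>M. \<forall>i\<in>s. i < k}"
  proof (rule fusion_finite_subsets[of "\<lambda>s M. \<forall>A\<in>Pow s. Q s A M", OF _ _ M1])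
    show "\<forall>A\<in>Pow s. Q s A M" if "\<forall>A\<in>Pow s. Q s A N" "M \<subseteq> N" for s N M
      using that Q_mono by blast
    show "\<exists>M\<subseteq>N. infinite M \<and> (\<forall>A\<in>Pow s. Q s A M)" if "finite s" "infinite N" for s N
      by (rule finite_dense_conj[OF _ _ _ that(2)]) (use that Q_mono Q_dense in auto)
  qed blast
  have RM: "R s A {k\<in>M. \<forall>i\<in>s. i < k}" if "finite s" "s \<subseteq> M" "A \<subseteq> s" for s A
  proof -
    have "{k\<in>M. \<forall>i\<in>s. i < k} \<inter> M1 = {k\<in>M. \<forall>i\<in>s. i < k}" using M(1) by auto
    then show ?thesis
      using QM[OF that(1,2)] that M infinite_tail[OF M(2) that(1)] unfolding Q_def by auto
  qed
  \<comment> \<open>The critical segment of \<open>E\<close> stays fixed while the elements of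
    \<open>O'\<close> are killed one at a time; \<open>E\<close> contributes \<open>A\<close> before
    the current element and \<open>H\<close> after it.\<close>
  have killing: "kills x L' (E \<inter> {..<n}) (O' \<inter> {..<b})"
    if E: "E \<subseteq> M" "O' \<subseteq> M" "E \<inter> O' = {}" and n: "critical x L' (E \<inter> {..<n})" and "b \<le> n" for E O' n b
    using \<open>b \<le> n\<close>
  proof (induction b)
    case 0
    obtain f where "f \<in> dual_ball" "f (\<Sum>i\<in>E \<inter> {..<n}. x i) = norm (\<Sum>i\<in>E \<inter> {..<n}. x i)"
      by (rule Hahn_Banach_norming)
    then show ?case using n unfolding kills_def critical_def by (intro bexI[of _ f]) auto
  next
    case (Suc b)
    show ?case
    proof (cases "b \<in> O'")
      case False
      then have "O' \<inter> {..<Suc b} = O' \<inter> {..<b}" by (auto simp: less_Suc_eq)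
      then show ?thesis using Suc by simp
    next
      case True
      define s where "s = (E \<union> O') \<inter> {..<b}"
      define A where "A = E \<inter> {..<b}"
      define H where "H = E \<inter> {b<..<n}"
      have "b \<notin> E" using True E(3) by auto
      then have AH: "A \<union> H = E \<inter> {..<n}"
        using Suc.prems by (auto simp: A_def H_def not_less intro: le_neq_trans)
      have sA: "s - A = O' \<inter> {..<b}" using E(3) by (auto simp: s_def A_def)
      have "R s A {k\<in>M. \<forall>i\<in>s. i < k}"
        by (rule RM) (use E in \<open>auto simp: s_def A_def\<close>)
      moreover have "b \<in> {k\<in>M. \<forall>i\<in>s. i < k}" "H \<subseteq> {k\<in>M. \<forall>i\<in>s. i < k}" "finite H"
        "\<forall>i\<in>s. i < b" "\<forall>k\<in>H. b < k"
        using True E by (auto simp: s_def H_def)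
      moreover have "critical x L' (A \<union> H)" "kills x L' (A \<union> H) (s - A)"
        unfolding AH sA using n Suc by auto
      ultimately have "kills x L' (A \<union> H) (insert b (s - A))" unfolding R_def by blast
      moreover have "insert b (s - A) = O' \<inter> {..<Suc b}" unfolding sA using True by auto
      ultimately show ?thesis by (simp add: AH)
    qed
  qed
  show ?thesis
  proof (rule that[OF M(2)])
    fix k :: "nat \<Rightarrow> nat" and \<sigma> :: "nat \<Rightarrow> real"
    assume k: "strict_mono k" "range k \<subseteq> M" and \<sigma>: "\<And>i. \<sigma> i = 1 \<or> \<sigma> i = - 1"
    have "infinite {i. \<sigma> i = 1} \<or> infinite {i. \<sigma> i = - 1}"
    proof -
      have "{i. \<sigma> i = 1} \<union> {i. \<sigma> i = - 1} = UNIV" using \<sigma> by auto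
      then show ?thesis by (metis finite_Un infinite_UNIV_nat)
    qed
    then obtain c where c: "c = 1 \<or> c = - 1" "infinite {i. \<sigma> i = c}" by blast
    define E where "E = k ` {i. \<sigma> i = c}"
    define O' where "O' = k ` {i. \<sigma> i \<noteq> c}"
    have kinj: "inj k" using k(1) by (rule strict_mono_imp_inj_on)
    have "infinite E" unfolding E_def using c(2) kinj by (simp add: finite_image_iff inj_on_subset)
    moreover have EM: "E \<subseteq> M" "O' \<subseteq> M" using k(2) by (auto simp: E_def O'_def)
    moreover have EO: "E \<inter> O' = {}" using kinj by (auto simp: E_def O'_def inj_def)
    ultimately obtain n0 where "L' < norm (\<Sum>i\<in>E \<inter> {..<n0}. x i)" using ex M(1) by blast
    then obtain n where n: "critical x L' (E \<inter> {..<n})" by (rule critical_initial_segment)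
    obtain f where f: "f \<in> dual_ball" "L' < f (\<Sum>i\<in>E \<inter> {..<n}. x i)"
      "\<And>q. q \<in> O' \<inter> {..<n} \<Longrightarrow> \<bar>f (x q)\<bar> \<le> (1 / 2) ^ card {p\<in>O' \<inter> {..<n}. p < q}"
      using killing[OF EM EO n order_refl] unfolding kills_def by blast
    have lin: "linear f" using f(1) by (rule dual_ball_linear)
    obtain m where m: "range k \<inter> {..<n} = k ` {..<m}" using range_Int_lessThan[OF k(1)] .
    have Em: "E \<inter> {..<n} = k ` {i\<in>{..<m}. \<sigma> i = c}" and Om: "O' \<inter> {..<n} = k ` {i\<in>{..<m}. \<sigma> i \<noteq> c}"
    proof -
      have "k i < n \<longleftrightarrow> i < m" for i
        using m kinj by (metis (no_types, lifting) IntD2 IntI inj_image_mem_iff lessThan_iff rangeI)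
      then show "E \<inter> {..<n} = k ` {i\<in>{..<m}. \<sigma> i = c}" "O' \<inter> {..<n} = k ` {i\<in>{..<m}. \<sigma> i \<noteq> c}"
        by (auto simp: E_def O'_def)
    qed
    have inj: "inj_on k B" for B using kinj by (rule inj_on_subset) simp
    let ?v = "\<Sum>i<m. \<sigma> i *\<^sub>R x (k i)"
    have "c * f ?v = (\<Sum>i<m. c * \<sigma> i * f (x (k i)))"
      using lin by (simp add: linear_sum linear_scale sum_distrib_left mult.assoc)
    also have "\<dots> = (\<Sum>i\<in>{i\<in>{..<m}. \<sigma> i = c}. c * \<sigma> i * f (x (k i))) + (\<Sum>i\<in>{i\<in>{..<m}. \<sigma> i \<noteq> c}. c * \<sigma> i * f (x (k i)))"
      by (subst sum.union_disjoint[symmetric]) (auto intro!: sum.cong)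
    also have "(\<Sum>i\<in>{i\<in>{..<m}. \<sigma> i = c}. c * \<sigma> i * f (x (k i))) = (\<Sum>i\<in>{i\<in>{..<m}. \<sigma> i = c}. f (x (k i)))"
      using c(1) by (intro sum.cong) auto
    also have "\<dots> = f (\<Sum>i\<in>E \<inter> {..<n}. x i)"
      unfolding Em using lin by (simp add: sum.reindex[OF inj] linear_sum)
    finally have eq: "c * f ?v = f (\<Sum>i\<in>E \<inter> {..<n}. x i) + (\<Sum>i\<in>{i\<in>{..<m}. \<sigma> i \<noteq> c}. c * \<sigma> i * f (x (k i)))" .
    have "(\<Sum>i\<in>{i\<in>{..<m}. \<sigma> i \<noteq> c}. c * \<sigma> i * f (x (k i))) \<ge> - (\<Sum>i\<in>{i\<in>{..<m}. \<sigma> i \<noteq> c}. \<bar>f (x (k i))\<bar>)"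
      unfolding sum_negf[symmetric]
    proof (rule sum_mono)
      fix i
      have "\<bar>c * \<sigma> i\<bar> = 1" using c(1) \<sigma>[of i] by auto
      then have "\<bar>c * \<sigma> i * f (x (k i))\<bar> = \<bar>f (x (k i))\<bar>" by (simp add: abs_mult)
      then show "- \<bar>f (x (k i))\<bar> \<le> c * \<sigma> i * f (x (k i))" by linarith
    qed
    with eq have 1: "f (\<Sum>i\<in>E \<inter> {..<n}. x i) - (\<Sum>i\<in>{i\<in>{..<m}. \<sigma> i \<noteq> c}. \<bar>f (x (k i))\<bar>) \<le> c * f ?v"
      by simp
    have "(\<Sum>i\<in>{i\<in>{..<m}. \<sigma> i \<noteq> c}. \<bar>f (x (k i))\<bar>) = (\<Sum>q\<in>O' \<inter> {..<n}. \<bar>f (x q)\<bar>)"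
      unfolding Om by (simp add: sum.reindex[OF inj])
    also have "\<dots> \<le> (\<Sum>q\<in>O' \<inter> {..<n}. (1 / 2) ^ card {p\<in>O' \<inter> {..<n}. p < q})"
      by (intro sum_mono f(3))
    also have "\<dots> \<le> 2 - 2 * (1 / 2) ^ card (O' \<inter> {..<n})"
      by (intro sum_halves_le) simp
    also have "\<dots> \<le> 2" by simp
    finally have "L < c * f ?v" using 1 f(2) by (simp add: L'_def)
    also have "\<dots> \<le> \<bar>f ?v\<bar>" using c(1) by auto
    also have "\<dots> \<le> norm ?v" by (rule dual_ball_le[OF f(1)])
    finally show "\<exists>n. L < norm (\<Sum>i<n. \<sigma> i *\<^sub>R x (k i))" by blast
  qed
qed

subsection \<open>Equivalence with the unit vector basis\<close>

lemma successive_blocks_self: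
  assumes "strict_mono r"
  shows "successive_blocks x (x \<circ> r)"
  unfolding successive_blocks_def
proof (intro exI[of _ r] conjI allI)
  show "(x \<circ> r) i \<in> span (x ` {r i..<r (Suc i)})" for i
    using assms by (intro span_base) (auto simp: strict_mono_less)
qed (rule assms)

lemma apply_sum_c0_unit:
  "apply_bcontfun (\<Sum>i<n. a i *\<^sub>R c0_unit i) j = (if j < n then a j else 0)"
proof -
  have "apply_bcontfun (\<Sum>i<n. a i *\<^sub>R c0_unit i) j = (\<Sum>i<n. if j = i then a i else 0)"
    unfolding apply_bcontfun_sum by (intro sum.cong) (auto simp: apply_c0_unit)
  then show ?thesis by simp
qed

text \<open>Splitting by the sign of the values, bounded sums over finite sets make the absolute
  values of any functional in the dual ball sum to at most 2 L. The summand 1 in the upper constant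
  keeps it positive; the lower estimate is the coefficient bound of the basis.\<close>

lemma equivalent_c0_unitI:
  fixes x :: "nat \<Rightarrow> 'a::real_normed_vector"
  assumes C: "\<And>a m n. m \<le> n \<Longrightarrow> norm (\<Sum>i<m. a i *\<^sub>R x i) \<le> C * norm (\<Sum>i<n. a i *\<^sub>R x i)"
    and "1 \<le> C" and x1: "\<And>i. norm (x i) = 1"
    and r: "strict_mono r" and L: "\<And>F. finite F \<Longrightarrow> F \<subseteq> range r \<Longrightarrow> norm (\<Sum>i\<in>F. x i) \<le> L"
  shows "equivalent_sequences (x \<circ> r) c0_unit"
proof -
  have L0: "0 \<le> L" using L[of "{}"] by simp
  have C': "norm (\<Sum>i<m. a i *\<^sub>R (x \<circ> r) i) \<le> C * norm (\<Sum>i<n. a i *\<^sub>R (x \<circ> r) i)" if "m \<le> n" for a m n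
    by (rule successive_blocks_basis_inequality[OF C successive_blocks_self[OF r] that])
  have lower: "norm (\<Sum>i<n. a i *\<^sub>R c0_unit i) \<le> 2 * C * norm (\<Sum>i<n. a i *\<^sub>R (x \<circ> r) i)" for n a
  proof (rule norm_bound)
    fix j
    show "norm (apply_bcontfun (\<Sum>i<n. a i *\<^sub>R c0_unit i) j) \<le> 2 * C * norm (\<Sum>i<n. a i *\<^sub>R (x \<circ> r) i)"
      using basis_inequality_coeff[of "x \<circ> r" C j n a, OF C'] \<open>1 \<le> C\<close>
      by (cases "j < n") (simp_all add: apply_sum_c0_unit x1)
  qed
  have upper: "norm (\<Sum>i<n. a i *\<^sub>R (x \<circ> r) i) \<le> (2 * L + 1) * norm (\<Sum>i<n. a i *\<^sub>R c0_unit i)" for n a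
  proof (rule norm_le_if_dual_ball)
    fix f :: "'a \<Rightarrow> real" assume f: "f \<in> dual_ball"
    let ?s = "norm (\<Sum>i<n. a i *\<^sub>R c0_unit i)"
    have lin: "linear f" using f by (rule dual_ball_linear)
    have inj: "inj_on r B" for B using r by (meson inj_on_subset strict_mono_imp_inj_on subset_UNIV)
    have part: "\<bar>\<Sum>i\<in>B. f (x (r i))\<bar> \<le> L" if "finite B" for B
    proof -
      have "(\<Sum>i\<in>B. f (x (r i))) = f (\<Sum>i\<in>r ` B. x i)"
        using lin by (simp add: sum.reindex[OF inj] linear_sum)
      then show ?thesis
        using dual_ball_le[OF f, of "\<Sum>i\<in>r ` B. x i"] L[of "r ` B"] that by force
    qed
    have "(\<Sum>i<n. \<bar>f (x (r i))\<bar>) = (\<Sum>i\<in>{i\<in>{..<n}. 0 \<le> f (x (r i))}. \<bar>f (x (r i))\<bar>)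
        + (\<Sum>i\<in>{i\<in>{..<n}. \<not> 0 \<le> f (x (r i))}. \<bar>f (x (r i))\<bar>)"
      by (subst sum.union_disjoint[symmetric]) (auto intro!: sum.cong)
    also have "(\<Sum>i\<in>{i\<in>{..<n}. 0 \<le> f (x (r i))}. \<bar>f (x (r i))\<bar>) = (\<Sum>i\<in>{i\<in>{..<n}. 0 \<le> f (x (r i))}. f (x (r i)))"
      by (intro sum.cong) auto
    also have "(\<Sum>i\<in>{i\<in>{..<n}. \<not> 0 \<le> f (x (r i))}. \<bar>f (x (r i))\<bar>) = - (\<Sum>i\<in>{i\<in>{..<n}. \<not> 0 \<le> f (x (r i))}. f (x (r i)))"
      unfolding sum_negf[symmetric] by (intro sum.cong) auto
    also have "(\<Sum>i\<in>{i\<in>{..<n}. 0 \<le> f (x (r i))}. f (x (r i)))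
        + - (\<Sum>i\<in>{i\<in>{..<n}. \<not> 0 \<le> f (x (r i))}. f (x (r i))) \<le> 2 * L"
      using part[of "{i\<in>{..<n}. 0 \<le> f (x (r i))}"] part[of "{i\<in>{..<n}. \<not> 0 \<le> f (x (r i))}"] by simp
    finally have sumL: "(\<Sum>i<n. \<bar>f (x (r i))\<bar>) \<le> 2 * L" .
    have as: "\<bar>a i\<bar> \<le> ?s" if "i < n" for i
      using norm_bounded[of "\<Sum>i<n. a i *\<^sub>R c0_unit i" i] that by (simp add: apply_sum_c0_unit)
    have "f (\<Sum>i<n. a i *\<^sub>R (x \<circ> r) i) = (\<Sum>i<n. a i * f (x (r i)))"
      using lin by (simp add: linear_sum linear_scale)
    also have "\<dots> \<le> (\<Sum>i<n. ?s * \<bar>f (x (r i))\<bar>)"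
    proof (rule sum_mono)
      fix i assume "i \<in> {..<n}"
      then have "\<bar>a i\<bar> * \<bar>f (x (r i))\<bar> \<le> ?s * \<bar>f (x (r i))\<bar>" using as by (intro mult_right_mono) auto
      moreover have "a i * f (x (r i)) \<le> \<bar>a i\<bar> * \<bar>f (x (r i))\<bar>"
        using abs_ge_self[of "a i * f (x (r i))"] by (simp add: abs_mult)
      ultimately show "a i * f (x (r i)) \<le> ?s * \<bar>f (x (r i))\<bar>" by linarith
    qed
    also have "\<dots> \<le> ?s * (2 * L)"
      unfolding sum_distrib_left[symmetric] using sumL by (intro mult_left_mono) auto
    also have "\<dots> \<le> (2 * L + 1) * ?s" by (simp add: algebra_simps)
    finally show "f (\<Sum>i<n. a i *\<^sub>R (x \<circ> r) i) \<le> (2 * L + 1) * ?s" .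
  qed
  have "1 / (2 * C) * norm (\<Sum>i<n. a i *\<^sub>R c0_unit i) \<le> norm (\<Sum>i<n. a i *\<^sub>R (x \<circ> r) i)" for n a
    using lower[of a n] \<open>1 \<le> C\<close> by (simp add: field_simps)
  moreover have "0 < 1 / (2 * C)" "0 < 2 * L + 1" using \<open>1 \<le> C\<close> L0 by auto
  ultimately show ?thesis
    using upper unfolding equivalent_sequences_def by blast
qed

subsection \<open>Signed sums\<close>

text \<open>Signed sums are lists because partial sums are prefixes and the construction
  concatenates.\<close>

definition svec :: "(nat \<Rightarrow> 'a::real_normed_vector) \<Rightarrow> (nat \<times> real) list \<Rightarrow> 'a"
  where "svec x l = (\<Sum>(m, s)\<leftarrow>l. s *\<^sub>R x m)"

definition flip :: "(nat \<times> real) list \<Rightarrow> (nat \<times> real) list"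
  where "flip l = map (\<lambda>(m, s). (m, - s)) l"

lemma svec_simps [simp]:
  "svec x [] = 0" "svec x (p # l) = snd p *\<^sub>R x (fst p) + svec x l"
  "svec x (l @ l') = svec x l + svec x l'"
  by (auto simp: svec_def case_prod_beta)

lemma svec_flip [simp]: "svec x (flip l) = - svec x l"
  by (induction l) (auto simp: flip_def)

lemma map_fst_flip [simp]: "map fst (flip l) = map fst l"
  by (auto simp: flip_def)

lemma svec_eq_sum:
  "\<exists>a. (\<forall>N. (\<forall>p\<in>set l. fst p < N) \<longrightarrow> svec x l = (\<Sum>i<N. a i *\<^sub>R x i)) \<and> (\<forall>i. i \<notin> fst ` set l \<longrightarrow> a i = 0)"
  proof (induction l)
    case Nil
    then show ?case by (intro exI[of _ "\<lambda>_. 0"]) auto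
  next
    case (Cons p l)
    then obtain a where a: "\<And>N. (\<forall>p\<in>set l. fst p < N) \<Longrightarrow> svec x l = (\<Sum>i<N. a i *\<^sub>R x i)"
      "\<And>i. i \<notin> fst ` set l \<Longrightarrow> a i = 0" by blast
    define a' where "a' i = (if i = fst p then snd p else 0) + a i" for i
    have "svec x (p # l) = (\<Sum>i<N. a' i *\<^sub>R x i)" if N: "\<forall>q\<in>set (p # l). fst q < N" for N
    proof -
      have "(\<Sum>i<N. a' i *\<^sub>R x i) = (\<Sum>i<N. if i = fst p then snd p *\<^sub>R x i else 0) + (\<Sum>i<N. a i *\<^sub>R x i)"
        unfolding sum.distrib[symmetric] by (intro sum.cong) (auto simp: a'_def algebra_simps)
      then show ?thesis using N a(1)[of N] by simp
    qed
    then show ?case using a(2) by (intro exI[of _ a']) (auto simp: a'_def)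
  qed

text \<open>With \<open>b\<close> just above the coordinates of \<open>l\<close>, projecting the
  whole sum to the coordinates below \<open>b\<close> returns the sum of \<open>l\<close>.\<close>

lemma svec_prefix_le:
  fixes x :: "nat \<Rightarrow> 'a::real_normed_vector"
  assumes C: "\<And>a m n. m \<le> n \<Longrightarrow> norm (\<Sum>i<m. a i *\<^sub>R x i) \<le> C * norm (\<Sum>i<n. a i *\<^sub>R x i)"
    and sep: "\<And>p q. p \<in> set l \<Longrightarrow> q \<in> set l' \<Longrightarrow> fst p < fst q"
  shows "norm (svec x l) \<le> C * norm (svec x (l @ l'))"
proof -
  obtain a where a: "\<And>N. (\<forall>p\<in>set l. fst p < N) \<Longrightarrow> svec x l = (\<Sum>i<N. a i *\<^sub>R x i)"
    "\<And>i. i \<notin> fst ` set l \<Longrightarrow> a i = 0" using svec_eq_sum[of l x] by blast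
  obtain a' where a': "\<And>N. (\<forall>p\<in>set l'. fst p < N) \<Longrightarrow> svec x l' = (\<Sum>i<N. a' i *\<^sub>R x i)"
    "\<And>i. i \<notin> fst ` set l' \<Longrightarrow> a' i = 0" using svec_eq_sum[of l' x] by blast
  define b where "b = Max (insert 0 (Suc ` fst ` set l))"
  define N where "N = Max (insert b (Suc ` fst ` set l'))"
  have lb: "fst p < b" if "p \<in> set l" for p
    unfolding b_def Suc_le_eq[symmetric] using that by (intro Max_ge) auto
  have lN: "fst p < N" if "p \<in> set l'" for p
    unfolding N_def Suc_le_eq[symmetric] using that by (intro Max_ge) auto
  have bN: "b \<le> N" unfolding N_def by (intro Max_ge) auto
  have bl': "b \<le> fst q" if "q \<in> set l'" for q
    unfolding b_def using sep that by (subst Max_le_iff) (auto simp: Suc_le_eq)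
  have a'0: "a' i = 0" if "i < b" for i
    using bl' that by (intro a'(2)) fastforce
  have 1: "svec x l = (\<Sum>i<b. (a i + a' i) *\<^sub>R x i)"
    using a(1)[of b] lb a'0 by simp
  have "svec x (l @ l') = (\<Sum>i<N. (a i + a' i) *\<^sub>R x i)"
  proof -
    have "\<forall>p\<in>set l. fst p < N" using lb bN by (meson less_le_trans)
    then show ?thesis
      using a(1)[of N] a'(1)[of N] lN by (simp add: scaleR_left_distrib sum.distrib)
  qed
  then show ?thesis unfolding 1 using C[OF bN] by simp
qed

lemma svec_in_span:
  "(\<And>p. p \<in> set l \<Longrightarrow> fst p \<in> A) \<Longrightarrow> svec x l \<in> span (x ` A)"
  by (induction l) (simp_all add: span_zero span_add span_scale span_base)

section \<open>Infinite branches of trees of finite sequences\<close>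

lemma list_branch:
  assumes "P []" "\<And>l. P l \<Longrightarrow> \<exists>c. P (l @ [c])"
  obtains f where "\<And>n. P (map f [0..<n])"
proof -
  obtain F where F: "\<And>n. P (F n) \<and> length (F n) = n" "\<And>n. \<exists>c. F (Suc n) = F n @ [c]"
    using dependent_nat_choice[of "\<lambda>n l. P l \<and> length l = n" "\<lambda>_ l l'. \<exists>c. l' = l @ [c]"] assms
    by (metis length_0_conv length_append_singleton)
  define f where "f n = F (Suc n) ! n" for n
  have "F n = map f [0..<n]" for n
  proof (induction n)
    case 0
    then show ?case using F(1)[of 0] by simp
  next
    case (Suc n)
    obtain c where c: "F (Suc n) = F n @ [c]" using F(2) by blast
    then have "f n = c" using F(1)[of n] by (simp add: f_def nth_append)
    then show ?case using Suc c by simp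
  qed
  then have "P (map f [0..<n])" for n using F(1) by metis
  then show ?thesis by (rule that)
qed

lemma Koenig:
  fixes P :: "'b list \<Rightarrow> bool"
  assumes prefix: "\<And>l n. P l \<Longrightarrow> P (take n l)"
    and fin: "\<And>i. finite (A i)"
    and ex: "\<And>n. \<exists>l. P l \<and> length l = n \<and> (\<forall>i<n. l ! i \<in> A i)"
  obtains f where "\<And>n. P (map f [0..<n])"
proof -
  define G where "G p \<longleftrightarrow> (\<forall>n\<ge>length p. \<exists>l. P l \<and> length l = n \<and> (\<forall>i<n. l ! i \<in> A i) \<and> take (length p) l = p)" for p
  have "G []" using ex by (simp add: G_def)
  moreover have "\<exists>c. G (p @ [c])" if p: "G p" for p
  proof (rule ccontr)
    define m where "m = length p"
    assume "\<not> ?thesis"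
    then have "\<forall>c. \<exists>n\<ge>Suc m. \<not> (\<exists>l. P l \<and> length l = n \<and> (\<forall>i<n. l ! i \<in> A i) \<and> take (Suc m) l = p @ [c])"
      by (simp add: G_def m_def)
    then obtain N where N: "\<And>c. Suc m \<le> N c"
      "\<And>c. \<not> (\<exists>l. P l \<and> length l = N c \<and> (\<forall>i<N c. l ! i \<in> A i) \<and> take (Suc m) l = p @ [c])" by metis
    \<comment> \<open>A list at least as long as all bounds \<open>N c\<close> refutes, once
      truncated, the bound belonging to its own entry at place \<open>m\<close>.\<close>
    define K where "K = Max (insert (Suc m) (N ` A m))"
    have K: "Suc m \<le> K" "\<And>c. c \<in> A m \<Longrightarrow> N c \<le> K"
      using fin[of m] by (auto simp: K_def)
    have "m \<le> K" using K(1) by simp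
    then obtain l where l: "P l" "length l = K" "\<forall>i<K. l ! i \<in> A i" "take m l = p"
      using p unfolding G_def m_def by blast
    define c where "c = l ! m"
    have c: "c \<in> A m" using l K(1) by (simp add: c_def)
    have "take (Suc m) (take (N c) l) = p @ [c]"
      using l(2,4) K(1) N(1)[of c] by (simp add: min_def take_Suc_conv_app_nth c_def)
    moreover have "length (take (N c) l) = N c" "\<forall>i<N c. take (N c) l ! i \<in> A i"
      using l K(2)[OF c] by auto
    ultimately show False using N(2)[of c] prefix[OF l(1), of "N c"] by blast
  qed
  ultimately obtain f where f: "\<And>n. G (map f [0..<n])"
    using list_branch[of G] by blast
  have "P (map f [0..<n])" for n
    using f[of n] unfolding G_def by (metis diff_zero le_refl length_map length_upt take_all)
  then show ?thesis by (rule that)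
qed

subsection \<open>The layered construction\<close>

definition admissible :: "(nat \<Rightarrow> 'a::real_normed_vector) \<Rightarrow> nat set \<Rightarrow> real \<Rightarrow> (nat \<times> real) list \<Rightarrow> bool"
  where "admissible x M L l \<longleftrightarrow> sorted_wrt (<) (map fst l) \<and>
    (\<forall>p\<in>set l. fst p \<in> M \<and> (snd p = 1 \<or> snd p = - 1)) \<and> (\<forall>n. norm (svec x (take n l)) \<le> L)"

definition majorizing :: "(nat \<Rightarrow> 'a::real_normed_vector) \<Rightarrow> nat set \<Rightarrow> real \<Rightarrow> nat list \<Rightarrow> bool"
  where "majorizing x M L t \<longleftrightarrow>
    (\<exists>l. admissible x M L l \<and> length l = length t \<and> (\<forall>i<length t. fst (l ! i) \<le> t ! i))"

text \<open>The markers \<open>a\<close> only encode the rank of the construction; they contribute no coordinates.\<close>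

inductive layered :: "(nat \<Rightarrow> 'a::real_normed_vector) \<Rightarrow> nat set \<Rightarrow> real \<Rightarrow> nat list \<Rightarrow> nat \<Rightarrow> (nat \<times> real) list \<Rightarrow> bool"
  for x M L where
  leaf: "\<not> majorizing x M L t \<Longrightarrow> b \<le> m \<Longrightarrow> m \<in> M \<Longrightarrow> layered x M L t b [(m, 1)]"
| node: "majorizing x M L t \<Longrightarrow> b \<le> a \<Longrightarrow> layered x M L (t @ [a]) a l1 \<Longrightarrow>
    layered x M L (t @ [a]) b2 l2 \<Longrightarrow> (\<And>p. p \<in> set l1 \<Longrightarrow> fst p < b2) \<Longrightarrow>
    layered x M L t b (l1 @ flip l2)"

lemma admissible_take: "admissible x M L l \<Longrightarrow> admissible x M L (take n l)"
  unfolding admissible_def by (auto simp: take_map[symmetric] sorted_wrt_take dest: in_set_takeD)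

lemma layered_props:
  assumes "layered x M L t b l"
  shows "l \<noteq> []" "\<And>p. p \<in> set l \<Longrightarrow> b \<le> fst p" "sorted_wrt (<) (map fst l)"
    "\<And>p. p \<in> set l \<Longrightarrow> fst p \<in> M \<and> (snd p = 1 \<or> snd p = - 1)"
proof -
  have "l \<noteq> [] \<and> (\<forall>p\<in>set l. b \<le> fst p) \<and> sorted_wrt (<) (map fst l) \<and>
      (\<forall>p\<in>set l. fst p \<in> M \<and> (snd p = 1 \<or> snd p = - 1))"
    using assms
  proof induction
    case (leaf t b m)
    then show ?case by simp
  next
    case (node t b a l1 b2 l2)
    have "fst p < fst q" if "p \<in> set l1" "q \<in> set l2" for p q
      using node.hyps(5)[OF that(1)] node.IH(2) that(2) by fastforce
    moreover have "b \<le> fst p" if "p \<in> set l1" for p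
      using node.IH(1) node.hyps(2) that by fastforce
    moreover from this have "b \<le> fst q" if "q \<in> set l2" for q
      using node.hyps(5) node.IH that by (metis dual_order.trans last_in_set less_imp_le)
    ultimately show ?case
      using node.IH by (auto simp: sorted_wrt_append flip_def comp_def case_prod_beta)
  qed
  then show "l \<noteq> []" "\<And>p. p \<in> set l \<Longrightarrow> b \<le> fst p" "sorted_wrt (<) (map fst l)"
    "\<And>p. p \<in> set l \<Longrightarrow> fst p \<in> M \<and> (snd p = 1 \<or> snd p = - 1)" by blast+
qed

lemma layered_mono:
  assumes "layered x M L t b l" "b' \<le> b"
  shows "layered x M L t b' l"
  using assms(1)
proof cases
  case (leaf m)
  then show ?thesis using assms(2) layered.leaf[of x M L t b' m] by simp
next
  case (node a l1 b2 l2)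
  have "b' \<le> a" using node(3) assms(2) by simp
  then show ?thesis unfolding node(1) by (rule layered.node[OF node(2) _ node(4-6)])
qed

text \<open>Following the second components downwards, the markers always exceed the coordinates already
  played, so that the path of markers stays majorizing and never reaches a leaf.\<close>

lemma layered_not_admissible:
  assumes "layered x M L t b l" "length t < length g" "\<And>i. i < length t \<Longrightarrow> g ! i \<le> t ! i"
    "\<And>m. m \<in> set g \<Longrightarrow> m < b" "admissible x M L l'" "map fst l' = g @ map fst l"
  shows False
  using assms
proof (induction arbitrary: g rule: layered.induct)
  case (leaf t b m)
  have len: "length t < length l'"
    using leaf.prems(1) arg_cong[OF leaf.prems(5), of length] by simp
  have "fst (l' ! i) = g ! i" if "i < length t" for i
    using leaf.prems(1) that len arg_cong[OF leaf.prems(5), of "\<lambda>l. l ! i"] by (simp add: nth_append)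
  then have "majorizing x M L t"
    unfolding majorizing_def using admissible_take[OF leaf.prems(4), of "length t"] len leaf.prems(2)
    by (intro exI[of _ "take (length t) l'"]) auto
  then show False using leaf.hyps by simp
next
  case (node t b a l1 b2 l2)
  \<comment> \<open>The descent goes to \<open>l2\<close>, with \<open>l1\<close> added to the
    coordinates already played. Since \<open>l1\<close> is nonempty they stay more numerous than the
    markers, and the new marker \<open>a\<close> is compared with an element of \<open>g\<close>,
    which lies below \<open>b\<close>.\<close>
  show False
  proof (rule node.IH(2)[of "g @ map fst l1"])
    show "length (t @ [a]) < length (g @ map fst l1)"
      using node.prems(1) layered_props(1)[OF node.hyps(3)] by (cases l1) auto
    show "(g @ map fst l1) ! i \<le> (t @ [a]) ! i" if "i < length (t @ [a])" for i
    proof (cases "i = length t")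
      case True
      then have "g ! i < b" using node.prems(1,3) by simp
      then show ?thesis using True node.prems(1) node.hyps(2) by (simp add: nth_append)
    next
      case False
      then show ?thesis using that node.prems(1,2) by (simp add: nth_append)
    qed
    show "m < b2" if "m \<in> set (g @ map fst l1)" for m
    proof (cases "m \<in> set g")
      case True
      obtain p where p: "p \<in> set l1" using layered_props(1)[OF node.hyps(3)] by (cases l1) auto
      have "m < b" "a \<le> fst p" "fst p < b2"
        using node.prems(3)[OF True] layered_props(2)[OF node.hyps(3) p] node.hyps(5)[OF p] by auto
      then show ?thesis using node.hyps(2) by linarith
    qed (use that node.hyps(5) in auto)
    show "map fst l' = (g @ map fst l1) @ map fst l2" using node.prems(5) by simp
  qed (rule node.prems(4))
qed

text \<open>Each list is finite and starts at or beyond its index, so a sparse subsequence consists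
  of successive blocks. Their norms are at least 1 / C because the first coordinate alone is a
  prefix of norm 1.\<close>

lemma layered_close_pair:
  fixes x :: "nat \<Rightarrow> 'a::real_normed_vector"
  assumes C: "\<And>a m n. m \<le> n \<Longrightarrow> norm (\<Sum>i<m. a i *\<^sub>R x i) \<le> C * norm (\<Sum>i<n. a i *\<^sub>R x i)"
    and "1 \<le> C" and x1: "\<And>i. norm (x i) = 1"
    and sm: "\<And>y (e :: nat \<Rightarrow> ell_infty). block_basis x y \<Longrightarrow> normalized y \<Longrightarrow> weakly_null y \<Longrightarrow>
      spreading_model y e \<Longrightarrow> norm (e 0 - e 1) = 1"
    and F: "\<And>i. layered x M L t i (F i)" "\<And>i. norm (svec x (F i)) \<le> K" "weakly_null (\<lambda>i. svec x (F i))"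
    and "0 < \<eta>"
  shows "\<exists>i j. b \<le> i \<and> (\<forall>p\<in>set (F i). fst p < j) \<and> norm (svec x (F i) - svec x (F j)) \<le> K + \<eta>"
proof -
  have "\<exists>j>i. \<forall>p\<in>set (F i). fst p < j" for i
  proof -
    obtain n where "fst ` set (F i) \<subseteq> {..<n}" using finite_nat_iff_bounded by blast
    then show ?thesis by (intro exI[of _ "max n (Suc i)"]) auto
  qed
  then obtain N where N: "\<And>i. i < N i" "\<And>i p. p \<in> set (F i) \<Longrightarrow> fst p < N i" by metis
  define q where "q = rec_nat b (\<lambda>_. N)"
  have q: "q 0 = b" "\<And>k. q (Suc k) = N (q k)" by (simp_all add: q_def)
  have q_mono: "strict_mono q" by (rule strict_monoI_Suc) (simp add: q N(1))
  define u where "u k = svec x (F (q k))" for k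
  have "\<exists>k k'. 0 \<le> k \<and> k < k' \<and> norm (u k - u k') \<le> K + \<eta>"
  proof (rule close_pair_in_weakly_null_blocks[where c = "1 / C" and C = C and x = x])
    show "norm (\<Sum>i<m. a i *\<^sub>R x i) \<le> C * norm (\<Sum>i<n. a i *\<^sub>R x i)" if "m \<le> n" for a m n
      by (rule C[OF that])
    show "norm (e 0 - e 1) = 1" if "block_basis x y" "normalized y" "weakly_null y" "spreading_model y e"
      for y and e :: "nat \<Rightarrow> ell_infty"
      by (rule sm[OF that])
    show "successive_blocks x u"
      unfolding successive_blocks_def
    proof (intro exI[of _ q] conjI allI q_mono)
      show "u k \<in> span (x ` {q k..<q (Suc k)})" for k
        unfolding u_def using layered_props(2)[OF F(1)] N(2) by (intro svec_in_span) (auto simp: q)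
    qed
    show "weakly_null u"
      unfolding u_def[abs_def] by (rule weakly_null_compose[OF F(3) filterlim_subseq[OF q_mono]])
    show "1 / C \<le> norm (u k)" for k
    proof -
      note props = layered_props[OF F(1)[of "q k"]]
      obtain p l where l: "F (q k) = p # l" using props(1) by (cases "F (q k)") auto
      have "norm (svec x [p]) \<le> C * norm (svec x ([p] @ l))"
        by (rule svec_prefix_le[OF C]) (use props(3) l in auto)
      moreover have "norm (svec x [p]) = 1" using props(4)[of p] l x1 by auto
      ultimately show ?thesis using \<open>1 \<le> C\<close> by (simp add: u_def l field_simps)
    qed
    show "norm (u k) \<le> K" for k by (simp add: u_def F(2))
    show "0 < 1 / C" using \<open>1 \<le> C\<close> by simp
  qed (use \<open>0 < \<eta>\<close> in auto)
  then obtain k k' where k: "k < k'" "norm (u k - u k') \<le> K + \<eta>" by blast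
  have "b \<le> q k" using q_mono q(1) by (metis strict_mono_less_eq zero_le)
  moreover have "q (Suc k) \<le> q k'" using k(1) q_mono by (simp add: strict_mono_less_eq Suc_leI)
  then have "\<forall>p\<in>set (F (q k)). fst p < q k'" using N(2) by (auto simp: q dest: less_le_trans)
  ultimately show ?thesis using k(2) unfolding u_def by blast
qed

text \<open>Every \<open>K > 1\<close> is demanded, since a node of infinite rank cannot share out a
  fixed error among its descendants. The lower bound \<open>i\<close> for the coordinates makes the
  lists move to infinity.\<close>

definition layer_ok :: "(nat \<Rightarrow> 'a::real_normed_vector) \<Rightarrow> nat set \<Rightarrow> real \<Rightarrow> nat list \<Rightarrow> bool"
  where "layer_ok x M L t \<longleftrightarrow> (\<forall>K>1. \<exists>F. (\<forall>i. layered x M L t i (F i)) \<and>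
    (\<forall>i. norm (svec x (F i)) \<le> K) \<and> weakly_null (\<lambda>i. svec x (F i)))"

lemma filterlim_nat_ge:
  assumes "\<And>i::nat. i \<le> k i"
  shows "filterlim k sequentially sequentially"
  using assms by (intro filterlim_at_top_mono[OF filterlim_ident]) auto

lemma layer_ok_leaf:
  assumes "\<not> majorizing x M L t" "infinite M" "\<And>i. norm (x i) = 1" "weakly_null x"
  shows "layer_ok x M L t"
  unfolding layer_ok_def
proof (intro allI impI)
  fix K :: real assume "1 < K"
  have "\<exists>m. i \<le> m \<and> m \<in> M" for i using assms(2) by (meson infinite_nat_iff_unbounded_le)
  then obtain h where h: "\<And>i. i \<le> h i" "\<And>i. h i \<in> M" by metis
  have "weakly_null (\<lambda>i. x (h i))"
    by (rule weakly_null_compose[OF assms(4) filterlim_nat_ge[OF h(1)]])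
  then show "\<exists>F. (\<forall>i. layered x M L t i (F i)) \<and> (\<forall>i. norm (svec x (F i)) \<le> K) \<and> weakly_null (\<lambda>i. svec x (F i))"
    using assms(1,3) h \<open>1 < K\<close> by (intro exI[of _ "\<lambda>i. [(h i, 1)]"]) (auto intro: layered.leaf)
qed

text \<open>Row \<open>a\<close> consists of differences of close pairs from child \<open>a\<close>.
  Taking them beyond \<open>a\<close> meets the condition on the marker, taking them beyond
  \<open>n\<close> keeps the row weakly null; the diagonal uses rows \<open>a k \<ge> k\<close>, so
  its lists again start at or beyond \<open>k\<close>.\<close>

lemma layer_ok_node:
  fixes x :: "nat \<Rightarrow> 'a::banach"
  assumes C: "\<And>a m n. m \<le> n \<Longrightarrow> norm (\<Sum>i<m. a i *\<^sub>R x i) \<le> C * norm (\<Sum>i<n. a i *\<^sub>R x i)"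
    and C1: "1 \<le> C" and x1: "\<And>i. norm (x i) = 1"
    and sm: "\<And>y (e :: nat \<Rightarrow> ell_infty). block_basis x y \<Longrightarrow> normalized y \<Longrightarrow> weakly_null y \<Longrightarrow>
      spreading_model y e \<Longrightarrow> norm (e 0 - e 1) = 1"
    and l1: "\<not> ell1_embeds_into TYPE('a)"
    and t: "majorizing x M L t" "\<And>a. layer_ok x M L (t @ [a])"
  shows "layer_ok x M L t"
  unfolding layer_ok_def
proof (intro allI impI)
  fix K :: real assume K: "1 < K"
  \<comment> \<open>The midpoint leaves \<open>K - K'\<close> for the passage to
    differences.\<close>
  define K' where "K' = (1 + K) / 2"
  have K': "1 < K'" "0 < K - K'" using K by (auto simp: K'_def)
  have "\<exists>F. (\<forall>i. layered x M L (t @ [a]) i (F i)) \<and>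
      (\<forall>i. norm (svec x (F i)) \<le> K') \<and> weakly_null (\<lambda>i. svec x (F i))" for a
    using t(2)[of a] K'(1) unfolding layer_ok_def by blast
  then obtain F where F: "\<And>a i. layered x M L (t @ [a]) i (F a i)"
    "\<And>a i. norm (svec x (F a i)) \<le> K'" "\<And>a. weakly_null (\<lambda>i. svec x (F a i))" by metis
  have "\<exists>i j. max a n \<le> i \<and> (\<forall>p\<in>set (F a i). fst p < j) \<and>
      norm (svec x (F a i) - svec x (F a j)) \<le> K' + (K - K')" for a n
    by (rule layered_close_pair[OF C C1 x1 sm F K'(2)])
  then obtain I J where IJ: "\<And>a n. max a n \<le> I a n" "\<And>a n p. p \<in> set (F a (I a n)) \<Longrightarrow> fst p < J a n"
    "\<And>a n. norm (svec x (F a (I a n)) - svec x (F a (J a n))) \<le> K"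
    by (metis add_diff_cancel_left' add_diff_eq)
  define u where "u a n = svec x (F a (I a n)) - svec x (F a (J a n))" for a n
  have "n \<le> J a n" for a n
  proof -
    obtain p where "p \<in> set (F a (I a n))" using layered_props(1)[OF F(1)] by (meson last_in_set)
    then show ?thesis
      using layered_props(2)[OF F(1)] IJ(2)[of p a n] IJ(1)[of a n] by fastforce
  qed
  moreover have "n \<le> I a n" for a n using IJ(1)[of a n] by simp
  ultimately have un: "weakly_null (u a)" for a
    unfolding u_def[abs_def]
    by (intro weakly_null_diff weakly_null_compose[OF F(3)] filterlim_nat_ge)
  have uK: "norm (u a n) \<le> K" for a n unfolding u_def by (rule IJ(3))
  obtain a n where a: "strict_mono a" "weakly_null (\<lambda>k. u (a k) (n k))"
    by (rule diagonal_weakly_null[OF l1, of u K, OF uK un]) (rule that)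
  define G where "G k = F (a k) (I (a k) (n k)) @ flip (F (a k) (J (a k) (n k)))" for k
  have G: "svec x (G k) = u (a k) (n k)" for k by (simp add: G_def u_def)
  have "layered x M L t k (G k)" for k
    unfolding G_def
  proof (rule layered.node[OF t(1)])
    show "k \<le> a k" using a(1) by (rule strict_mono_imp_increasing)
    show "layered x M L (t @ [a k]) (a k) (F (a k) (I (a k) (n k)))"
      using IJ(1)[of "a k" "n k"] by (intro layered_mono[OF F(1)]) simp
    show "layered x M L (t @ [a k]) (J (a k) (n k)) (F (a k) (J (a k) (n k)))" by (rule F(1))
  qed (rule IJ(2))
  moreover have "norm (svec x (G k)) \<le> K" for k unfolding G u_def by (rule IJ(3))
  ultimately show "\<exists>F. (\<forall>i. layered x M L t i (F i)) \<and> (\<forall>i. norm (svec x (F i)) \<le> K) \<and> weakly_null (\<lambda>i. svec x (F i))"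
    using a(2) by (intro exI[of _ G]) (simp add: G)
qed

lemma svec_map_upt: "svec x (map f [0..<n]) = (\<Sum>i<n. snd (f i) *\<^sub>R x (fst (f i)))"
  by (induction n) auto

theorem theorem4p1:
  fixes x :: "nat \<Rightarrow> 'a::banach"
  assumes "schauder_basis_of UNIV x"
    and "normalized x"
    and "weakly_null x"
    and "\<not> ell1_embeds_into TYPE('a)"
    and "\<And>y (e :: nat \<Rightarrow> ell_infty).
           block_basis x y \<Longrightarrow> normalized y \<Longrightarrow> weakly_null y \<Longrightarrow> spreading_model y e
           \<Longrightarrow> norm (e 0 - e 1) = 1"
  shows "\<exists>r :: nat \<Rightarrow> nat. strict_mono r \<and> equivalent_sequences (x \<circ> r) c0_unit"
proof (rule ccontr)
  assume no_c0: "\<not> ?thesis"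
  obtain C where C1: "1 \<le> C"
    and C: "\<And>a m n. m \<le> n \<Longrightarrow> norm (\<Sum>i<m. a i *\<^sub>R x i) \<le> C * norm (\<Sum>i<n. a i *\<^sub>R x i)"
    using schauder_basis_constant[OF assms(1)] by blast
  have x1: "norm (x i) = 1" for i using assms(2) by (simp add: normalized_def)
  \<comment> \<open>Otherwise the enumeration of \<open>M\<close> would give a subsequence
    equivalent to the unit vector basis.\<close>
  have big: "\<exists>F\<subseteq>M. finite F \<and> L < norm (\<Sum>i\<in>F. x i)" if M: "infinite M" for M L
  proof (rule ccontr)
    assume no: "\<not> ?thesis"
    have r: "strict_mono (enumerate M)" "range (enumerate M) \<subseteq> M"
      using M by (auto simp: strict_mono_enumerate enumerate_in_set)
    have "equivalent_sequences (x \<circ> enumerate M) c0_unit"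
    proof (rule equivalent_c0_unitI[OF C C1 x1 r(1), of L])
      fix F assume "finite F" "F \<subseteq> range (enumerate M)"
      then have "finite F" "F \<subseteq> M" using r(2) by auto
      then show "norm (\<Sum>i\<in>F. x i) \<le> L" using no not_le by blast
    qed
    then show False using no_c0 r(1) by blast
  qed
  define L where "L = 2 * C"
  obtain M where M: "infinite M"
    and Elton: "\<And>(k :: nat \<Rightarrow> nat) \<sigma>. strict_mono k \<Longrightarrow> range k \<subseteq> M \<Longrightarrow> (\<And>i. \<sigma> i = 1 \<or> \<sigma> i = - 1) \<Longrightarrow>
      \<exists>n. L < norm (\<Sum>i<n. \<sigma> i *\<^sub>R x (k i))"
    by (rule Elton_sign_sums[OF assms(3) big]) blast+
  have node: "layer_ok x M L t" if "majorizing x M L t" "\<And>a. layer_ok x M L (t @ [a])" for t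
    by (rule layer_ok_node[OF C C1 x1 assms(5,4) that])
  have "layer_ok x M L []"
  proof (rule ccontr)
    assume "\<not> layer_ok x M L []"
    moreover have "\<exists>a. \<not> layer_ok x M L (t @ [a])" if "\<not> layer_ok x M L t" for t
      using that layer_ok_leaf[OF _ M x1 assms(3)] node by blast
    ultimately obtain \<alpha> where \<alpha>: "\<And>n. \<not> layer_ok x M L (map \<alpha> [0..<n])"
      using list_branch[of "\<lambda>t. \<not> layer_ok x M L t"] by blast
    \<comment> \<open>Leaves are good, so a branch of bad nodes meets no leaf.\<close>
    then have maj: "majorizing x M L (map \<alpha> [0..<n])" for n
      using layer_ok_leaf[OF _ M x1 assms(3)] by blast
    obtain f where f: "\<And>n. admissible x M L (map f [0..<n])"
    \<comment> \<open>The bound \<open>\<alpha> i\<close> on the coordinate and the two signs leave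
      finitely many choices at each level.\<close>
    proof (rule Koenig[of "admissible x M L" "\<lambda>i. {..\<alpha> i} \<times> {1, - 1}"])
      show "\<exists>l. admissible x M L l \<and> length l = n \<and> (\<forall>i<n. l ! i \<in> {..\<alpha> i} \<times> {1, - 1})" for n
      proof -
        obtain l where l: "admissible x M L l" "length l = n" "\<And>i. i < n \<Longrightarrow> fst (l ! i) \<le> \<alpha> i"
          using maj[of n] unfolding majorizing_def by auto
        have "snd (l ! i) = 1 \<or> snd (l ! i) = - 1" if "i < n" for i
          using l(1,2) that unfolding admissible_def by (metis nth_mem)
        then show ?thesis using l by (intro exI[of _ l]) (auto simp: mem_Times_iff)
      qed
    qed (auto intro: admissible_take)
    have "\<exists>n. L < norm (\<Sum>i<n. snd (f i) *\<^sub>R x (fst (f i)))"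
    proof (rule Elton)
      show "strict_mono (\<lambda>i. fst (f i))"
      proof (rule strict_monoI_Suc)
        show "fst (f i) < fst (f (Suc i))" for i
          using f[of "Suc (Suc i)"] by (auto simp: admissible_def sorted_wrt_append)
      qed
      show "range (\<lambda>i. fst (f i)) \<subseteq> M" "snd (f i) = 1 \<or> snd (f i) = - 1" for i
        using f[of "Suc _"] by (auto simp: admissible_def)
    qed
    then obtain n where "L < norm (svec x (map f [0..<n]))" by (auto simp: svec_map_upt)
    moreover have "norm (svec x (take n (map f [0..<n]))) \<le> L"
      using f[of n] unfolding admissible_def by blast
    ultimately show False by simp
  qed
  \<comment> \<open>The bound 3 / 2 leaves 1 / 2 for the last difference, whose norm is then at most
    2 and whose prefixes are bounded by L = 2 C.\<close>
  moreover have "1 < (3 / 2 :: real)" by simp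
  ultimately have "\<exists>F. (\<forall>i. layered x M L [] i (F i)) \<and> (\<forall>i. norm (svec x (F i)) \<le> 3 / 2) \<and>
      weakly_null (\<lambda>i. svec x (F i))"
    unfolding layer_ok_def by blast
  then obtain F where F: "\<And>i. layered x M L [] i (F i)" "\<And>i. norm (svec x (F i)) \<le> 3 / 2"
    "weakly_null (\<lambda>i. svec x (F i))" by blast
  have half: "0 < (1 / 2 :: real)" by simp
  have "\<exists>i j. 0 \<le> i \<and> (\<forall>p\<in>set (F i). fst p < j) \<and> norm (svec x (F i) - svec x (F j)) \<le> 3 / 2 + 1 / 2"
    by (rule layered_close_pair[OF C C1 x1 assms(5) F half])
  then obtain i j where ij: "\<And>p. p \<in> set (F i) \<Longrightarrow> fst p < j" "norm (svec x (F i) - svec x (F j)) \<le> 3 / 2 + 1 / 2"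
    by blast
  define l where "l = F i @ flip (F j)"
  note Fi = layered_props[OF F(1)[of i]] and Fj = layered_props[OF F(1)[of j]]
  have sorted: "sorted_wrt (<) (map fst l)"
    using Fi(3) Fj(2,3) ij(1) by (fastforce simp: l_def sorted_wrt_append)
  have "admissible x M L l"
    unfolding admissible_def
  proof (intro conjI ballI allI sorted)
    show "fst p \<in> M" "snd p = 1 \<or> snd p = - 1" if "p \<in> set l" for p
    proof -
      have "fst p \<in> M \<and> (snd p = 1 \<or> snd p = - 1)"
      proof (cases "p \<in> set (F i)")
        case False
        then have "(fst p, - snd p) \<in> set (F j)" using that by (auto simp: l_def flip_def)
        from Fj(4)[OF this] show ?thesis by auto
      qed (rule Fi(4))
      then show "fst p \<in> M" "snd p = 1 \<or> snd p = - 1" by blast+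
    qed
    show "norm (svec x (take n l)) \<le> L" for n
    proof -
      have "norm (svec x (take n l)) \<le> C * norm (svec x (take n l @ drop n l))"
      proof (rule svec_prefix_le[OF C])
        show "fst p < fst q" if "p \<in> set (take n l)" "q \<in> set (drop n l)" for p q
        proof -
          have "sorted_wrt (<) (map fst (take n l) @ map fst (drop n l))"
            using sorted by (simp flip: map_append)
          then show ?thesis using that by (simp add: sorted_wrt_append)
        qed
      qed
      also have "\<dots> \<le> C * 2"
        unfolding append_take_drop_id using ij(2) C1 by (intro mult_left_mono) (auto simp: l_def)
      finally show ?thesis by (simp add: L_def)
    qed
  qed
  moreover have "map fst l = map fst (F i) @ map fst (F j)" by (simp add: l_def)
  moreover have "m < j" if "m \<in> set (map fst (F i))" for m
    using that ij(1) by auto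
  \<comment> \<open>At the root the path of markers is empty, and the nonempty list of coordinates
    of \<open>F i\<close> counts as already played.\<close>
  ultimately show False
    using layered_not_admissible[OF F(1)[of j], of "map fst (F i)" l] Fi(1) by simp
qed

end
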